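(* Let $F$ be a field, $S=F[x_0,\dots,x_n]$, let $M$ be a finitely generated graded $S$-module generated in degree $0$, and let $I\subset S$ be a homogeneous ideal generated by forms of degree $d$. If $M/IM$ has finite length, but $M$ does not, then we may write (for integers $t\ge 1$) \begin{enumerate} \item $\operatorname{reg} M/I^tM = dt+f_t-1$, with $f_1\geq f_2\geq\cdots\geq 0$; \item $\operatorname{reg} I^tM = dt+e_t$, with $e_1\geq e_2\geq\cdots\geq 0$. \end{enumerate} Moreover, $e:=\inf\{e_t\}=\inf\{f_t\}$, and we have $\operatorname{reg} I^tM=dt+e$ for $t\gg 0$.
   Context: $S$ is the standard graded polynomial ring, and $\operatorname{reg}$ denotes the Castelnuovo-Mumford regularity of a finitely generated graded $S$-module. *)

theory Defs
  imports
    "HOL-Algebra.Module"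
    "HOL-Algebra.Ideal_Product"
    "HOL-Algebra.Algebraic_Closure_Type"
    "HOL-Library.Poly_Mapping"
    "HOL-Library.Extended_Real"
begin

text \<open>
  The polynomials \<open>F[x\<^sub>v : v \<in> 'v]\<close> over a field \<open>F = 'a\<close>: finitely supported functions from exponent
  vectors to coefficients. As \<open>'v\<close> ranges over the nonempty finite types, this covers
  \<open>F[x\<^sub>0, \<dots>, x\<^sub>n]\<close> for all \<open>n \<ge> 0\<close>, with \<open>n + 1 = CARD('v)\<close>.
\<close>

type_synonym ('a, 'v) mpol = "('v \<Rightarrow>\<^sub>0 nat) \<Rightarrow>\<^sub>0 'a"

abbreviation polyring :: "('a::field, 'v::finite) mpol ring"
  where "polyring \<equiv> ring_of_type_algebra"

text \<open>The forms of degree \<open>j\<close>, including \<open>0\<close>; only \<open>0\<close> has negative degree.\<close>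

definition forms :: "int \<Rightarrow> ('a::field, 'v::finite) mpol set"
  where "forms j = {p. \<forall>m\<in>Poly_Mapping.keys p. int (\<Sum>v\<in>UNIV. Poly_Mapping.lookup m v) = j}"


subsection \<open>Modules\<close>

definition generated_submodule ::
    "('r, 'x) ring_scheme \<Rightarrow> ('r, 'm, 'y) module_scheme \<Rightarrow> 'm set \<Rightarrow> 'm set"
  where "generated_submodule R M Y = (\<lambda>N. submodule N R M) hull Y"

definition finitely_generated :: "('r, 'x) ring_scheme \<Rightarrow> ('r, 'm, 'y) module_scheme \<Rightarrow> bool"
  where "finitely_generated R M \<longleftrightarrow>
    (\<exists>Y. finite Y \<and> Y \<subseteq> carrier M \<and> generated_submodule R M Y = carrier M)"

definition ideal_smult ::
    "('r, 'x) ring_scheme \<Rightarrow> 'r set \<Rightarrow> ('r, 'm, 'y) module_scheme \<Rightarrow> 'm set"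
  where "ideal_smult R I M =
    generated_submodule R M {a \<odot>\<^bsub>M\<^esub> x | a x. a \<in> I \<and> x \<in> carrier M}"

text \<open>\<open>I\<^sup>t M\<close>, with \<open>I\<^sup>t\<close> the power in the library's multiplicative monoid of ideals.\<close>

abbreviation power_smult ::
    "('a::field, 'v::finite) mpol set \<Rightarrow> nat \<Rightarrow> (('a, 'v) mpol, 'm, 'y) module_scheme \<Rightarrow> 'm set"
  where "power_smult I t M \<equiv> ideal_smult polyring (I [^]\<^bsub>ideals_set polyring\<^esub> t) M"

text \<open>
  The chain \<open>N 0 \<subset> \<dots> \<subset> N l\<close> is a composition series; its members need not be homogeneous.
\<close>

definition finite_length :: "('r, 'x) ring_scheme \<Rightarrow> ('r, 'm, 'y) module_scheme \<Rightarrow> bool"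
  where "finite_length R M \<longleftrightarrow>
    (\<exists>(N :: nat \<Rightarrow> 'm set) l.
       N 0 = {\<zero>\<^bsub>M\<^esub>} \<and> N l = carrier M \<and> (\<forall>i\<le>l. submodule (N i) R M) \<and>
       (\<forall>i<l. N i \<subset> N (Suc i) \<and> \<not> (\<exists>L. submodule L R M \<and> N i \<subset> L \<and> L \<subset> N (Suc i))))"


subsection \<open>Graded modules\<close>

record ('r, 'm) graded_module = "('r, 'm) module" +
  grade :: "int \<Rightarrow> 'm set"

locale graded_module = Module.module polyring M
  for M :: "(('a::field, 'v::finite) mpol, 'm) graded_module" (structure) +
  assumes grade_subgroup: "subgroup (grade M j) (add_monoid M)"
    and grade_smult:
      "\<lbrakk>p \<in> forms i; x \<in> grade M j\<rbrakk> \<Longrightarrow> p \<odot>\<^bsub>M\<^esub> x \<in> grade M (i + j)"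
    and grade_direct_sum:
      "x \<in> carrier M \<Longrightarrow>
        \<exists>!c. (\<forall>j. c j \<in> grade M j) \<and> finite {j. c j \<noteq> \<zero>\<^bsub>M\<^esub>} \<and>
             x = finsum M c {j. c j \<noteq> \<zero>\<^bsub>M\<^esub>}"

text \<open>
  Degrees in a submodule \<open>N\<close> and in a quotient \<open>M/N\<close> are inherited from \<open>M\<close>, without a shift. Both are
  meant for homogeneous \<open>N\<close>. The ring multiplication and unit, which every module record carries, play
  no role in a module.
\<close>

definition graded_sub :: "('r, 'm) graded_module \<Rightarrow> 'm set \<Rightarrow> ('r, 'm) graded_module"
  where "graded_sub M N = M\<lparr>carrier := N, grade := (\<lambda>j. grade M j \<inter> N)\<rparr>"

definition graded_quot :: "('r, 'm) graded_module \<Rightarrow> 'm set \<Rightarrow> ('r, 'm set) graded_module"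
  where "graded_quot M N =
    \<lparr>carrier = a_rcosets\<^bsub>M\<^esub> N,
     monoid.mult = undefined,
     one = undefined,
     ring.zero = N,
     add = set_add M,
     module.smult = (\<lambda>a Y. \<Union>x\<in>Y. N +>\<^bsub>M\<^esub> (a \<odot>\<^bsub>M\<^esub> x)),
     grade = (\<lambda>j. (\<lambda>x. N +>\<^bsub>M\<^esub> x) ` grade M j)\<rparr>"


subsection \<open>Minimal graded free resolutions and regularity\<close>

text \<open>
  The free module of rank \<open>r\<close> consists of the functions on \<open>nat\<close> that vanish outside \<open>{..<r}\<close>, and a
  homomorphism from rank \<open>r\<close> to rank \<open>s\<close> is given by its matrix: the entry \<open>A l k\<close> is the \<open>l\<close>-th
  coordinate of the image of the \<open>k\<close>-th basis element.
\<close>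

definition free_carrier :: "nat \<Rightarrow> (nat \<Rightarrow> ('a::field, 'v::finite) mpol) set"
  where "free_carrier r = {v. \<forall>k\<ge>r. v k = 0}"

definition free_map ::
    "nat \<Rightarrow> nat \<Rightarrow> (nat \<Rightarrow> nat \<Rightarrow> ('a::field, 'v::finite) mpol) \<Rightarrow>
     (nat \<Rightarrow> ('a, 'v) mpol) \<Rightarrow> nat \<Rightarrow> ('a, 'v) mpol"
  where "free_map r s A v = (\<lambda>l. if l < s then \<Sum>k<r. A l k * v k else 0)"

definition augmentation ::
    "(('a::field, 'v::finite) mpol, 'm) graded_module \<Rightarrow> nat \<Rightarrow> (nat \<Rightarrow> 'm) \<Rightarrow>
     (nat \<Rightarrow> ('a, 'v) mpol) \<Rightarrow> 'm"
  where "augmentation M r g v = finsum M (\<lambda>k. v k \<odot>\<^bsub>M\<^esub> g k) {..<r}"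

text \<open>
  The resolution is \<open>\<dots> \<rightarrow> F\<^sub>2 \<rightarrow> F\<^sub>1 \<rightarrow> F\<^sub>0 \<rightarrow> M \<rightarrow> 0\<close>, where \<open>F\<^sub>i\<close> is free of rank \<open>r i\<close> with \<open>k\<close>-th basis
  element in degree \<open>b i k\<close>, the map \<open>F\<^sub>i\<^sub>+\<^sub>1 \<rightarrow> F\<^sub>i\<close> has matrix \<open>A i\<close>, and \<open>F\<^sub>0 \<rightarrow> M\<close> sends the \<open>k\<close>-th basis
  element to \<open>g k\<close>. The conditions on \<open>g\<close> and on the entries of \<open>A\<close> say that all maps have degree \<open>0\<close>.
  Minimality means that the image of \<open>F\<^sub>i\<^sub>+\<^sub>1\<close> lies in \<open>(x\<^sub>v : v \<in> 'v) F\<^sub>i\<close>, that is, all matrix entries have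
  zero constant term.
\<close>

definition minimal_graded_free_resolution ::
    "(('a::field, 'v::finite) mpol, 'm) graded_module \<Rightarrow> (nat \<Rightarrow> nat) \<Rightarrow> (nat \<Rightarrow> nat \<Rightarrow> int) \<Rightarrow>
     (nat \<Rightarrow> 'm) \<Rightarrow> (nat \<Rightarrow> nat \<Rightarrow> nat \<Rightarrow> ('a, 'v) mpol) \<Rightarrow> bool"
  where "minimal_graded_free_resolution M r b g A \<longleftrightarrow>
    (\<forall>k<r 0. g k \<in> grade M (b 0 k)) \<and>
    (\<forall>i. \<forall>k<r (Suc i). \<forall>l<r i. A i l k \<in> forms (b (Suc i) k - b i l)) \<and>
    augmentation M (r 0) g ` free_carrier (r 0) = carrier M \<and>
    {v \<in> free_carrier (r 0). augmentation M (r 0) g v = \<zero>\<^bsub>M\<^esub>} =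
      free_map (r 1) (r 0) (A 0) ` free_carrier (r 1) \<and>
    (\<forall>i. {v \<in> free_carrier (r (Suc i)). free_map (r (Suc i)) (r i) (A i) v = (\<lambda>_. 0)} =
      free_map (r (Suc (Suc i))) (r (Suc i)) (A (Suc i)) ` free_carrier (r (Suc (Suc i)))) \<and>
    (\<forall>i. \<forall>k<r (Suc i). \<forall>l<r i. Poly_Mapping.lookup (A i l k) 0 = 0)"

text \<open>
  The Castelnuovo-Mumford regularity of a finitely generated graded module: the largest \<open>b - i\<close> such
  that \<open>F\<^sub>i\<close> has a basis element of degree \<open>b\<close>. Minimal resolutions are unique up to isomorphism, so the
  supremum over all of them is that of any one. The zero module has regularity \<open>-\<infinity>\<close>.
\<close>

definition reg :: "(('a::field, 'v::finite) mpol, 'm) graded_module \<Rightarrow> ereal"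
  where "reg M = Sup {ereal (real_of_int (b i k - int i)) | r b g A i k.
    minimal_graded_free_resolution M r b g A \<and> k < r i}"

end

theory Submission
  imports Defs "HOL-Library.Function_Algebras" "HOL-Library.Cardinality"
begin

text \<open>
  Regularity is read off Koszul homology: in a minimal resolution, the generators of \<open>F\<^sub>i\<close> of degree
  \<open>j\<close> correspond to the degree \<open>j\<close> part of \<open>H\<^sub>i(x; M)\<close>. Write \<open>M = F/U\<close> with \<open>F\<close> free of finite rank,
  generated in degree \<open>0\<close>, so that all modules become subquotients of \<open>F\<close> and homology can be taken
  relative to a submodule.

  A module of finite length has regularity equal to its largest nonzero degree, because its socle is
  the top Koszul homology. Hence \<open>reg M/I\<^sup>tM = dt + f\<^sub>t - 1\<close> says that \<open>M\<close> and \<open>I\<^sup>tM\<close> agree exactly above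
  degree \<open>dt + f\<^sub>t - 1\<close>; multiplication by \<open>I\<close> then gives \<open>f\<^sub>t \<ge> f\<^sub>t\<^sub>+\<^sub>1\<close>.

  For \<open>I\<^sup>tM\<close>, let \<open>H\<close> consist of the elements of \<open>M\<close> killed by a power of the irrelevant ideal. The two top
  Koszul homologies show that \<open>M = I\<^sup>tM + H\<close> in all degrees \<open>\<ge> reg I\<^sup>tM\<close>, and that \<open>I\<^sup>tM\<close> and \<open>H\<close> meet
  trivially in degrees \<open>> reg I\<^sup>tM\<close>. For \<open>t \<ge> 1\<close>, multiplying by \<open>I\<close> gives that \<open>I\<^sup>tM\<close> and \<open>I\<^sup>t\<^sup>+\<^sup>1M\<close> agree
  in degrees \<open>\<ge> reg I\<^sup>tM + d\<close>, and the long exact sequence yields \<open>reg I\<^sup>t\<^sup>+\<^sup>1M \<le> reg I\<^sup>tM + d\<close>. For large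
  \<open>t\<close> the module \<open>H\<close> vanishes in the degrees that matter, and the same comparison gives \<open>e\<^sub>t = f\<^sub>t\<close>.
\<close>

section \<open>Relative Koszul homology\<close>

text \<open>The definition of \<open>reg\<close> speaks of minimal resolutions, which are awkward to
  compare along an exact sequence; Koszul homology is independent of choices and can be handled
  element by element. Its two top degrees take the part that local cohomology in degrees 0 and 1
  would play. The bounds \<open>f\<^sub>t \<ge> 0\<close> and \<open>e\<^sub>t \<ge> 0\<close> come
  from degrees: \<open>I\<^sup>tM\<close> has nothing below degree \<open>dt\<close>, while a module
  generated in degree 0 that vanishes in one degree vanishes from there on and has finite length, so
  \<open>M\<close> is nonzero in every degree \<ge> 0, in particular in degree
  \<open>dt - 1\<close>. The shift by 1 between \<open>f\<^sub>t - 1\<close> and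
  \<open>e\<^sub>t\<close> is that of the connecting map from Tor_(i+1) of
  \<open>M/I\<^sup>tM\<close> to Tor_i of \<open>I\<^sup>tM\<close>. One obstacle is that
  composition series need not be homogeneous. To see that \<open>M/IM\<close> vanishes in large
  degrees, its composition series is compared with the filtration by lowest occurring degree.
  Conversely, a finite composition series of \<open>M\<close> is built from monomial multiples of
  the generators if \<open>M\<close> vanishes in some degree.\<close>

definition ksign :: "'v::finite set \<Rightarrow> 'v \<Rightarrow> 'g::ab_group_add \<Rightarrow> 'g"
  where "ksign Y v a = (if even (card {w \<in> Y. to_nat w < to_nat v}) then a else - a)"

lemma ksign_insert:
  assumes "w \<notin> Y"
  shows "ksign (insert w Y) v a = (if to_nat w < to_nat v then - ksign Y v a else ksign Y v a)"
proof -
  have "{u \<in> insert w Y. to_nat u < to_nat v} =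
      (if to_nat w < to_nat v then insert w {u \<in> Y. to_nat u < to_nat v} else {u \<in> Y. to_nat u < to_nat v})"
    by auto
  then show ?thesis
    using assms by (auto simp: ksign_def)
qed

lemma ksign_simps [simp]:
  "ksign Y v 0 = 0" "ksign Y v (- a) = - ksign Y v a"
  "ksign Y v (ksign Y v a) = a"
  by (auto simp: ksign_def)

lemma ksign_diff: "ksign Y v (a - b) = ksign Y v a - ksign Y v b"
  and ksign_commute: "ksign Y v (ksign Z w a) = ksign Z w (ksign Y v a)"
  by (auto simp: ksign_def)

lemma ksign_sum: "ksign Y v (sum f S) = (\<Sum>x\<in>S. ksign Y v (f x))"
  by (simp add: ksign_def sum_negf)

text \<open>The Koszul complex only needs commuting additive operators, the multiplications by the
  variables, so it is set up over an abelian group; submodules and degrees enter as families of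
  subgroups.\<close>

locale koszul =
  fixes \<xi> :: "'v::finite \<Rightarrow> 'g::ab_group_add \<Rightarrow> 'g"
  assumes xi_add: "\<xi> v (a + b) = \<xi> v a + \<xi> v b"
    and xi_commute: "\<xi> v (\<xi> w a) = \<xi> w (\<xi> v a)"
begin

lemma xi_zero [simp]: "\<xi> v 0 = 0"
  using xi_add[of v 0 0] by simp

lemma xi_minus [simp]: "\<xi> v (- a) = - \<xi> v a"
  using xi_add[of v a "- a"] by (simp add: eq_neg_iff_add_eq_0 add.commute)

lemma xi_diff: "\<xi> v (a - b) = \<xi> v a - \<xi> v b"
  using xi_add[of v a "- b"] by simp

lemma xi_sum: "\<xi> v (sum f S) = (\<Sum>x\<in>S. \<xi> v (f x))"
  by (induction S rule: infinite_finite_induct) (simp_all add: xi_add)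

lemma xi_ksign: "\<xi> v (ksign Y w a) = ksign Y w (\<xi> v a)"
  by (simp add: ksign_def)

text \<open>The value of a chain at \<open>Y\<close> is the coefficient of the exterior basis
  element indexed by \<open>Y\<close>, and this is the Koszul differential read coefficientwise. The
  variables carry no order of their own; the signs use the one induced by
  \<open>to_nat\<close>.\<close>

definition bd :: "('v set \<Rightarrow> 'g) \<Rightarrow> 'v set \<Rightarrow> 'g"
  where "bd c Y = (\<Sum>v\<in>-Y. ksign Y v (\<xi> v (c (insert v Y))))"

lemma bd_diff: "bd (\<lambda>Y. c Y - c' Y) Y = bd c Y - bd c' Y"
  by (simp add: bd_def xi_diff ksign_diff sum_subtractf)

lemma bd_zero [simp]: "bd (\<lambda>Y. 0) Y = 0"
  by (simp add: bd_def)

lemma bd_bd: "bd (bd c) Y = 0"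
proof -
  define T where "T v w = (if w = v then 0 else
      ksign Y v (ksign (insert v Y) w (\<xi> v (\<xi> w (c (insert w (insert v Y)))))))" for v w
  have anti: "T v w = - T w v" if "v \<in> - Y" "w \<in> - Y" for v w
  proof (cases "v = w")
    case False
    then have "to_nat v \<noteq> to_nat w"
      by auto
    then show ?thesis
      using that False
      by (auto simp: T_def ksign_insert insert_commute[of v w] xi_commute[of v w]
          ksign_commute[of Y v Y w])
  qed (simp add: T_def)
  \<comment> \<open>Antisymmetry of \<open>T\<close> only shows that the double sum equals its own
    negative, which says nothing in characteristic 2. Splitting \<open>T\<close> into two ordered
    halves makes them cancel in every characteristic.\<close>
  define lo where "lo v w = (if to_nat v < to_nat w then T v w else 0)" for v w
  have split: "T v w = lo v w - lo w v" if "v \<in> - Y" "w \<in> - Y" for v w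
    using less_linear[of "to_nat v" "to_nat w"] anti[OF that] by (auto simp: lo_def T_def)
  have "bd (bd c) Y = (\<Sum>v\<in>-Y. \<Sum>w\<in>- insert v Y.
      ksign Y v (ksign (insert v Y) w (\<xi> v (\<xi> w (c (insert w (insert v Y)))))))"
    by (simp add: bd_def xi_sum ksign_sum xi_ksign)
  also have "\<dots> = (\<Sum>v\<in>-Y. \<Sum>w\<in>-Y. T v w)"
  proof (rule sum.cong[OF refl])
    fix v assume "v \<in> - Y"
    show "(\<Sum>w\<in>- insert v Y.
        ksign Y v (ksign (insert v Y) w (\<xi> v (\<xi> w (c (insert w (insert v Y))))))) = (\<Sum>w\<in>-Y. T v w)"
      by (rule sum.mono_neutral_cong_left) (auto simp: T_def)
  qed
  also have "\<dots> = (\<Sum>v\<in>-Y. \<Sum>w\<in>-Y. lo v w - lo w v)"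
    by (intro sum.cong refl split)
  also have "\<dots> = (\<Sum>v\<in>-Y. \<Sum>w\<in>-Y. lo v w) - (\<Sum>v\<in>-Y. \<Sum>w\<in>-Y. lo w v)"
    by (simp add: sum_subtractf)
  also have "(\<Sum>v\<in>-Y. \<Sum>w\<in>-Y. lo w v) = (\<Sum>v\<in>-Y. \<Sum>w\<in>-Y. lo v w)"
    by (rule sum.swap)
  finally show ?thesis by simp
qed

definition gfam :: "(int \<Rightarrow> 'g set) \<Rightarrow> bool"
  where "gfam B \<longleftrightarrow> (\<forall>j. 0 \<in> B j \<and> (\<forall>a\<in>B j. \<forall>b\<in>B j. a - b \<in> B j) \<and> (\<forall>v. \<forall>a\<in>B j. \<xi> v a \<in> B (j + 1)))"

lemma gfam_zero: "gfam B \<Longrightarrow> 0 \<in> B j"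
  and gfam_diff: "gfam B \<Longrightarrow> a \<in> B j \<Longrightarrow> b \<in> B j \<Longrightarrow> a - b \<in> B j"
  and gfam_xi: "gfam B \<Longrightarrow> a \<in> B j \<Longrightarrow> \<xi> v a \<in> B (j + 1)"
  by (auto simp: gfam_def)

lemma gfam_minus: "gfam B \<Longrightarrow> a \<in> B j \<Longrightarrow> - a \<in> B j"
  using gfam_diff[of B 0 j a] gfam_zero[of B j] by simp

lemma gfam_add: "gfam B \<Longrightarrow> a \<in> B j \<Longrightarrow> b \<in> B j \<Longrightarrow> a + b \<in> B j"
  using gfam_diff[of B a j "- b"] gfam_minus[of B b j] by simp

lemma gfam_sum: "gfam B \<Longrightarrow> (\<And>x. x \<in> S \<Longrightarrow> f x \<in> B j) \<Longrightarrow> sum f S \<in> B j"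
  by (induction S rule: infinite_finite_induct) (simp_all add: gfam_zero gfam_add)

lemma gfam_ksign: "gfam B \<Longrightarrow> a \<in> B j \<Longrightarrow> ksign Y v a \<in> B j"
  by (simp add: ksign_def gfam_minus)

text \<open>\<open>j\<close> is the total degree: each exterior generator has degree 1, so the
  coefficient at a set of size \<open>i\<close> has degree \<open>j - i\<close>.\<close>

definition chains :: "nat \<Rightarrow> int \<Rightarrow> (int \<Rightarrow> 'g set) \<Rightarrow> ('v set \<Rightarrow> 'g) set"
  where "chains i j B = {c. \<forall>Y. if card Y = i then c Y \<in> B (j - int i) else c Y = 0}"

lemma chainsD: "c \<in> chains i j B \<Longrightarrow> card Y = i \<Longrightarrow> c Y \<in> B (j - int i)"
  and chainsD0: "c \<in> chains i j B \<Longrightarrow> card Y \<noteq> i \<Longrightarrow> c Y = 0"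
  by (auto simp: chains_def)

lemma chains_mono: "(\<And>j. B j \<subseteq> C j) \<Longrightarrow> c \<in> chains i j B \<Longrightarrow> c \<in> chains i j C"
  unfolding chains_def by (simp split: if_splits) blast

lemma chains_zero: "gfam B \<Longrightarrow> (\<lambda>Y. 0) \<in> chains i j B"
  by (simp add: chains_def gfam_zero)

lemma chains_diff:
  "gfam B \<Longrightarrow> c \<in> chains i j B \<Longrightarrow> c' \<in> chains i j B \<Longrightarrow> (\<lambda>Y. c Y - c' Y) \<in> chains i j B"
  by (simp add: chains_def gfam_diff)

lemma bd_chains:
  assumes "gfam B" "c \<in> chains (Suc i) j B"
  shows "bd c \<in> chains i j B"
  unfolding chains_def mem_Collect_eq
proof (rule allI)
  fix Y :: "'v set"
  have "ksign Y v (\<xi> v (c (insert v Y))) \<in> B (j - int i)" if "v \<in> - Y" "card Y = i" for v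
    using gfam_xi[OF assms(1) chainsD[OF assms(2), of "insert v Y"], of v] that
    by (simp add: gfam_ksign[OF assms(1)])
  moreover have "bd c Y = 0" if "card Y \<noteq> i"
    unfolding bd_def by (rule sum.neutral) (use that in \<open>simp add: chainsD0[OF assms(2)]\<close>)
  ultimately show "if card Y = i then bd c Y \<in> B (j - int i) else bd c Y = 0"
    using gfam_sum[OF assms(1), of "-Y" "\<lambda>v. ksign Y v (\<xi> v (c (insert v Y)))"]
    by (simp add: bd_def)
qed

text \<open>
  \<open>tor B A i j\<close> says that the degree \<open>j\<close> part of the \<open>i\<close>-th Koszul homology of \<open>B/A\<close> is nonzero.
\<close>

definition tor :: "(int \<Rightarrow> 'g set) \<Rightarrow> (int \<Rightarrow> 'g set) \<Rightarrow> nat \<Rightarrow> int \<Rightarrow> bool"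
  where "tor B A i j \<longleftrightarrow> (\<exists>c\<in>chains i j B. (\<forall>Y. bd c Y \<in> A (j - int i + 1)) \<and>
    (\<forall>w\<in>chains (Suc i) j B. \<exists>Y. c Y - bd w Y \<notin> A (j - int i)))"

lemma torD:
  assumes "\<not> tor B A i j" "c \<in> chains i j B" "\<And>Y. bd c Y \<in> A (j - int i + 1)"
  obtains w where "w \<in> chains (Suc i) j B" "\<And>Y. c Y - bd w Y \<in> A (j - int i)"
  using assms unfolding tor_def by blast

lemma chainsI_mod:
  assumes "c \<in> chains i j C" "c' \<in> chains i j C" "\<And>Y. c Y - c' Y \<in> B (j - int i)"
  shows "(\<lambda>Y. c Y - c' Y) \<in> chains i j B"
  using assms by (auto simp: chains_def)

text \<open>The segment Tor_(i+1)(C/B) -> Tor_i(B/A) -> Tor_i(C/A) of the long exact sequence. If a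
  cycle of B/A is the boundary of some \<open>w\<close> over C/A, then \<open>w\<close> is a cycle
  modulo \<open>B\<close>; subtracting a boundary moves it into \<open>B\<close> without changing
  its own boundary.\<close>

lemma tor_long_exact:
  assumes B: "gfam B" and C: "gfam C" and AB: "\<And>j. A j \<subseteq> B j" and BC: "\<And>j. B j \<subseteq> C j"
    and tor: "tor B A i j"
  shows "tor C A i j \<or> tor C B (Suc i) j"
proof (rule ccontr)
  assume neg: "\<not> (tor C A i j \<or> tor C B (Suc i) j)"
  obtain c where c: "c \<in> chains i j B" "\<And>Y. bd c Y \<in> A (j - int i + 1)"
    and nb: "\<And>w. w \<in> chains (Suc i) j B \<Longrightarrow> \<exists>Y. c Y - bd w Y \<notin> A (j - int i)"
    using tor unfolding tor_def by blast
  have cC: "c \<in> chains i j C"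
    using c(1) BC by (fastforce simp: chains_def)
  obtain w where w: "w \<in> chains (Suc i) j C" "\<And>Y. c Y - bd w Y \<in> A (j - int i)"
    using torD[of C A i j c] neg cC c(2) by blast
  have cB: "c Y \<in> B (j - int i)" for Y
    using c(1) gfam_zero[OF B] by (cases "card Y = i") (auto simp: chains_def)
  have "bd w Y \<in> B (j - int (Suc i) + 1)" for Y
    using gfam_diff[OF B cB[of Y] subsetD[OF AB w(2)[of Y]]] by simp
  then obtain z where z: "z \<in> chains (Suc (Suc i)) j C" "\<And>Y. w Y - bd z Y \<in> B (j - int (Suc i))"
    using torD[of C B "Suc i" j w] neg w(1) by blast
  have "(\<lambda>Y. w Y - bd z Y) \<in> chains (Suc i) j B"
    using chainsI_mod[of w "Suc i" j C "bd z" B] w(1) bd_chains[OF C z(1)] z(2) by simp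
  from nb[OF this] show False
    using w(2) by (simp add: bd_diff bd_bd)
qed

text \<open>The coefficients of a chain of total degree \<open>j\<close> in homological degree
  \<open>i\<close> lie in degree \<open>j - i\<close>, so a class needs C/B to be nonzero there. For
  a module of finite length this bounds the regularity by the top degree.\<close>

lemma tor_quotientD:
  assumes B: "gfam B" and C: "gfam C" and tor: "tor C B i j"
  shows "\<not> C (j - int i) \<subseteq> B (j - int i)"
proof
  assume sub: "C (j - int i) \<subseteq> B (j - int i)"
  obtain c where c: "c \<in> chains i j C"
    and nb: "\<And>w. w \<in> chains (Suc i) j C \<Longrightarrow> \<exists>Y. c Y - bd w Y \<notin> B (j - int i)"
    using tor unfolding tor_def by blast
  obtain Y where "c Y \<notin> B (j - int i)"
    using nb[OF chains_zero[OF C]] by auto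
  moreover have "c Y \<in> B (j - int i)"
    using sub c gfam_zero[OF B] by (cases "card Y = i") (auto simp: chains_def)
  ultimately show False by simp
qed

text \<open>There are no chains beyond the full set of variables, hence no boundaries in the top
  homology: a socle element of degree \<open>l\<close> is a nonzero class, with degree raised by the
  number of variables.\<close>

lemma tor_top:
  assumes A: "gfam A" and B: "gfam B"
    and v: "v \<in> B l" "v \<notin> A l" and soc: "\<And>w. \<xi> w v \<in> A (l + 1)"
  shows "tor B A CARD('v) (l + int CARD('v))"
proof -
  let ?n = "CARD('v)"
  define c :: "'v set \<Rightarrow> 'g" where "c Y = (if Y = UNIV then v else 0)" for Y
  have card: "card Y = ?n \<longleftrightarrow> Y = UNIV" for Y :: "'v set"
    using card_subset_eq[of "UNIV :: 'v set" Y] by auto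
  have "c \<in> chains ?n (l + int ?n) B"
    using v by (auto simp: chains_def c_def card)
  moreover have "bd c Y \<in> A (l + int ?n - int ?n + 1)" for Y
    unfolding bd_def
    by (intro gfam_sum[OF A] gfam_ksign[OF A]) (use soc gfam_zero[OF A] in \<open>auto simp: c_def\<close>)
  moreover have "bd w UNIV = 0" for w
    by (simp add: bd_def)
  ultimately show ?thesis
    using v(2) unfolding tor_def
    by (intro bexI[of _ c] conjI allI ballI exI[of _ UNIV]) (auto simp: c_def)
qed

text \<open>A family \<open>m\<close> with the relations \<open>syz\<close> is a cycle one step
  below the top, with \<open>m w\<close> placed at the complement of \<open>w\<close>. That it is a
  boundary means that a single element \<open>b\<close> induces the whole family modulo
  \<open>A\<close>.\<close>

lemma tor_subtop:
  assumes A: "gfam A" and B: "gfam B"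
    and m: "\<And>w. m w \<in> B l" and syz: "\<And>u w. \<xi> u (m w) - \<xi> w (m u) \<in> A (l + 1)"
    and ntor: "\<not> tor B A (CARD('v) - 1) (l + int (CARD('v) - 1))"
  obtains b where "b \<in> B (l - 1)" "\<And>w. \<xi> w b - m w \<in> A l"
proof -
  let ?n = "CARD('v)"
  have n: "?n \<ge> 1"
    by (simp add: Suc_leI)
  \<comment> \<open>The sign is the one that \<open>bd\<close> attaches to the full set at
    \<open>- {w}\<close>, so that \<open>c (- {w})\<close> and \<open>bd z (- {w})\<close> differ by
    a common sign from \<open>m w\<close> and the multiple of \<open>z UNIV\<close>.\<close>
  define c :: "'v set \<Rightarrow> 'g" where
    "c Y = (if card Y = ?n - 1 then (let w = (THE w. w \<notin> Y) in ksign Y w (m w)) else 0)" for Y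
  have the: "(THE u. u \<notin> - {w}) = w" for w :: 'v
    by auto
  have card_compl: "card (- {w}) = ?n - 1" for w :: 'v
    by (simp add: Compl_eq_Diff_UNIV)
  have c_compl: "c (- {w}) = ksign (- {w}) w (m w)" for w
    by (simp add: c_def card_compl the)
  have compl_ex: "\<exists>w. Y = - {w}" if "card Y = ?n - 1" for Y :: "'v set"
  proof -
    have "card (- Y) = 1"
      using that n by (simp add: Compl_eq_Diff_UNIV card_Diff_subset)
    then obtain w where "- Y = {w}"
      by (auto simp: card_1_singleton_iff)
    then have "Y = - {w}" by auto
    then show ?thesis ..
  qed
  have c: "c \<in> chains (?n - 1) (l + int (?n - 1)) B"
    unfolding chains_def mem_Collect_eq
  proof (rule allI)
    fix Y :: "'v set"
    show "if card Y = ?n - 1 then c Y \<in> B (l + int (?n - 1) - int (?n - 1)) else c Y = 0"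
    proof (cases "card Y = ?n - 1")
      case True
      then obtain w where "Y = - {w}" using compl_ex by blast
      then show ?thesis using True m by (simp add: c_compl gfam_ksign[OF B])
    qed (simp add: c_def)
  qed
  have bdc: "bd c Y \<in> A (l + int (?n - 1) - int (?n - 1) + 1)" for Y
  proof (cases "\<exists>v. v \<notin> Y \<and> card (insert v Y) = ?n - 1")
    case True
    then obtain u where u: "u \<notin> Y" "card (insert u Y) = ?n - 1" by blast
    then obtain w where w: "insert u Y = - {w}" using compl_ex by blast
    have uw: "u \<noteq> w" and Y: "- Y = {u, w}"
      using w u by auto
    have ins: "insert u Y = - {w}" "insert w Y = - {u}"
      using Y uw by auto
    have wY: "w \<notin> Y" using Y by auto
    \<comment> \<open>\<open>Y\<close> misses exactly the two variables \<open>u\<close> and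
      \<open>w\<close>. The two remaining terms carry opposite signs and combine to the difference
      controlled by \<open>syz\<close>.\<close>
    have "bd c Y = ksign Y u (\<xi> u (c (insert u Y))) + ksign Y w (\<xi> w (c (insert w Y)))"
      unfolding bd_def Y using uw by simp
    also have "\<dots> = ksign Y u (ksign (insert u Y) w (\<xi> u (m w))) + ksign Y w (ksign (insert w Y) u (\<xi> w (m u)))"
      by (simp only: ins c_compl xi_ksign)
    also have "\<dots> = (if to_nat u < to_nat w then - ksign Y u (ksign Y w (\<xi> u (m w) - \<xi> w (m u)))
        else ksign Y u (ksign Y w (\<xi> u (m w) - \<xi> w (m u))))"
    proof -
      have "to_nat u \<noteq> to_nat w" using uw by simp
      then show ?thesis
        using u(1) wY by (auto simp: ksign_insert ksign_diff ksign_commute[of Y w Y u])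
    qed
    finally show ?thesis
      using syz by (simp add: gfam_minus[OF A] gfam_ksign[OF A])
  next
    case False
    have "bd c Y = 0"
      unfolding bd_def using False by (intro sum.neutral) (auto simp: c_def)
    then show ?thesis using gfam_zero[OF A] by simp
  qed
  obtain z where z: "z \<in> chains (Suc (?n - 1)) (l + int (?n - 1)) B"
    and cz: "\<And>Y. c Y - bd z Y \<in> A (l + int (?n - 1) - int (?n - 1))"
    by (rule torD[OF ntor c bdc]) blast
  have "z UNIV \<in> B (l - 1)"
    using chainsD[OF z, of UNIV] n by simp
  moreover have "\<xi> w (z UNIV) - m w \<in> A l" for w
  proof -
    have "bd z (- {w}) = ksign (- {w}) w (\<xi> w (z UNIV))"
      unfolding bd_def by (simp add: insert_UNIV flip: Compl_insert) (simp add: insert_absorb Compl_eq_Diff_UNIV)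
    then have "ksign (- {w}) w (m w - \<xi> w (z UNIV)) \<in> A l"
      using cz[of "- {w}"] by (simp add: c_compl ksign_diff)
    from gfam_ksign[OF A this, of "- {w}" w] have "m w - \<xi> w (z UNIV) \<in> A l"
      by simp
    from gfam_minus[OF A this] show ?thesis by simp
  qed
  ultimately show ?thesis by (rule that)
qed

text \<open>\<open>F\<close> is a free cover of B/A with kernel \<open>Z\<close>, and the connecting
  map identifies Tor_(i+1)(B/A) with Tor_i(Z): lift a cycle to \<open>F\<close> and take its
  boundary, which falls into \<open>Z\<close>. Acyclicity of \<open>F\<close> in positive degrees
  suffices for \<open>i > 0\<close>; for \<open>i = 0\<close> the map Tor_0(Z) -> Tor_0(F) has to
  vanish, which is what \<open>minimal\<close> says.\<close>

lemma tor_dimension_shift: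
  fixes \<phi> :: "'g \<Rightarrow> 'g"
  assumes F: "gfam F" and A: "gfam A" and B: "gfam B" and Z: "gfam Z"
    and \<phi>_diff: "\<And>a b. \<phi> (a - b) = \<phi> a - \<phi> b"
    and \<phi>_xi: "\<And>v a. \<phi> (\<xi> v a) = \<xi> v (\<phi> a)"
    and \<phi>_B: "\<And>j f. f \<in> F j \<Longrightarrow> \<phi> f \<in> B j"
    and onto: "\<And>j x. x \<in> B j \<Longrightarrow> \<exists>f\<in>F j. x - \<phi> f \<in> A j"
    and ker: "\<And>j. Z j = {f \<in> F j. \<phi> f \<in> A j}"
    and acyclic: "\<And>i j c. c \<in> chains (Suc i) j F \<Longrightarrow> (\<And>Y. bd c Y = 0) \<Longrightarrow>
      \<exists>w\<in>chains (Suc (Suc i)) j F. bd w = c"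
    and minimal: "\<And>j z. z \<in> Z j \<Longrightarrow> \<exists>u. (\<forall>v. u v \<in> F (j - 1)) \<and> z = (\<Sum>v\<in>UNIV. \<xi> v (u v))"
  shows "tor B A (Suc i) j \<longleftrightarrow> tor Z (\<lambda>_. {0}) i j"
proof
  have \<phi>_0: "\<phi> 0 = 0"
    using \<phi>_diff[of 0 0] by simp
  have \<phi>_add: "\<phi> (a + b) = \<phi> a + \<phi> b" for a b
    using \<phi>_diff[of a "0 - b"] \<phi>_diff[of 0 b] \<phi>_0 by simp
  have \<phi>_sum: "\<phi> (sum f S) = (\<Sum>x\<in>S. \<phi> (f x))" for f :: "'v \<Rightarrow> 'g" and S
    by (induction S rule: infinite_finite_induct) (simp_all add: \<phi>_0 \<phi>_add)
  have \<phi>_ksign: "\<phi> (ksign Y v a) = ksign Y v (\<phi> a)" for Y v a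
    using \<phi>_diff[of 0 a] \<phi>_0 by (simp add: ksign_def)
  have \<phi>_bd: "\<phi> (bd c Y) = bd (\<lambda>Y. \<phi> (c Y)) Y" for c Y
    by (simp add: bd_def \<phi>_sum \<phi>_ksign \<phi>_xi)
  have \<phi>_chains: "(\<lambda>Y. \<phi> (c Y)) \<in> chains i j B" if "c \<in> chains i j F" for c i j
    using that by (auto simp: chains_def \<phi>_0 \<phi>_B)
  have lift: "\<exists>c'\<in>chains i j F. \<forall>Y. c Y - \<phi> (c' Y) \<in> A (j - int i)" if c: "c \<in> chains i j B" for c i j
  proof -
    have "\<forall>Y. \<exists>f. (if card Y = i then f \<in> F (j - int i) else f = 0) \<and> c Y - \<phi> f \<in> A (j - int i)"
    proof
      fix Y :: "'v set"
      show "\<exists>f. (if card Y = i then f \<in> F (j - int i) else f = 0) \<and> c Y - \<phi> f \<in> A (j - int i)"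
        using onto[OF chainsD[OF c, of Y]] chainsD0[OF c, of Y] \<phi>_0 gfam_zero[OF A]
        by (cases "card Y = i") auto
    qed
    then obtain c' where "\<And>Y. (if card Y = i then c' Y \<in> F (j - int i) else c' Y = 0) \<and>
        c Y - \<phi> (c' Y) \<in> A (j - int i)"
      by metis
    then show ?thesis
      by (intro bexI[of _ c']) (auto simp: chains_def)
  qed
  have bd_A: "bd (\<lambda>Y. d Y) Y \<in> A (j - int i)"
    if "\<And>Y. d Y \<in> A (j - int (Suc i))" for d i j Y
    unfolding bd_def
    using gfam_xi[OF A that] by (intro gfam_sum[OF A] gfam_ksign[OF A]) simp
  {
    assume "tor B A (Suc i) j"
    then obtain c where c: "c \<in> chains (Suc i) j B" "\<And>Y. bd c Y \<in> A (j - int (Suc i) + 1)"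
      and nb: "\<And>w. w \<in> chains (Suc (Suc i)) j B \<Longrightarrow> \<exists>Y. c Y - bd w Y \<notin> A (j - int (Suc i))"
      unfolding tor_def by blast
    obtain c' where c': "c' \<in> chains (Suc i) j F" "\<And>Y. c Y - \<phi> (c' Y) \<in> A (j - int (Suc i))"
      using lift[OF c(1)] by blast
    have "\<phi> (bd c' Y) \<in> A (j - int i)" for Y
    proof -
      have "bd (\<lambda>Y. c Y - \<phi> (c' Y)) Y \<in> A (j - int i)"
        by (rule bd_A) (rule c')
      then have "bd c Y - \<phi> (bd c' Y) \<in> A (j - int i)"
        by (simp add: bd_diff \<phi>_bd)
      from gfam_diff[OF A _ this, of "bd c Y"] c(2)[of Y] show ?thesis by simp
    qed
    then have zZ: "bd c' \<in> chains i j Z"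
      using bd_chains[OF F c'(1)] by (auto simp: chains_def ker)
    show "tor Z (\<lambda>_. {0}) i j"
    proof (rule ccontr)
      assume "\<not> tor Z (\<lambda>_. {0}) i j"
      from torD[OF this zZ] obtain w where
        w: "w \<in> chains (Suc i) j Z" "\<And>Y. bd c' Y - bd w Y \<in> {0}"
        by (auto simp: bd_bd)
      have "w \<in> chains (Suc i) j F"
        using w(1) by (rule chains_mono[rotated]) (auto simp: ker)
      then have "(\<lambda>Y. c' Y - w Y) \<in> chains (Suc i) j F"
        by (rule chains_diff[OF F c'(1)])
      from acyclic[OF this] obtain u where u: "u \<in> chains (Suc (Suc i)) j F" "bd u = (\<lambda>Y. c' Y - w Y)"
        using w(2) by (auto simp: bd_diff)
      obtain Y where Y: "c Y - bd (\<lambda>Y. \<phi> (u Y)) Y \<notin> A (j - int (Suc i))"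
        using nb[OF \<phi>_chains[OF u(1)]] by blast
      have "c Y - bd (\<lambda>Y. \<phi> (u Y)) Y = (c Y - \<phi> (c' Y)) + \<phi> (w Y)"
        using u(2) by (simp flip: \<phi>_bd add: \<phi>_diff)
      moreover have "\<phi> (w Y) \<in> A (j - int (Suc i))"
        using chainsD[OF w(1), of Y] chainsD0[OF w(1), of Y] \<phi>_0 gfam_zero[OF A]
        by (cases "card Y = Suc i") (auto simp: ker)
      ultimately show False
        using Y gfam_add[OF A c'(2)[of Y], of "\<phi> (w Y)"] by metis
    qed
  }
  {
    assume "tor Z (\<lambda>_. {0}) i j"
    then obtain z where z: "z \<in> chains i j Z" "\<And>Y. bd z Y = 0"
      and nb: "\<And>w. w \<in> chains (Suc i) j Z \<Longrightarrow> \<exists>Y. z Y - bd w Y \<noteq> 0"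
      unfolding tor_def by auto
    have zF: "z \<in> chains i j F"
      using z(1) by (rule chains_mono[rotated]) (auto simp: ker)
    have "\<exists>u\<in>chains (Suc i) j F. bd u = z"
    proof (cases i)
      case (Suc i')
      then show ?thesis using acyclic[of z i' j] zF z(2) by simp
    next
      \<comment> \<open>Acyclicity says nothing in homological degree 0. Instead
        \<open>minimal\<close> writes the value at the empty set through the variables, and the
        coefficients form the 1-chain \<open>u\<close>.\<close>
      case 0
      have "z {} \<in> Z j"
        using chainsD[OF z(1), of "{}"] 0 by simp
      then obtain a where a: "\<And>v. a v \<in> F (j - 1)" "z {} = (\<Sum>v\<in>UNIV. \<xi> v (a v))"
        using minimal by blast
      define u where "u Y = (if card Y = 1 then a (THE v. v \<in> Y) else 0)" for Y
      have "u \<in> chains (Suc i) j F"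
        using a(1) 0 by (auto simp: chains_def u_def)
      moreover have "bd u Y = z Y" for Y
      proof (cases "Y = {}")
        case True
        then show ?thesis using a(2) by (simp add: bd_def u_def ksign_def)
      next
        case False
        then have "bd u Y = 0"
          by (auto simp: bd_def u_def card_insert_if intro!: sum.neutral)
        moreover have "z Y = 0"
          using False chainsD0[OF zF, of Y] 0 by (simp add: card_eq_0_iff)
        ultimately show ?thesis by simp
      qed
      ultimately show ?thesis by blast
    qed
    then obtain u where u: "u \<in> chains (Suc i) j F" "bd u = z" by blast
    show "tor B A (Suc i) j"
    proof (rule ccontr)
      assume ntor: "\<not> tor B A (Suc i) j"
      have "bd (\<lambda>Y. \<phi> (u Y)) Y \<in> A (j - int (Suc i) + 1)" for Y
        using chainsD[OF z(1), of Y] chainsD0[OF z(1), of Y] \<phi>_0 gfam_zero[OF A] u(2)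
        by (cases "card Y = i") (auto simp: ker simp flip: \<phi>_bd)
      from torD[OF ntor \<phi>_chains[OF u(1)] this] obtain w where
        w: "w \<in> chains (Suc (Suc i)) j B" "\<And>Y. \<phi> (u Y) - bd w Y \<in> A (j - int (Suc i))"
        by blast
      obtain w' where w': "w' \<in> chains (Suc (Suc i)) j F" "\<And>Y. w Y - \<phi> (w' Y) \<in> A (j - int (Suc (Suc i)))"
        using lift[OF w(1)] by blast
      have "\<phi> (u Y - bd w' Y) \<in> A (j - int (Suc i))" for Y
      proof -
        have "bd (\<lambda>Y. w Y - \<phi> (w' Y)) Y \<in> A (j - int (Suc i))"
          by (rule bd_A) (rule w')
        then have "bd w Y - \<phi> (bd w' Y) \<in> A (j - int (Suc i))"
          by (simp add: bd_diff \<phi>_bd)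
        from gfam_add[OF A w(2)[of Y] this] show ?thesis by (simp add: \<phi>_diff)
      qed
      then have "(\<lambda>Y. u Y - bd w' Y) \<in> chains (Suc i) j Z"
        using chains_diff[OF F u(1) bd_chains[OF F w'(1)]] unfolding chains_def ker
        by (simp split: if_splits)
      from nb[OF this] show False
        using u(2) by (simp add: bd_diff bd_bd)
    qed
  }
qed

text \<open>No set of variables has more than \<open>CARD('v)\<close> elements, so there are no
  chains beyond. This limits the homological degrees that \<open>tor_bounded\<close> has to inspect
  to finitely many.\<close>

lemma tor_card_le:
  assumes "gfam A" "tor B A i j"
  shows "i \<le> CARD('v)"
proof (rule ccontr)
  assume "\<not> i \<le> CARD('v)"
  then have card: "card Y \<noteq> i" "card Y \<noteq> Suc i" for Y :: "'v set"
    using card_mono[of UNIV Y] by auto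
  obtain c where c: "c \<in> chains i j B"
    and nb: "\<And>w. w \<in> chains (Suc i) j B \<Longrightarrow> \<exists>Y. c Y - bd w Y \<notin> A (j - int i)"
    using assms(2) unfolding tor_def by blast
  have "(\<lambda>Y. 0) \<in> chains (Suc i) j B"
    using card by (simp add: chains_def)
  from nb[OF this] show False
    using c card gfam_zero[OF assms(1)] by (simp add: chains_def)
qed

end

section \<open>Homogeneous components\<close>

definition mdeg :: "('v::finite \<Rightarrow>\<^sub>0 nat) \<Rightarrow> nat"
  where "mdeg m = (\<Sum>v\<in>UNIV. Poly_Mapping.lookup m v)"

lemma mdeg_add: "mdeg (m + n) = mdeg m + mdeg n"
  by (simp add: mdeg_def lookup_add sum.distrib)

lemma mdeg_zero [simp]: "mdeg 0 = 0"
  by (simp add: mdeg_def)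

lemma mdeg_single [simp]: "mdeg (Poly_Mapping.single v n) = n"
  by (simp add: mdeg_def lookup_single when_def)

lemma mdeg_eq_0_iff: "mdeg m = 0 \<longleftrightarrow> m = 0"
  by (auto simp: mdeg_def intro: poly_mapping_eqI)

lemma forms_iff: "p \<in> forms j \<longleftrightarrow> (\<forall>m. Poly_Mapping.lookup p m \<noteq> 0 \<longrightarrow> int (mdeg m) = j)"
  by (auto simp: forms_def mdeg_def in_keys_iff)

lemma forms_zero [simp]: "0 \<in> forms j"
  by (simp add: forms_iff)

lemma forms_add: "p \<in> forms j \<Longrightarrow> q \<in> forms j \<Longrightarrow> p + q \<in> forms j"
  unfolding forms_iff lookup_add by (metis add_0)

lemma forms_minus: "p \<in> forms j \<Longrightarrow> - p \<in> forms j"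
  by (simp add: forms_iff)

lemma forms_diff: "p \<in> forms j \<Longrightarrow> q \<in> forms j \<Longrightarrow> p - q \<in> forms j"
  using forms_add[of p j "- q"] forms_minus[of q j] by simp

lemma forms_mult:
  assumes "p \<in> forms i" "q \<in> forms j"
  shows "p * q \<in> forms (i + j)"
  unfolding forms_iff
proof (intro allI impI)
  fix m assume "Poly_Mapping.lookup (p * q) m \<noteq> 0"
  then have "m \<in> Poly_Mapping.keys (p * q)"
    by (simp add: in_keys_iff)
  then obtain a b where "m = a + b" "a \<in> Poly_Mapping.keys p" "b \<in> Poly_Mapping.keys q"
    using keys_mult[of p q] by blast
  then show "int (mdeg m) = i + j"
    using assms by (simp add: forms_iff in_keys_iff mdeg_add)
qed

lemma single_in_forms: "Poly_Mapping.single m c \<in> forms (int (mdeg m))"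
  by (simp add: forms_iff lookup_single when_def)

lemma forms_neg: "p \<in> forms j \<Longrightarrow> j < 0 \<Longrightarrow> p = 0"
  by (rule poly_mapping_eqI) (auto simp: forms_iff)

lemma forms_0_const: "p \<in> forms 0 \<Longrightarrow> p = Poly_Mapping.single 0 (Poly_Mapping.lookup p 0)"
  by (rule poly_mapping_eqI) (auto simp: forms_iff lookup_single when_def mdeg_eq_0_iff)

definition hcomp :: "int \<Rightarrow> ('a::field, 'v::finite) mpol \<Rightarrow> ('a, 'v) mpol"
  where "hcomp j p = Abs_poly_mapping (\<lambda>m. if int (mdeg m) = j then Poly_Mapping.lookup p m else 0)"

lemma lookup_hcomp:
  "Poly_Mapping.lookup (hcomp j p) m = (if int (mdeg m) = j then Poly_Mapping.lookup p m else 0)"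
proof -
  have "finite {m. (if int (mdeg m) = j then Poly_Mapping.lookup p m else 0) \<noteq> 0}"
    by (rule finite_subset[OF _ finite_lookup[of p]]) auto
  then show ?thesis
    by (simp add: hcomp_def)
qed

lemma hcomp_in_forms: "hcomp j p \<in> forms j"
  by (simp add: forms_iff lookup_hcomp)

lemma hcomp_add: "hcomp j (p + q) = hcomp j p + hcomp j q"
  by (rule poly_mapping_eqI) (simp add: lookup_hcomp lookup_add)

lemma hcomp_zero [simp]: "hcomp j 0 = 0"
  by (rule poly_mapping_eqI) (simp add: lookup_hcomp)

lemma hcomp_sum: "hcomp j (sum f S) = (\<Sum>x\<in>S. hcomp j (f x))"
  by (induction S rule: infinite_finite_induct) (simp_all add: hcomp_add)

lemma hcomp_form: "p \<in> forms j \<Longrightarrow> hcomp l p = (if l = j then p else 0)"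
  by (rule poly_mapping_eqI) (auto simp: lookup_hcomp forms_iff)

lemma sum_hcomp:
  assumes "finite L" "\<And>m. Poly_Mapping.lookup p m \<noteq> 0 \<Longrightarrow> int (mdeg m) \<in> L"
  shows "(\<Sum>l\<in>L. hcomp l p) = p"
  by (rule poly_mapping_eqI) (use assms in \<open>auto simp: lookup_sum lookup_hcomp\<close>)

lemma hcomp_mult:
  assumes q: "q \<in> forms i"
  shows "hcomp j (q * p) = q * hcomp (j - i) p"
proof -
  define L where "L = insert (j - i) ((int \<circ> mdeg) ` Poly_Mapping.keys p)"
  have L: "finite L" by (simp add: L_def)
  have p: "p = (\<Sum>l\<in>L. hcomp l p)"
    by (rule sum_hcomp[OF L, symmetric]) (auto simp: L_def in_keys_iff)
  have "hcomp j (q * p) = (\<Sum>l\<in>L. hcomp j (q * hcomp l p))"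
    by (subst p) (simp add: sum_distrib_left hcomp_sum)
  also have "\<dots> = (\<Sum>l\<in>L. if l = j - i then q * hcomp l p else 0)"
    by (rule sum.cong[OF refl]) (auto simp: hcomp_form[OF forms_mult[OF q hcomp_in_forms]])
  also have "\<dots> = q * hcomp (j - i) p"
    using L by (simp add: L_def)
  finally show ?thesis .
qed

definition xvar :: "'v::finite \<Rightarrow> ('a::field, 'v) mpol"
  where "xvar v = Poly_Mapping.single (Poly_Mapping.single v 1) 1"

lemma xvar_in_forms: "xvar v \<in> forms 1"
  using single_in_forms[of "Poly_Mapping.single v 1"] by (simp add: xvar_def)

lemma lookup_xvar_mult:
  fixes p :: "('a::field, 'v::finite) mpol"
  shows "Poly_Mapping.lookup (xvar v * p) m =
    (if Poly_Mapping.lookup m v > 0 then Poly_Mapping.lookup p (m - Poly_Mapping.single v 1) else 0)"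
proof -
  let ?s = "Poly_Mapping.single v 1"
  have "Poly_Mapping.lookup (xvar v * p) m =
      (\<Sum>l. (1 when ?s = l) * (\<Sum>q. Poly_Mapping.lookup p q when m = l + q))"
    by (simp add: lookup_mult lookup_single xvar_def)
  also have "\<dots> = (\<Sum>q. Poly_Mapping.lookup p q when m = ?s + q)"
    by (simp add: when_mult)
  also have "\<dots> = (if Poly_Mapping.lookup m v > 0 then Poly_Mapping.lookup p (m - ?s) else 0)"
  proof (cases "Poly_Mapping.lookup m v > 0")
    case True
    have "m = ?s + (m - ?s)"
      by (rule poly_mapping_eqI) (use True in \<open>auto simp: lookup_add lookup_minus lookup_single when_def\<close>)
    then have "m = ?s + q \<longleftrightarrow> q = m - ?s" for q
      by (metis add_diff_cancel_left')
    then show ?thesis using True by simp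
  next
    case False
    then have "m \<noteq> ?s + q" for q
      by (auto simp: lookup_add)
    then show ?thesis using False by simp
  qed
  finally show ?thesis .
qed

section \<open>Graded free modules\<close>

text \<open>Free modules of all ranks sit inside one type of functions. A module, its syzygies and
  all higher syzygies can then be treated by the same constants and be chosen recursively.\<close>

definition vscale :: "('a::field, 'v::finite) mpol \<Rightarrow> (nat \<Rightarrow> ('a, 'v) mpol) \<Rightarrow> nat \<Rightarrow> ('a, 'v) mpol"
  where "vscale p u = (\<lambda>k. p * u k)"

lemma vscale_apply [simp]: "vscale p u k = p * u k"
  by (simp add: vscale_def)

interpretation vm: Modules.module vscale
  by unfold_locales (auto simp: fun_eq_iff algebra_simps)

lemma sum_fun_apply: "sum f S k = (\<Sum>x\<in>S. f x k)"
  for f :: "'x \<Rightarrow> nat \<Rightarrow> 'y::comm_monoid_add"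
  by (induction S rule: infinite_finite_induct) simp_all

interpretation kz: koszul "\<lambda>v. vscale (xvar v)"
  by unfold_locales (auto simp: fun_eq_iff algebra_simps)

definition gr :: "nat \<Rightarrow> (nat \<Rightarrow> int) \<Rightarrow> int \<Rightarrow> (nat \<Rightarrow> ('a::field, 'v::finite) mpol) set"
  where "gr r b j = {u \<in> free_carrier r. \<forall>k<r. u k \<in> forms (j - b k)}"

lemma gr_iff: "u \<in> gr r b j \<longleftrightarrow> (\<forall>k\<ge>r. u k = 0) \<and> (\<forall>k. u k \<in> forms (j - b k))"
  by (auto simp: gr_def free_carrier_def) (metis forms_zero leI)

definition vcomp :: "(nat \<Rightarrow> int) \<Rightarrow> int \<Rightarrow> (nat \<Rightarrow> ('a::field, 'v::finite) mpol) \<Rightarrow> nat \<Rightarrow> ('a, 'v) mpol"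
  where "vcomp b j u = (\<lambda>k. hcomp (j - b k) (u k))"

lemma subspace_free_carrier: "vm.subspace (free_carrier r)"
  by (auto simp: vm.subspace_def free_carrier_def)

lemma gr_zero: "0 \<in> gr r b j"
  and gr_add: "u \<in> gr r b j \<Longrightarrow> u' \<in> gr r b j \<Longrightarrow> u + u' \<in> gr r b j"
  and gr_diff: "u \<in> gr r b j \<Longrightarrow> u' \<in> gr r b j \<Longrightarrow> u - u' \<in> gr r b j"
  by (auto simp: gr_iff intro: forms_add forms_diff)

lemma gr_scale: "p \<in> forms i \<Longrightarrow> u \<in> gr r b j \<Longrightarrow> vscale p u \<in> gr r b (i + j)"
  unfolding gr_iff by (simp add: forms_mult add_diff_eq[symmetric])

lemma gr_sum: "(\<And>x. x \<in> S \<Longrightarrow> f x \<in> gr r b j) \<Longrightarrow> sum f S \<in> gr r b j"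
  by (induction S rule: infinite_finite_induct) (simp_all add: gr_zero gr_add)

lemma gfam_gr: "kz.gfam (gr r b)"
  using gr_scale[OF xvar_in_forms] unfolding kz.gfam_def
  by (auto simp: gr_zero gr_diff add.commute)

lemma gr_subset: "gr r b j \<subseteq> free_carrier r"
  by (auto simp: gr_def)

lemma vcomp_in_gr: "u \<in> free_carrier r \<Longrightarrow> vcomp b j u \<in> gr r b j"
  by (auto simp: gr_def free_carrier_def vcomp_def hcomp_in_forms)

lemma vcomp_add: "vcomp b j (u + u') = vcomp b j u + vcomp b j u'"
  by (auto simp: vcomp_def hcomp_add)

lemma vcomp_zero [simp]: "vcomp b j 0 = 0"
  by (auto simp: vcomp_def)

lemma vcomp_sum: "vcomp b j (sum f S) = (\<Sum>x\<in>S. vcomp b j (f x))"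
  by (rule ext) (simp add: vcomp_def sum_fun_apply hcomp_sum)

lemma vcomp_scale: "q \<in> forms i \<Longrightarrow> vcomp b j (vscale q u) = vscale q (vcomp b (j - i) u)"
  by (auto simp: vcomp_def hcomp_mult algebra_simps)

lemma vcomp_gr: "u \<in> gr r b j \<Longrightarrow> vcomp b l u = (if l = j then u else 0)"
proof (rule ext)
  fix k assume "u \<in> gr r b j"
  then have "u k \<in> forms (j - b k)" by (simp add: gr_iff)
  from hcomp_form[OF this, of "l - b k"] show "vcomp b l u k = (if l = j then u else 0) k"
    by (simp add: vcomp_def)
qed

lemma sum_vcomp:
  assumes "u \<in> free_carrier r"
  obtains L where "finite L" "u = (\<Sum>l\<in>L. vcomp b l u)"
proof
  let ?L = "\<Union>k<r. (\<lambda>m. int (mdeg m) + b k) ` Poly_Mapping.keys (u k)"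
  show fin: "finite ?L" by simp
  show "u = (\<Sum>l\<in>?L. vcomp b l u)"
  proof (rule ext)
    fix k
    show "u k = (\<Sum>l\<in>?L. vcomp b l u) k"
    proof (cases "k < r")
      case True
      have "(\<Sum>l\<in>?L. hcomp (l - b k) (u k)) = (\<Sum>l\<in>(\<lambda>l. l - b k) ` ?L. hcomp l (u k))"
        by (subst sum.reindex) (auto simp: inj_on_def)
      also have "\<dots> = u k"
        by (rule sum_hcomp) (use fin True in \<open>force simp: in_keys_iff image_iff\<close>)+
      finally show ?thesis by (simp add: vcomp_def sum_fun_apply)
    qed (use assms in \<open>simp add: vcomp_def free_carrier_def sum_fun_apply\<close>)
  qed
qed

definition hsub :: "nat \<Rightarrow> (nat \<Rightarrow> int) \<Rightarrow> (nat \<Rightarrow> ('a::field, 'v::finite) mpol) set \<Rightarrow> bool"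
  where "hsub r b U \<longleftrightarrow> vm.subspace U \<and> U \<subseteq> free_carrier r \<and> (\<forall>u\<in>U. \<forall>j. vcomp b j u \<in> U)"

lemma hsub_free_carrier: "hsub r b (free_carrier r)"
  using vcomp_in_gr gr_subset by (fastforce simp: hsub_def subspace_free_carrier)

lemma hsub_zero: "hsub r b {0}"
  by (auto simp: hsub_def free_carrier_def vm.subspace_def)

definition pieces :: "nat \<Rightarrow> (nat \<Rightarrow> int) \<Rightarrow> (nat \<Rightarrow> ('a::field, 'v::finite) mpol) set \<Rightarrow> int \<Rightarrow>
    (nat \<Rightarrow> ('a, 'v) mpol) set"
  where "pieces r b U j = U \<inter> gr r b j"

lemma gfam_pieces: "vm.subspace U \<Longrightarrow> kz.gfam (pieces r b U)"
  using gfam_gr[of r b] unfolding kz.gfam_def pieces_def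
  by (auto simp: vm.subspace_0 vm.subspace_diff vm.subspace_scale)

lemma pieces_zero: "pieces r b {0} = (\<lambda>_. {0})"
  by (auto simp: pieces_def gr_zero)

lemma pieces_free: "pieces r b (free_carrier r) = gr r b"
  by (auto simp: pieces_def gr_def)

text \<open>
  In each multidegree the Koszul complex of the polynomial ring is the chain complex of a simplex,
  which is contracted onto its least vertex.
\<close>

lemma koszul_contraction:
  fixes c :: "'v::finite set \<Rightarrow> nat \<Rightarrow> ('a::field, 'v) mpol"
  assumes c: "c \<in> kz.chains i j (gr r b)" and cyc: "\<And>Y. kz.bd c Y = 0"
    and const: "\<And>k. Poly_Mapping.lookup (c {} k) 0 = 0"
  shows "\<exists>w\<in>kz.chains (Suc i) j (gr r b). kz.bd w = c"
proof -
  let ?e = "\<lambda>v::'v. Poly_Mapping.single v (1::nat)"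
  define mn where "mn Y = arg_min to_nat (\<lambda>v::'v. v \<in> Y)" for Y
  have mn_eq: "mn Y = v" if "v \<in> Y" "\<And>w. w \<in> Y \<Longrightarrow> to_nat v \<le> to_nat w" for Y v
  proof -
    have "mn Y \<in> Y"
      unfolding mn_def using that(1) by (rule arg_min_natI)
    moreover have "to_nat (mn Y) \<le> to_nat v"
      unfolding mn_def using that(1) by (rule arg_min_nat_le)
    ultimately show ?thesis
      using that(2)[of "mn Y"] by auto
  qed
  have mn_in: "mn Y \<in> Y" and mn_le: "\<And>w. w \<in> Y \<Longrightarrow> to_nat (mn Y) \<le> to_nat w" if "Y \<noteq> {}" for Y
    using that unfolding mn_def by (auto intro: arg_min_natI arg_min_nat_le)
  define below where "below v m \<longleftrightarrow> (\<forall>w. to_nat w < to_nat v \<longrightarrow> Poly_Mapping.lookup m w = 0)"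
    for v :: 'v and m :: "'v \<Rightarrow>\<^sub>0 nat"
  \<comment> \<open>In the multidegree of the term with exponent \<open>m\<close> at
    \<open>Y\<close>, the simplex has as vertices the variables dividing the monomial or lying in
    \<open>Y\<close>, and \<open>below (mn Y) m\<close> says that \<open>mn Y\<close> is the least
    of them. The contraction moves this vertex from the exponent into the index set; being least, it
    contributes no sign.\<close>
  define w where "w Y k = (if Y = {} then 0 else Abs_poly_mapping (\<lambda>m. if below (mn Y) m
      then Poly_Mapping.lookup (c (Y - {mn Y}) k) (m + ?e (mn Y)) else 0))" for Y k
  have lookup_w: "Poly_Mapping.lookup (w Y k) m = (if Y \<noteq> {} \<and> below (mn Y) m
      then Poly_Mapping.lookup (c (Y - {mn Y}) k) (m + ?e (mn Y)) else 0)" for Y k m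
  proof -
    have "finite ((\<lambda>m. m + ?e (mn Y)) -` Poly_Mapping.keys (c (Y - {mn Y}) k))"
      by (rule finite_vimageI) (auto simp: inj_on_def)
    then have "finite {m. (if below (mn Y) m
      then Poly_Mapping.lookup (c (Y - {mn Y}) k) (m + ?e (mn Y)) else 0) \<noteq> 0}"
      by (rule rev_finite_subset) (auto simp: in_keys_iff)
    then show ?thesis
      by (simp add: w_def)
  qed
  have "w \<in> kz.chains (Suc i) j (gr r b)"
    unfolding kz.chains_def mem_Collect_eq
  proof (rule allI)
    fix Y :: "'v set"
    have card: "card (Y - {mn Y}) = i \<longleftrightarrow> card Y = Suc i" if "Y \<noteq> {}"
    proof -
      have "card Y = Suc (card (Y - {mn Y}))"
        by (rule card.remove[OF _ mn_in[OF that]]) simp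
      then show ?thesis by simp
    qed
    show "if card Y = Suc i then w Y \<in> gr r b (j - int (Suc i)) else w Y = 0"
    proof (cases "card Y = Suc i")
      case True
      then have ne: "Y \<noteq> {}" by auto
      have g: "c (Y - {mn Y}) \<in> gr r b (j - int i)"
        using kz.chainsD[OF c] card[OF ne] True by simp
      have "w Y k = 0" if "k \<ge> r" for k
        by (rule poly_mapping_eqI) (use g that in \<open>simp add: lookup_w gr_iff\<close>)
      moreover have "w Y k \<in> forms (j - int (Suc i) - b k)" for k
        unfolding forms_iff
      proof (intro allI impI)
        fix m assume "Poly_Mapping.lookup (w Y k) m \<noteq> 0"
        then have "Poly_Mapping.lookup (c (Y - {mn Y}) k) (m + ?e (mn Y)) \<noteq> 0"
          by (simp add: lookup_w split: if_splits)
        then have "int (mdeg (m + ?e (mn Y))) = j - int i - b k"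
          using g by (simp add: gr_iff forms_iff)
        then show "int (mdeg m) = j - int (Suc i) - b k"
          by (simp add: mdeg_add)
      qed
      ultimately show ?thesis using True by (simp add: gr_iff)
    next
      case False
      have "w Y k = 0" for k
        by (rule poly_mapping_eqI) (use card False kz.chainsD0[OF c, of "Y - {mn Y}"] in \<open>auto simp: lookup_w\<close>)
      then show ?thesis using False by (simp add: fun_eq_iff)
    qed
  qed
  moreover have "kz.bd w Y k = c Y k" for Y k
  proof (rule poly_mapping_eqI)
    fix m :: "'v \<Rightarrow>\<^sub>0 nat"
    have lookup_bd: "Poly_Mapping.lookup (kz.bd a Z k) n = (\<Sum>v\<in>-Z. ksign Z v
        (if Poly_Mapping.lookup n v > 0 then Poly_Mapping.lookup (a (insert v Z) k) (n - ?e v) else 0))"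
      for a :: "'v set \<Rightarrow> nat \<Rightarrow> ('a::field, 'v) mpol" and Z n
      unfolding kz.bd_def sum_fun_apply lookup_sum
      by (rule sum.cong[OF refl]) (auto simp: ksign_def lookup_xvar_mult)
    define s where "s = {v. Poly_Mapping.lookup m v > 0} \<union> Y"
    show "Poly_Mapping.lookup (kz.bd w Y k) m = Poly_Mapping.lookup (c Y k) m"
    proof (cases "s = {}")
      \<comment> \<open>Multidegree zero has no vertex to contract onto; here the hypothesis on the
        constant coefficients replaces the contraction.\<close>
      case True
      then have "Y = {}" "m = 0"
        by (auto simp: s_def intro: poly_mapping_eqI)
      then show ?thesis
        using const by (simp add: lookup_bd)
    next
      case ne: False
      define v0 where "v0 = mn s"
      have v0: "v0 \<in> s" "\<And>u. u \<in> s \<Longrightarrow> to_nat v0 \<le> to_nat u"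
        using mn_in[OF ne] mn_le[OF ne] by (auto simp: v0_def)
      have v0_less: "to_nat v0 < to_nat u" if "u \<in> s" "u \<noteq> v0" for u
        using v0(2)[OF that(1)] that(2) by (metis le_neq_implies_less to_nat_split)
      have below: "below v0 m"
        unfolding below_def s_def using v0(2) by (auto simp: s_def not_less) (meson leD not_gr_zero)
      have sign0: "ksign Z v0 a = a" if "Z \<subseteq> s" for Z and a :: 'a
      proof -
        have "{u \<in> Z. to_nat u < to_nat v0} = {}"
          using v0(2) that by (auto simp: not_less)
        then show ?thesis unfolding ksign_def by (simp only: card.empty even_zero if_True)
      qed
      show ?thesis
      proof (cases "v0 \<in> Y")
        case True
        let ?Z = "Y - {v0}"
        let ?t = "\<lambda>v. if Poly_Mapping.lookup m v > 0
          then Poly_Mapping.lookup (c (insert v ?Z) k) (m - ?e v + ?e v0) else 0"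
        have Y: "Y = insert v0 ?Z" using True by auto
        have "Poly_Mapping.lookup (kz.bd w Y k) m = (\<Sum>v\<in>-Y. - ksign ?Z v (?t v))"
          unfolding lookup_bd
        proof (rule sum.cong[OF refl])
          fix v assume v: "v \<in> - Y"
          show "ksign Y v (if Poly_Mapping.lookup m v > 0
              then Poly_Mapping.lookup (w (insert v Y) k) (m - ?e v) else 0) = - ksign ?Z v (?t v)"
          proof (cases "Poly_Mapping.lookup m v > 0")
            case pos: True
            have lt: "to_nat v0 < to_nat v"
              using v0_less[of v] pos v True by (auto simp: s_def)
            have mnv: "mn (insert v Y) = v0"
              by (rule mn_eq) (use True v0(2) lt in \<open>auto simp: s_def\<close>)
            have "below v0 (m - ?e v)"
              using below by (auto simp: below_def lookup_minus)
            moreover have "insert v Y - {v0} = insert v ?Z"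
              using lt by auto
            ultimately have "Poly_Mapping.lookup (w (insert v Y) k) (m - ?e v) = ?t v"
              using pos by (simp add: lookup_w mnv)
            then show ?thesis
              using pos lt ksign_insert[of v0 ?Z v "?t v"] Y by simp
          qed simp
        qed
        \<comment> \<open>The cycle condition at \<open>Y\<close> without \<open>v0\<close>, in the
          same multidegree, expresses the coefficient of \<open>c\<close> at \<open>Y\<close>
          through the other faces, which are up to sign the terms of
          \<open>kz.bd w Y\<close>.\<close>
        moreover have "0 = Poly_Mapping.lookup (kz.bd c ?Z k) (m + ?e v0)"
          by (simp add: cyc)
        moreover have "Poly_Mapping.lookup (kz.bd c ?Z k) (m + ?e v0) =
            Poly_Mapping.lookup (c Y k) m + (\<Sum>v\<in>-Y. ksign ?Z v (?t v))"
        proof -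
          have compl: "- ?Z = insert v0 (- Y)" using True by auto
          have step: "(if Poly_Mapping.lookup (m + ?e v0) v > 0
              then Poly_Mapping.lookup (c (insert v ?Z) k) (m + ?e v0 - ?e v) else 0) = ?t v"
            if "v \<in> - Y" for v
          proof -
            have "v \<noteq> v0" using that True by auto
            then have "m + ?e v0 - ?e v = m - ?e v + ?e v0"
              by (intro poly_mapping_eqI) (auto simp: lookup_add lookup_minus lookup_single when_def)
            then show ?thesis
              using \<open>v \<noteq> v0\<close> by (simp add: lookup_add lookup_single when_def)
          qed
          have "(\<Sum>v\<in>-Y. ksign ?Z v (if Poly_Mapping.lookup (m + ?e v0) v > 0
              then Poly_Mapping.lookup (c (insert v ?Z) k) (m + ?e v0 - ?e v) else 0)) =
              (\<Sum>v\<in>-Y. ksign ?Z v (?t v))"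
            by (rule sum.cong[OF refl]) (simp only: step)
          moreover have "insert v0 ?Z = Y" "?Z \<subseteq> s"
            using True by (auto simp: s_def)
          moreover have "v0 \<notin> - Y" using True by simp
          ultimately show ?thesis
            unfolding lookup_bd compl by (subst sum.insert) (auto simp: sign0 lookup_add)
        qed
        ultimately show ?thesis
          by (simp add: sum_negf add_eq_0_iff2)
      next
        \<comment> \<open>Now \<open>v0\<close> divides the monomial. For any other \<open>v\<close>
          the least element of \<open>insert v Y\<close> lies above \<open>v0\<close>, which still
          divides the exponent, so \<open>w\<close> vanishes there and only the face
          \<open>v = v0\<close> survives.\<close>
        case False
        then have m0: "Poly_Mapping.lookup m v0 > 0"
          using v0(1) by (auto simp: s_def)
        have "Poly_Mapping.lookup (kz.bd w Y k) m =
            (\<Sum>v\<in>-Y. if v = v0 then Poly_Mapping.lookup (c Y k) m else 0)"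
          unfolding lookup_bd
        proof (rule sum.cong[OF refl])
          fix v assume v: "v \<in> - Y"
          show "ksign Y v (if Poly_Mapping.lookup m v > 0
              then Poly_Mapping.lookup (w (insert v Y) k) (m - ?e v) else 0) =
              (if v = v0 then Poly_Mapping.lookup (c Y k) m else 0)"
          proof (cases "v = v0")
            case True
            have mnv: "mn (insert v0 Y) = v0"
              by (rule mn_eq) (use v0(2) in \<open>auto simp: s_def\<close>)
            have "below v0 (m - ?e v0)"
              using below by (auto simp: below_def lookup_minus)
            moreover have "m - ?e v0 + ?e v0 = m"
              by (rule poly_mapping_eqI) (use m0 in \<open>auto simp: lookup_add lookup_minus lookup_single when_def\<close>)
            moreover have "insert v0 Y - {v0} = Y" "Y \<subseteq> s"
              using False by (auto simp: s_def)
            ultimately show ?thesis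
              using True m0 by (simp add: lookup_w mnv sign0)
          next
            case neq: False
            have "\<not> below (mn (insert v Y)) (m - ?e v)" if pos: "Poly_Mapping.lookup m v > 0"
            proof -
              have "mn (insert v Y) \<in> insert v Y"
                by (rule mn_in) simp
              then have "mn (insert v Y) \<in> s" "mn (insert v Y) \<noteq> v0"
                using pos neq False by (auto simp: s_def)
              from v0_less[OF this] show ?thesis
                using m0 neq by (auto simp: below_def lookup_minus lookup_single)
            qed
            then show ?thesis
              using neq by (simp add: lookup_w)
          qed
        qed
        then show ?thesis
          using False by simp
      qed
    qed
  qed
  ultimately show ?thesis
    by (intro bexI[of _ w]) (auto simp: fun_eq_iff)
qed

text \<open>In positive homological degree the value at the empty set is 0, so the condition of
  \<open>koszul_contraction\<close> on constant coefficients is automatic.\<close>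

lemma koszul_gr_acyclic:
  assumes "c \<in> kz.chains (Suc i) j (gr r b)" "\<And>Y. kz.bd c Y = 0"
  shows "\<exists>w\<in>kz.chains (Suc (Suc i)) j (gr r b). kz.bd w = c"
  using assms kz.chainsD0[OF assms(1), of "{}"] by (intro koszul_contraction) auto

text \<open>The contraction in homological degree 0: regarded as a 0-cycle, \<open>z\<close> is the
  boundary of a 1-chain, and the values of that chain are the required homogeneous
  coefficients.\<close>

lemma in_irrelevant_part:
  fixes z :: "nat \<Rightarrow> ('a::field, 'v::finite) mpol"
  assumes z: "z \<in> gr r b j" and const: "\<And>k. Poly_Mapping.lookup (z k) 0 = 0"
  shows "\<exists>u. (\<forall>v. u v \<in> gr r b (j - 1)) \<and> z = (\<Sum>v\<in>UNIV. vscale (xvar v) (u v))"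
proof -
  define c where "c Y = (if Y = {} then z else 0)" for Y :: "'v set"
  have "c \<in> kz.chains 0 j (gr r b)"
    using z by (auto simp: kz.chains_def c_def)
  moreover have "kz.bd c Y = 0" for Y
    by (simp add: kz.bd_def c_def)
  moreover have "Poly_Mapping.lookup (c {} k) 0 = 0" for k
    by (simp add: c_def const)
  ultimately obtain w where w: "w \<in> kz.chains (Suc 0) j (gr r b)" "kz.bd w = c"
    using koszul_contraction by blast
  have "z = kz.bd w {}"
    by (simp add: w(2) c_def)
  also have "\<dots> = (\<Sum>v\<in>UNIV. vscale (xvar v) (w {v}))"
    by (simp add: kz.bd_def ksign_def)
  finally show ?thesis
    using kz.chainsD[OF w(1)] by (intro exI[of _ "\<lambda>v. w {v}"]) simp
qed

section \<open>Finite generation\<close>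

lemma nat_mono_subsequence:
  fixes g :: "nat \<Rightarrow> nat"
  shows "\<exists>t :: nat \<Rightarrow> nat. strict_mono t \<and> (\<forall>i j. i \<le> j \<longrightarrow> g (t i) \<le> g (t j))"
proof -
  obtain t where t: "strict_mono t" "monoseq (\<lambda>n. g (t n))"
    using seq_monosub[of g] by blast
  show ?thesis
  proof (cases "incseq (\<lambda>n. g (t n))")
    case True
    then show ?thesis using t(1) by (intro exI[of _ t]) (auto simp: incseq_def)
  next
    case False
    then have dec: "g (t j) \<le> g (t i)" if "i \<le> j" for i j
      using t(2) that by (auto simp: monoseq_iff decseq_def)
    \<comment> \<open>A weakly decreasing sequence of naturals is constant from the point where its
      least value is taken.\<close>
    obtain N where N: "\<And>n. g (t N) \<le> g (t n)"
      using ex_has_least_nat[of "\<lambda>_. True" 0 "\<lambda>n. g (t n)"] by auto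
    have eq: "g (t (N + n)) = g (t N)" for n
      using N[of "N + n"] dec[of N "N + n"] by simp
    show ?thesis
      by (rule exI[of _ "\<lambda>n. t (N + n)"]) (use t(1) eq in \<open>auto simp: strict_mono_def\<close>)
  qed
qed

text \<open>Dickson's lemma, with the coordinates given as a finite set of functions: passing to a
  subsequence once per coordinate makes all of them weakly increasing.\<close>

lemma dickson:
  fixes H :: "('t \<Rightarrow> nat) set" and f :: "nat \<Rightarrow> 't"
  assumes "finite H"
  shows "\<exists>i j. i < j \<and> (\<forall>h\<in>H. h (f i) \<le> h (f j))"
proof -
  have "\<exists>s :: nat \<Rightarrow> nat. strict_mono s \<and> (\<forall>h\<in>H. \<forall>i j. i \<le> j \<longrightarrow> h (f (s i)) \<le> h (f (s j)))"
    using assms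
  proof (induction H)
    case empty
    show ?case by (rule exI[of _ "\<lambda>x. x"]) (simp add: strict_mono_def)
  next
    case (insert h H)
    then obtain s :: "nat \<Rightarrow> nat" where s: "strict_mono s" "\<forall>h\<in>H. \<forall>i j. i \<le> j \<longrightarrow> h (f (s i)) \<le> h (f (s j))"
      by blast
    obtain t :: "nat \<Rightarrow> nat" where t: "strict_mono t" "\<forall>i j. i \<le> j \<longrightarrow> h (f (s (t i))) \<le> h (f (s (t j)))"
      using nat_mono_subsequence[of "\<lambda>n. h (f (s n))"] by (elim exE conjE)
    have "strict_mono (\<lambda>n. s (t n))"
      using s(1) t(1) by (simp add: strict_mono_def)
    moreover have "t i \<le> t j" if "i \<le> j" for i j
      using t(1) that by (simp add: strict_mono_less_eq)
    ultimately show ?case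
      using s(2) t(2) by (intro exI[of _ "\<lambda>n. s (t n)"]) auto
  qed
  then obtain s :: "nat \<Rightarrow> nat" where s: "strict_mono s" "\<forall>h\<in>H. \<forall>i j. i \<le> j \<longrightarrow> h (f (s i)) \<le> h (f (s j))"
    by blast
  have "s 0 < s 1"
    using s(1) by (simp add: strict_mono_def)
  then show ?thesis
    using s(2) by (intro exI[of _ "s 0"] exI[of _ "s 1"]) simp
qed

lemma finite_mdeg_le: "finite {m :: 'v::finite \<Rightarrow>\<^sub>0 nat. mdeg m \<le> n}"
proof -
  have "finite {f :: 'v \<Rightarrow> nat. \<forall>x. (x \<in> UNIV \<longrightarrow> f x \<in> {..n}) \<and> (x \<notin> UNIV \<longrightarrow> f x = 0)}"
    by (rule finite_set_of_finite_funs) auto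
  moreover have "Poly_Mapping.lookup m v \<le> mdeg m" for m :: "'v \<Rightarrow>\<^sub>0 nat" and v
    unfolding mdeg_def by (rule member_le_sum) auto
  from order_trans[OF this] have "Poly_Mapping.lookup ` {m :: 'v \<Rightarrow>\<^sub>0 nat. mdeg m \<le> n} \<subseteq>
      {f. \<forall>x. (x \<in> UNIV \<longrightarrow> f x \<in> {..n}) \<and> (x \<notin> UNIV \<longrightarrow> f x = 0)}"
    by auto
  ultimately have "finite (Poly_Mapping.lookup ` {m :: 'v \<Rightarrow>\<^sub>0 nat. mdeg m \<le> n})"
    by (rule rev_finite_subset)
  then show ?thesis
    by (rule finite_imageD) (auto simp: inj_on_def intro: poly_mapping_eqI)
qed

text \<open>
  A monomial order on the terms \<open>x\<^sup>m e\<^sub>k\<close> of a free module: the exponent vector, preceded by the index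
  \<open>k\<close>, is turned into an element of the lexicographically ordered type of finitely supported sequences.
\<close>

definition mkey :: "('v::finite \<Rightarrow>\<^sub>0 nat) \<Rightarrow> nat \<Rightarrow>\<^sub>0 nat"
  where "mkey m = (\<Sum>v\<in>UNIV. Poly_Mapping.single (Suc (to_nat v)) (Poly_Mapping.lookup m v))"

definition tkey :: "nat \<times> ('v::finite \<Rightarrow>\<^sub>0 nat) \<Rightarrow> nat \<Rightarrow>\<^sub>0 nat"
  where "tkey t = mkey (snd t) + Poly_Mapping.single 0 (fst t)"

lemma mkey_add: "mkey (m + n) = mkey m + mkey n"
  by (simp add: mkey_def lookup_add single_add sum.distrib)

lemma lookup_mkey: "Poly_Mapping.lookup (mkey m) (Suc (to_nat v)) = Poly_Mapping.lookup m v"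
proof -
  have "Poly_Mapping.lookup (mkey m) (Suc (to_nat v)) =
      (\<Sum>w\<in>UNIV. if w = v then Poly_Mapping.lookup m w else 0)"
    unfolding mkey_def lookup_sum by (intro sum.cong refl) (auto simp: lookup_single when_def)
  then show ?thesis by simp
qed

lemma inj_tkey:
  fixes s t :: "nat \<times> ('v::finite \<Rightarrow>\<^sub>0 nat)"
  shows "tkey s = tkey t \<Longrightarrow> s = t"
proof -
  assume eq: "tkey s = tkey t"
  have 0: "Poly_Mapping.lookup (mkey m) 0 = 0" for m :: "'v \<Rightarrow>\<^sub>0 nat"
    by (simp add: mkey_def lookup_sum lookup_single)
  have "fst s = fst t"
    using arg_cong[OF eq, of "\<lambda>p. Poly_Mapping.lookup p 0"] by (simp add: tkey_def lookup_add 0)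
  moreover have "Poly_Mapping.lookup (snd s) v = Poly_Mapping.lookup (snd t) v" for v
    using arg_cong[OF eq, of "\<lambda>p. Poly_Mapping.lookup p (Suc (to_nat v))"]
    by (simp add: tkey_def lookup_add lookup_mkey lookup_single)
  ultimately show ?thesis
    by (simp add: prod_eq_iff poly_mapping_eqI)
qed

definition vterms :: "(nat \<Rightarrow> ('a::field, 'v::finite) mpol) \<Rightarrow> (nat \<times> ('v \<Rightarrow>\<^sub>0 nat)) set"
  where "vterms u = {(k, m). Poly_Mapping.lookup (u k) m \<noteq> 0}"

lemma lookup_single_mult_add:
  fixes p :: "('a::field, 'v::finite) mpol"
  shows "Poly_Mapping.lookup (Poly_Mapping.single n a * p) (n + m) = a * Poly_Mapping.lookup p m"
  by (simp add: lookup_mult lookup_single when_mult)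

text \<open>A Groebner basis argument. Leading terms of homogeneous elements that are minimal for
  divisibility are finitely many by \<open>dickson\<close>; one homogeneous element for each of them
  generates, since every element can be divided by them with a remainder of smaller leading
  term.\<close>

lemma homogeneous_generators:
  fixes U :: "(nat \<Rightarrow> ('a::field, 'v::finite) mpol) set"
  assumes U: "hsub r b U"
  shows "\<exists>G. finite G \<and> G \<subseteq> U \<and> (\<forall>x\<in>G. \<exists>j. x \<in> gr r b j) \<and> U \<subseteq> vm.span G"
proof -
  have sub: "vm.subspace U" using U by (simp add: hsub_def)
  define lead where "lead t u \<longleftrightarrow> t \<in> vterms u \<and> (\<forall>s\<in>vterms u. tkey s \<le> tkey t)"
    for t and u :: "nat \<Rightarrow> ('a, 'v) mpol"
  define L where "L = {t. \<exists>j u. u \<in> U \<and> u \<in> gr r b j \<and> lead t u}"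
  define dom where "dom s t \<longleftrightarrow> fst s = fst t \<and> (\<forall>v. Poly_Mapping.lookup (snd s) v \<le> Poly_Mapping.lookup (snd t) v)"
    for s t :: "nat \<times> ('v \<Rightarrow>\<^sub>0 nat)"
  define L0 where "L0 = {t \<in> L. \<forall>s\<in>L. dom s t \<longrightarrow> s = t}"
  have L_r: "fst t < r" if "t \<in> L" for t
    using that by (force simp: L_def lead_def vterms_def gr_iff not_le)
  have fin: "finite L0"
  proof (rule ccontr)
    assume "infinite L0"
    then obtain f :: "nat \<Rightarrow> _" where f: "inj f" "range f \<subseteq> L0"
      using infinite_countable_subset by blast
    \<comment> \<open>Including both the basis index and \<open>r\<close> minus that index among the
      coordinates forces the indices of the two terms to be equal.\<close>
    let ?H = "{\<lambda>t. fst t, \<lambda>t. r - fst t} \<union> range (\<lambda>(v::'v) t. Poly_Mapping.lookup (snd t) v)"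
    have "finite ?H" by (intro finite_UnI finite_imageI finite.intros finite)
    from dickson[OF this, of f] obtain i j where ij: "i < j" and
      "\<forall>h\<in>?H. h (f i) \<le> h (f j)" by (elim exE conjE)
    then have le: "\<And>h. h \<in> ?H \<Longrightarrow> h (f i) \<le> h (f j)"
      by (elim bspec)
    have mem: "f i \<in> L0" "f j \<in> L0" using f(2) by auto
    have "fst (f i) \<le> fst (f j)" "r - fst (f i) \<le> r - fst (f j)"
      using le[of "\<lambda>t. fst t"] le[of "\<lambda>t. r - fst t"] by auto
    moreover have "fst (f j) < r" "fst (f i) < r"
      using mem L_r by (auto simp: L0_def)
    moreover have "Poly_Mapping.lookup (snd (f i)) v \<le> Poly_Mapping.lookup (snd (f j)) v" for v
      using le[of "\<lambda>t. Poly_Mapping.lookup (snd t) v"] by auto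
    ultimately have "dom (f i) (f j)"
      by (auto simp: dom_def)
    then have "f i = f j"
      using mem by (auto simp: L0_def)
    then show False
      using f(1) ij by (auto simp: inj_def)
  qed
  have L0_below: "\<exists>s\<in>L0. dom s t" if "t \<in> L" for t
  proof -
    have "t \<in> L \<and> dom t t" using that by (simp add: dom_def)
    \<comment> \<open>Among the divisors of \<open>t\<close> in \<open>L\<close>, one of least total
      degree is minimal for divisibility.\<close>
    then obtain s where s: "s \<in> L" "dom s t" and
      least: "\<And>s'. s' \<in> L \<and> dom s' t \<Longrightarrow> mdeg (snd s) \<le> mdeg (snd s')"
      using ex_has_least_nat[of "\<lambda>s. s \<in> L \<and> dom s t" t "\<lambda>s. mdeg (snd s)"] by auto
    have "s' = s" if s': "s' \<in> L" "dom s' s" for s'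
    proof -
      have "dom s' t"
        using s' s(2) by (auto simp: dom_def intro: order_trans)
      then have deg: "mdeg (snd s) \<le> mdeg (snd s')"
        using least s'(1) by blast
      have le: "Poly_Mapping.lookup (snd s') v \<le> Poly_Mapping.lookup (snd s) v" for v
        using s'(2) by (simp add: dom_def)
      have "Poly_Mapping.lookup (snd s') v = Poly_Mapping.lookup (snd s) v" for v
      proof (rule ccontr)
        assume "Poly_Mapping.lookup (snd s') v \<noteq> Poly_Mapping.lookup (snd s) v"
        then have "Poly_Mapping.lookup (snd s') v < Poly_Mapping.lookup (snd s) v"
          using le[of v] by simp
        then have "mdeg (snd s') < mdeg (snd s)"
          unfolding mdeg_def using le by (intro sum_strict_mono_ex1) auto
        then show False using deg by simp
      qed
      then show ?thesis
        using s'(2) by (simp add: dom_def prod_eq_iff poly_mapping_eqI)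
    qed
    then have "s \<in> L0" using s(1) by (auto simp: L0_def)
    then show ?thesis using s(2) by blast
  qed
  have "\<forall>t\<in>L0. \<exists>u. u \<in> U \<and> (\<exists>j. u \<in> gr r b j) \<and> lead t u"
    by (auto simp: L0_def L_def)
  then obtain w where w: "\<And>t. t \<in> L0 \<Longrightarrow> w t \<in> U" "\<And>t. t \<in> L0 \<Longrightarrow> \<exists>j. w t \<in> gr r b j"
    "\<And>t. t \<in> L0 \<Longrightarrow> lead t (w t)"
    by metis
  let ?S = "vm.span (w ` L0)"
  have hom: "u \<in> ?S" if "u \<in> U" "u \<in> gr r b j" for u j
  proof -
    \<comment> \<open>A finite set containing the keys of all terms that can occur in degree
      \<open>j\<close>. The number of keys in \<open>K\<close> up to the leading one is the measure
      for which division terminates.\<close>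
    define K where "K = tkey ` (\<Union>k<r. Pair k ` {m :: 'v \<Rightarrow>\<^sub>0 nat. mdeg m \<le> nat (j - b k)})"
    have finK: "finite K"
      unfolding K_def using finite_mdeg_le by blast
    have K: "tkey t \<in> K" if "t \<in> vterms u" "u \<in> gr r b j" for t and u :: "nat \<Rightarrow> ('a, 'v) mpol"
    proof -
      obtain k m where t: "t = (k, m)" by force
      have "Poly_Mapping.lookup (u k) m \<noteq> 0" using that(1) by (simp add: vterms_def t)
      then have "k < r" "int (mdeg m) = j - b k"
        using that(2) by (auto simp: gr_iff forms_iff not_le[symmetric])
      then show ?thesis by (force simp: K_def t)
    qed
    have "u \<in> ?S" if "u \<in> U" "u \<in> gr r b j" "\<forall>t\<in>vterms u. card {\<kappa> \<in> K. \<kappa> \<le> tkey t} \<le> n" for n u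
      using that
    proof (induction n arbitrary: u)
      case 0
      have "vterms u = {}"
      proof (rule ccontr)
        assume "vterms u \<noteq> {}"
        then obtain t where t: "t \<in> vterms u" by blast
        then have "tkey t \<in> {\<kappa> \<in> K. \<kappa> \<le> tkey t}" using K[OF t 0(2)] by simp
        then show False using 0(3) t finK by (auto simp: card_eq_0_iff)
      qed
      then have "u k = 0" for k
        by (intro poly_mapping_eqI) (auto simp: vterms_def)
      then have "u = 0" by (simp add: fun_eq_iff)
      then show ?case using vm.span_zero by metis
    next
      case (Suc n)
      show ?case
      proof (cases "vterms u = {}")
        case True
        then have "u k = 0" for k
          by (intro poly_mapping_eqI) (auto simp: vterms_def)
        then have "u = 0" by (simp add: fun_eq_iff)
        then show ?thesis using vm.span_zero by metis
      next
        case False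
        have fink: "finite (tkey ` vterms u)"
          by (rule finite_subset[OF _ finK]) (use K Suc.prems(2) in auto)
        then have "Max (tkey ` vterms u) \<in> tkey ` vterms u"
          using False by (intro Max_in) auto
        then obtain t where t: "t \<in> vterms u" "tkey t = Max (tkey ` vterms u)" by auto
        have lead: "lead t u"
          using t fink by (auto simp: lead_def)
        then have "t \<in> L" using Suc.prems by (auto simp: L_def)
        then obtain s where s: "s \<in> L0" "dom s t" using L0_below by blast
        obtain k m where km: "t = (k, m)" by force
        obtain m0 where s_eq: "s = (k, m0)" and le: "\<And>v. Poly_Mapping.lookup m0 v \<le> Poly_Mapping.lookup m v"
          using s(2) by (cases s) (auto simp: dom_def km)
        define q where "q = m - m0"
        have m: "m = q + m0"
          by (rule poly_mapping_eqI) (use le in \<open>simp add: q_def lookup_add lookup_minus\<close>)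
        let ?g = "w s"
        obtain j0 where j0: "?g \<in> gr r b j0" using w(2)[OF s(1)] by blast
        have c0: "Poly_Mapping.lookup (?g k) m0 \<noteq> 0"
          using w(3)[OF s(1)] by (auto simp: lead_def vterms_def s_eq)
        have c: "Poly_Mapping.lookup (u k) m \<noteq> 0"
          using t(1) by (simp add: vterms_def km)
        have deg: "int (mdeg q) + j0 = j"
        proof -
          have "int (mdeg m0) = j0 - b k" "int (mdeg m) = j - b k"
            using j0 c0 c Suc.prems(2) by (auto simp: gr_iff forms_iff)
          then show ?thesis by (simp add: m mdeg_add)
        qed
        \<comment> \<open>The quotient of the two leading coefficients, so that subtracting
          \<open>h\<close> cancels the leading term of \<open>u\<close>.\<close>
        define a where "a = Poly_Mapping.lookup (u k) m / Poly_Mapping.lookup (?g k) m0"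
        define h where "h = vscale (Poly_Mapping.single q a) ?g"
        have "w s \<in> w ` L0" using s(1) by simp
        then have h: "h \<in> U" "h \<in> gr r b j" "h \<in> ?S"
          using w(1)[OF s(1)] sub gr_scale[OF single_in_forms j0, of q a] deg
          by (simp_all add: h_def vm.subspace_scale vm.span_scale vm.span_base)
        have h_terms: "\<exists>s'\<in>vterms ?g. tkey t' = tkey s' + mkey q \<and> (s' = s \<longleftrightarrow> t' = t)"
          if t': "t' \<in> vterms h" for t'
        proof -
          obtain k' m' where km': "t' = (k', m')" by force
          have "m' \<in> Poly_Mapping.keys (Poly_Mapping.single q a * ?g k')"
            using t' by (simp add: vterms_def km' h_def in_keys_iff)
          then obtain m'' where m'': "m' = q + m''" "m'' \<in> Poly_Mapping.keys (?g k')"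
            using keys_mult[of "Poly_Mapping.single q a" "?g k'"] by (fastforce split: if_splits)
          then have "(k', m'') \<in> vterms ?g"
            by (simp add: vterms_def in_keys_iff)
          then show ?thesis
            by (intro bexI[of _ "(k', m'')"])
              (auto simp: km' km m''(1) m s_eq tkey_def mkey_add ac_simps)
        qed
        have less: "tkey t' < tkey t" if "t' \<in> vterms (u - h)" for t'
        proof -
          obtain k' m' where km': "t' = (k', m')" by force
          have nz: "Poly_Mapping.lookup (u k') m' - Poly_Mapping.lookup (h k') m' \<noteq> 0"
            using that by (simp add: vterms_def km' lookup_minus)
          have tk: "tkey t = tkey s + mkey q"
            by (simp add: km s_eq m tkey_def mkey_add ac_simps)
          have "t' \<in> vterms u \<or> t' \<in> vterms h"
            using nz by (auto simp: vterms_def km')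
          then have "tkey t' \<le> tkey t"
          proof
            assume "t' \<in> vterms h"
            then obtain s' where s': "s' \<in> vterms ?g" "tkey t' = tkey s' + mkey q"
              using h_terms by blast
            then show ?thesis
              using w(3)[OF s(1)] by (auto simp: tk lead_def intro: add_right_mono)
          qed (use lead in \<open>simp add: lead_def\<close>)
          moreover have "t' \<noteq> t"
          proof
            assume "t' = t"
            then have "k' = k" "m' = m" by (auto simp: km km')
            moreover have "Poly_Mapping.lookup (h k) m = Poly_Mapping.lookup (u k) m"
              using c0 by (simp add: h_def m lookup_single_mult_add) (simp add: a_def m)
            ultimately show False using nz by simp
          qed
          ultimately show ?thesis
            using inj_tkey[of t' t] by (metis order_le_less)
        qed
        have "u - h \<in> ?S"
        proof (rule Suc.IH)
          show "u - h \<in> U" "u - h \<in> gr r b j"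
            using h Suc.prems sub by (auto intro: vm.subspace_diff gr_diff)
          show "\<forall>t'\<in>vterms (u - h). card {\<kappa> \<in> K. \<kappa> \<le> tkey t'} \<le> n"
          proof
            fix t' assume "t' \<in> vterms (u - h)"
            then have lt: "tkey t' < tkey t" by (rule less)
            have "{\<kappa> \<in> K. \<kappa> \<le> tkey t'} \<subset> {\<kappa> \<in> K. \<kappa> \<le> tkey t}"
              using lt K[OF t(1) Suc.prems(2)] by force
            then have "card {\<kappa> \<in> K. \<kappa> \<le> tkey t'} < card {\<kappa> \<in> K. \<kappa> \<le> tkey t}"
              using finK by (intro psubset_card_mono) auto
            then show "card {\<kappa> \<in> K. \<kappa> \<le> tkey t'} \<le> n"
              using Suc.prems(3) t(1) by fastforce
          qed
        qed
        from vm.span_add[OF this h(3)] show ?thesis by (simp only: diff_add_cancel)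
      qed
    qed
    note main = this
    have "card {\<kappa> \<in> K. \<kappa> \<le> tkey t} \<le> card K" for t
      using finK by (intro card_mono) auto
    with main[OF that, of "card K"] show ?thesis by blast
  qed
  have "U \<subseteq> ?S"
  proof
    fix u assume u: "u \<in> U"
    then have "u \<in> free_carrier r" using U by (auto simp: hsub_def)
    then obtain J where J: "finite J" "u = (\<Sum>l\<in>J. vcomp b l u)" by (rule sum_vcomp)
    have "vcomp b l u \<in> ?S" for l
      by (rule hom[OF _ vcomp_in_gr[OF \<open>u \<in> free_carrier r\<close>]]) (use U u in \<open>simp add: hsub_def\<close>)
    then have "(\<Sum>l\<in>J. vcomp b l u) \<in> ?S" by (intro vm.span_sum)
    then show "u \<in> ?S" using J(2) by simp
  qed
  then show ?thesis
    using fin w(1,2) by (intro exI[of _ "w ` L0"]) auto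
qed

section \<open>Minimal generators and syzygies\<close>

definition lincomb :: "nat \<Rightarrow> (nat \<Rightarrow> nat \<Rightarrow> ('a::field, 'v::finite) mpol) \<Rightarrow>
    (nat \<Rightarrow> ('a, 'v) mpol) \<Rightarrow> nat \<Rightarrow> ('a, 'v) mpol"
  where "lincomb r g v = (\<Sum>k<r. vscale (v k) (g k))"

lemma lincomb_apply: "lincomb r g v l = (\<Sum>k<r. v k * g k l)"
  by (simp add: lincomb_def sum_fun_apply)

lemma lincomb_diff: "lincomb r g (v - v') = lincomb r g v - lincomb r g v'"
  and lincomb_add: "lincomb r g (v + v') = lincomb r g v + lincomb r g v'"
  and lincomb_zero: "lincomb r g 0 = 0"
  and lincomb_scale: "lincomb r g (vscale p v) = vscale p (lincomb r g v)"
  by (rule ext; simp add: lincomb_apply algebra_simps sum_subtractf sum.distrib sum_distrib_left)+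

lemma lincomb_sum: "lincomb r g (sum f S) = (\<Sum>x\<in>S. lincomb r g (f x))"
  by (induction S rule: infinite_finite_induct) (simp_all only: lincomb_zero lincomb_add sum.infinite sum.empty sum.insert not_False_eq_True)

lemma lincomb_in_subspace:
  "vm.subspace U \<Longrightarrow> (\<And>k. k < r \<Longrightarrow> g k \<in> U) \<Longrightarrow> lincomb r g v \<in> U"
  unfolding lincomb_def by (intro vm.subspace_sum vm.subspace_scale) auto

lemma vcomp_diff: "vcomp b j (u - u') = vcomp b j u - vcomp b j u'"
  using vcomp_add[of b j "u - u'" u'] by simp

lemma vcomp_scale_gr:
  assumes "u \<in> gr s \<beta> i"
  shows "vcomp \<beta> j (vscale p u) = vscale (hcomp (j - i) p) u"
proof (rule ext)
  fix k
  have "u k \<in> forms (i - \<beta> k)" using assms by (simp add: gr_iff)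
  from hcomp_mult[OF this, of "j - \<beta> k" p]
  show "vcomp \<beta> j (vscale p u) k = vscale (hcomp (j - i) p) u k"
    by (simp add: vcomp_def mult.commute)
qed

lemma vcomp_lincomb:
  assumes "\<And>k. k < r \<Longrightarrow> g k \<in> gr s \<beta> (b k)"
  shows "vcomp \<beta> j (lincomb r g v) = lincomb r g (vcomp b j v)"
proof -
  have "vcomp \<beta> j (vscale (v k) (g k)) = vscale (vcomp b j v k) (g k)" if "k < r" for k
    using vcomp_scale_gr[OF assms[OF that]] by (simp add: vcomp_def)
  then show ?thesis
    unfolding lincomb_def vcomp_sum by (intro sum.cong refl) auto
qed

lemma lincomb_gr:
  assumes "\<And>k. k < r \<Longrightarrow> g k \<in> gr s \<beta> (b k)" "v \<in> gr r b j"
  shows "lincomb r g v \<in> gr s \<beta> j"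
  unfolding lincomb_def
proof (intro gr_sum)
  fix k assume "k \<in> {..<r}"
  then show "vscale (v k) (g k) \<in> gr s \<beta> j"
    using gr_scale[of "v k" "j - b k" "g k" s \<beta> "b k"] assms by (auto simp: gr_iff)
qed

definition syz :: "nat \<Rightarrow> (nat \<Rightarrow> nat \<Rightarrow> ('a::field, 'v::finite) mpol) \<Rightarrow>
    (nat \<Rightarrow> ('a, 'v) mpol) set \<Rightarrow> (nat \<Rightarrow> ('a, 'v) mpol) set"
  where "syz r g A = {v \<in> free_carrier r. lincomb r g v \<in> A}"

text \<open>Generation and relations are both taken modulo \<open>A\<close>, so that one notion
  covers the module B/A itself and, with \<open>A = {0}\<close>, all its syzygy modules. The last
  clause is minimality: no relation has an invertible coefficient in lowest degree.\<close>

definition min_gens :: "nat \<Rightarrow> (nat \<Rightarrow> int) \<Rightarrow> (nat \<Rightarrow> ('a::field, 'v::finite) mpol) set \<Rightarrow>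
    (nat \<Rightarrow> ('a, 'v) mpol) set \<Rightarrow> nat \<Rightarrow> (nat \<Rightarrow> int) \<Rightarrow> (nat \<Rightarrow> nat \<Rightarrow> ('a, 'v) mpol) \<Rightarrow> bool"
  where "min_gens s \<beta> B A r b g \<longleftrightarrow>
    (\<forall>k<r. g k \<in> B \<and> g k \<in> gr s \<beta> (b k)) \<and>
    (\<forall>x\<in>B. \<exists>v\<in>free_carrier r. x - lincomb r g v \<in> A) \<and>
    (\<forall>v\<in>syz r g A. \<forall>k. Poly_Mapping.lookup (v k) 0 = 0)"

lemma hsub_syz:
  assumes A: "hsub s \<beta> A" and g: "\<And>k. k < r \<Longrightarrow> g k \<in> gr s \<beta> (b k)"
  shows "hsub r b (syz r g A)"
  unfolding hsub_def
proof (intro conjI ballI allI)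
  have A': "vm.subspace A" using A by (simp add: hsub_def)
  show "vm.subspace (syz r g A)"
    using A' subspace_free_carrier[of r] unfolding vm.subspace_def syz_def
    by (auto simp: lincomb_zero lincomb_add lincomb_scale)
  show "syz r g A \<subseteq> free_carrier r" by (auto simp: syz_def)
  fix u j assume u: "u \<in> syz r g A"
  then have "vcomp \<beta> j (lincomb r g u) \<in> A"
    using A by (auto simp: hsub_def syz_def)
  then show "vcomp b j u \<in> syz r g A"
    using u vcomp_in_gr[of u r b j] gr_subset[of r b j]
    by (auto simp: syz_def vcomp_lincomb[OF g])
qed

text \<open>A homogeneous generating set of least cardinality is minimal: a relation with a nonzero
  constant coefficient would express one generator by the others modulo \<open>A\<close>.\<close>

lemma min_gens_exist:
  fixes B :: "(nat \<Rightarrow> ('a::field, 'v::finite) mpol) set"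
  assumes B: "hsub s \<beta> B" and A: "hsub s \<beta> A"
  shows "\<exists>r b g. min_gens s \<beta> B A r b g"
proof -
  have subA: "vm.subspace A" using A by (simp add: hsub_def)
  define Q where "Q G \<longleftrightarrow> finite G \<and> G \<subseteq> B \<and> (\<forall>x\<in>G. \<exists>j. x \<in> gr s \<beta> j) \<and>
    (\<forall>x\<in>B. \<exists>y\<in>vm.span G. x - y \<in> A)" for G
  obtain G0 where "finite G0" "G0 \<subseteq> B" "\<forall>x\<in>G0. \<exists>j. x \<in> gr s \<beta> j" "B \<subseteq> vm.span G0"
    using homogeneous_generators[OF B] by blast
  then have "Q G0"
    unfolding Q_def using vm.subspace_0[OF subA] by (metis diff_self subsetD)
  then obtain G where G: "Q G" and least: "\<And>G'. Q G' \<Longrightarrow> card G \<le> card G'"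
    using ex_has_least_nat[of Q G0 card] by auto
  define r where "r = card G"
  obtain g where g: "bij_betw g {..<r} G"
    using ex_bij_betw_nat_finite[of G] G by (auto simp: Q_def r_def atLeast0LessThan)
  have gG: "g k \<in> G" if "k < r" for k
    using bij_betwE[OF g] that by auto
  have "\<forall>k. \<exists>j. k < r \<longrightarrow> g k \<in> gr s \<beta> j"
    using gG G by (auto simp: Q_def)
  then obtain b where b: "\<And>k. k < r \<Longrightarrow> g k \<in> gr s \<beta> (b k)"
    by metis
  have span: "\<exists>v\<in>free_carrier r. y = lincomb r g v" if y: "y \<in> vm.span G" for y
  proof -
    obtain u where u: "y = (\<Sum>x\<in>G. vscale (u x) x)"
      using y G by (auto simp: Q_def vm.span_finite)
    have "y = (\<Sum>k<r. vscale (u (g k)) (g k))"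
      unfolding u by (rule sum.reindex_bij_betw[OF g, symmetric])
    then have "y = lincomb r g (\<lambda>k. if k < r then u (g k) else 0)"
      by (simp add: lincomb_def)
    then show ?thesis
      by (intro bexI[of _ "\<lambda>k. if k < r then u (g k) else 0"]) (auto simp: free_carrier_def)
  qed
  have "Poly_Mapping.lookup (v k) 0 = 0" if v: "v \<in> syz r g A" for v k
  proof (rule ccontr)
    assume c: "Poly_Mapping.lookup (v k) 0 \<noteq> 0"
    define c where "c = Poly_Mapping.lookup (v k) 0"
    have k: "k < r"
      using c v by (auto simp: syz_def free_carrier_def not_less[symmetric])
    \<comment> \<open>In the component of degree \<open>b k\<close> of the relation, the coefficient
      of \<open>g k\<close> has degree 0, hence is the scalar \<open>c\<close> and can be divided
      out.\<close>
    let ?v = "vcomp b (b k) v" and ?G = "G - {g k}"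
    define y where "y = (\<Sum>l\<in>{..<r} - {k}. vscale (?v l) (g l))"
    have "vcomp \<beta> (b k) (lincomb r g v) \<in> A"
      using v A by (auto simp: hsub_def syz_def)
    then have "lincomb r g ?v \<in> A"
      by (simp add: vcomp_lincomb[OF b])
    moreover have "lincomb r g ?v = vscale (?v k) (g k) + y"
      unfolding lincomb_def y_def using k by (intro sum.remove) auto
    moreover have "?v k = Poly_Mapping.single 0 c"
      using forms_0_const[OF hcomp_in_forms[of 0 "v k"]]
      by (simp add: vcomp_def c_def lookup_hcomp)
    ultimately have "vscale (Poly_Mapping.single 0 c) (g k) + y \<in> A" by simp
    from vm.subspace_scale[OF subA this, of "Poly_Mapping.single 0 (1 / c)"]
    have gk: "g k + vscale (Poly_Mapping.single 0 (1 / c)) y \<in> A" (is "g k + ?y \<in> A")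
      using c by (simp add: vm.scale_right_distrib mult_single c_def)
    have "y \<in> vm.span ?G"
      unfolding y_def
    proof (intro vm.span_sum vm.span_scale vm.span_base)
      fix l assume "l \<in> {..<r} - {k}"
      then show "g l \<in> ?G"
        using gG k bij_betw_imp_inj_on[OF g] by (auto dest: inj_onD)
    qed
    then have y: "?y \<in> vm.span ?G" by (rule vm.span_scale)
    have "Q ?G"
      unfolding Q_def
    proof (intro conjI ballI)
      fix x assume "x \<in> B"
      then obtain z where z: "z \<in> vm.span G" "x - z \<in> A" using G by (auto simp: Q_def)
      have "G = insert (g k) ?G" using gG[OF k] by auto
      then obtain p where p: "z - vscale p (g k) \<in> vm.span ?G"
        using z(1) vm.span_insert[of "g k" ?G] by auto
      show "\<exists>y\<in>vm.span ?G. x - y \<in> A"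
      proof
        show "(z - vscale p (g k)) - vscale p ?y \<in> vm.span ?G"
          by (rule vm.span_diff[OF p vm.span_scale[OF y]])
        have "x - ((z - vscale p (g k)) - vscale p ?y) = (x - z) + vscale p (g k + ?y)"
          by (simp add: vm.scale_right_distrib)
        then show "x - ((z - vscale p (g k)) - vscale p ?y) \<in> A"
          using z(2) gk subA by (metis vm.subspace_add vm.subspace_scale)
      qed
    qed (use G in \<open>auto simp: Q_def\<close>)
    from least[OF this] have "card G \<le> card ?G" .
    moreover have "card ?G < card G"
      using G gG[OF k] by (intro card_Diff1_less) (auto simp: Q_def)
    ultimately show False by simp
  qed
  moreover have "\<exists>v\<in>free_carrier r. x - lincomb r g v \<in> A" if "x \<in> B" for x
    using G that span unfolding Q_def by metis
  ultimately have "min_gens s \<beta> B A r b g"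
    using gG G b unfolding min_gens_def Q_def by blast
  then show ?thesis by blast
qed

lemma min_gens_lift:
  assumes gens: "min_gens s \<beta> B A r b g" and B: "hsub s \<beta> B" and A: "hsub s \<beta> A" and AB: "A \<subseteq> B"
    and x: "x \<in> pieces s \<beta> B j"
  shows "\<exists>f\<in>gr r b j. x - lincomb r g f \<in> pieces s \<beta> A j"
proof -
  have g: "\<And>k. k < r \<Longrightarrow> g k \<in> gr s \<beta> (b k)"
    using gens by (simp add: min_gens_def)
  obtain v where v: "v \<in> free_carrier r" "x - lincomb r g v \<in> A"
    using gens x by (auto simp: min_gens_def pieces_def)
  have x': "x \<in> gr s \<beta> j" using x by (simp add: pieces_def)
  have "vcomp \<beta> j (x - lincomb r g v) \<in> A"
    using v(2) A by (auto simp: hsub_def)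
  moreover have "vcomp \<beta> j (x - lincomb r g v) = x - lincomb r g (vcomp b j v)"
    using vcomp_gr[OF x', of j] by (simp add: vcomp_diff vcomp_lincomb[OF g])
  moreover have "vcomp b j v \<in> gr r b j" using v(1) by (rule vcomp_in_gr)
  ultimately show ?thesis
    using gr_diff[OF x' lincomb_gr[OF g, where v = "vcomp b j v" and j = j]]
    by (intro bexI[of _ "vcomp b j v"]) (auto simp: pieces_def)
qed

lemma tor_Suc_iff_syz:
  fixes B :: "(nat \<Rightarrow> ('a::field, 'v::finite) mpol) set"
  assumes gens: "min_gens s \<beta> B A r b g" and B: "hsub s \<beta> B" and A: "hsub s \<beta> A" and AB: "A \<subseteq> B"
  shows "kz.tor (pieces s \<beta> B) (pieces s \<beta> A) (Suc i) j \<longleftrightarrow>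
    kz.tor (pieces r b (syz r g A)) (pieces r b {0}) i j"
  unfolding pieces_zero
proof (rule kz.tor_dimension_shift[of "gr r b" _ _ _ "lincomb r g"])
  have g: "\<And>k. k < r \<Longrightarrow> g k \<in> gr s \<beta> (b k)" "\<And>k. k < r \<Longrightarrow> g k \<in> B"
    using gens by (auto simp: min_gens_def)
  have sub: "vm.subspace A" "vm.subspace B" "vm.subspace (syz r g A)"
    using A B hsub_syz[OF A g(1)] by (auto simp: hsub_def)
  show "kz.gfam (gr r b)" "kz.gfam (pieces s \<beta> A)" "kz.gfam (pieces s \<beta> B)" "kz.gfam (pieces r b (syz r g A))"
    using sub by (auto intro: gfam_gr gfam_pieces)
  show "lincomb r g (a - a') = lincomb r g a - lincomb r g a'" for a a'
    by (rule lincomb_diff)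
  show "lincomb r g (vscale (xvar v) a) = vscale (xvar v) (lincomb r g a)" for v a
    by (rule lincomb_scale)
  show "lincomb r g f \<in> pieces s \<beta> B j" if "f \<in> gr r b j" for f j
    using lincomb_gr[OF g(1) that] lincomb_in_subspace[OF sub(2) g(2)] by (auto simp: pieces_def)
  show "\<exists>f\<in>gr r b j. x - lincomb r g f \<in> pieces s \<beta> A j" if "x \<in> pieces s \<beta> B j" for x j
    by (rule min_gens_lift[OF gens B A AB that])
  show "pieces r b (syz r g A) j = {f \<in> gr r b j. lincomb r g f \<in> pieces s \<beta> A j}" for j
    using lincomb_gr[OF g(1), where j = j] gr_subset[of r b j] by (auto simp: pieces_def syz_def)
  show "\<exists>w\<in>kz.chains (Suc (Suc i)) j (gr r b). kz.bd w = c"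
    if "c \<in> kz.chains (Suc i) j (gr r b)" "\<And>Y. kz.bd c Y = 0" for i j c
    using that by (rule koszul_gr_acyclic)
  show "\<exists>u. (\<forall>v. u v \<in> gr r b (j - 1)) \<and> z = (\<Sum>v\<in>UNIV. vscale (xvar v) (u v))"
    if "z \<in> pieces r b (syz r g A) j" for j z
    using that gens by (intro in_irrelevant_part) (auto simp: pieces_def min_gens_def)
qed

text \<open>Graded Nakayama: Tor_0 is B/A modulo the multiples of the variables. A minimal generator
  survives there, and a degree without generators contributes nothing.\<close>

lemma tor_0_iff:
  fixes B :: "(nat \<Rightarrow> ('a::field, 'v::finite) mpol) set"
  assumes gens: "min_gens s \<beta> B A r b g" and B: "hsub s \<beta> B" and A: "hsub s \<beta> A" and AB: "A \<subseteq> B"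
  shows "kz.tor (pieces s \<beta> B) (pieces s \<beta> A) 0 j \<longleftrightarrow> (\<exists>k<r. b k = j)"
proof
  have g: "\<And>k. k < r \<Longrightarrow> g k \<in> gr s \<beta> (b k)" "\<And>k. k < r \<Longrightarrow> g k \<in> B"
    using gens by (auto simp: min_gens_def)
  have sub: "vm.subspace A" "vm.subspace B"
    using A B by (auto simp: hsub_def)
  have bd0: "kz.bd w {} = (\<Sum>v\<in>UNIV. vscale (xvar v) (w {v}))" for w :: "'v set \<Rightarrow> nat \<Rightarrow> ('a, 'v) mpol"
    by (simp add: kz.bd_def ksign_def)
  {
    assume "\<exists>k<r. b k = j"
    then obtain k where k: "k < r" "b k = j" by blast
    define c where "c Y = (if Y = {} then g k else 0)" for Y :: "'v set"
    have "c \<in> kz.chains 0 j (pieces s \<beta> B)"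
      using g k by (auto simp: kz.chains_def c_def pieces_def)
    moreover have "kz.bd c Y \<in> pieces s \<beta> A (j - int 0 + 1)" for Y
      using kz.gfam_zero[OF gfam_pieces[OF sub(1)]] by (simp add: kz.bd_def c_def)
    moreover have "c {} - kz.bd w {} \<notin> pieces s \<beta> A j" if w: "w \<in> kz.chains (Suc 0) j (pieces s \<beta> B)" for w
    proof
      assume mem: "c {} - kz.bd w {} \<in> pieces s \<beta> A j"
      have "w {v} \<in> pieces s \<beta> B (j - 1)" for v
        using kz.chainsD[OF w, of "{v}"] by simp
      then have "\<forall>v. \<exists>f\<in>gr r b (j - 1). w {v} - lincomb r g f \<in> pieces s \<beta> A (j - 1)"
        using min_gens_lift[OF gens B A AB] by blast
      then obtain u where u: "\<And>v. u v \<in> gr r b (j - 1)" "\<And>v. w {v} - lincomb r g (u v) \<in> A"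
        by (metis Int_iff pieces_def)
      define e where "e l = (if l = k then 1 else (0 :: ('a, 'v) mpol))" for l :: nat
      define z where "z = (\<Sum>v\<in>UNIV. vscale (xvar v) (u v))"
      have e: "e \<in> free_carrier r" using k by (auto simp: e_def free_carrier_def)
      have z: "z \<in> free_carrier r"
        unfolding z_def using u(1) gr_subset subspace_free_carrier
        by (intro vm.subspace_sum vm.subspace_scale) blast+
      have "lincomb r g e = (\<Sum>l<r. if l = k then g k else 0)"
        unfolding lincomb_def by (intro sum.cong refl) (auto simp: e_def)
      then have le: "lincomb r g e = g k" using k by simp
      \<comment> \<open>If \<open>g k\<close> were a combination of multiples of variables modulo
        \<open>A\<close>, then \<open>e - z\<close> would be a relation with constant coefficient 1
        at \<open>k\<close>, against minimality.\<close>
      have "lincomb r g (e - z) = (c {} - kz.bd w {}) +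
          (\<Sum>v\<in>UNIV. vscale (xvar v) (w {v} - lincomb r g (u v)))"
        by (simp add: lincomb_diff le z_def lincomb_sum lincomb_scale c_def bd0
            vm.scale_right_diff_distrib sum_subtractf)
      also have "\<dots> \<in> A"
        using mem u(2) sub(1)
        by (intro vm.subspace_add vm.subspace_sum vm.subspace_scale) (auto simp: pieces_def)
      finally have "e - z \<in> syz r g A"
        using e z vm.subspace_diff[OF subspace_free_carrier] by (auto simp: syz_def)
      then have "Poly_Mapping.lookup ((e - z) k) 0 = 0"
        using gens by (auto simp: min_gens_def)
      moreover have "Poly_Mapping.lookup (z k) 0 = 0"
        by (simp add: z_def sum_fun_apply lookup_sum lookup_xvar_mult)
      ultimately show False
        by (simp add: lookup_minus e_def)
    qed
    ultimately show "kz.tor (pieces s \<beta> B) (pieces s \<beta> A) 0 j"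
      unfolding kz.tor_def by (intro bexI[of _ c]) auto
  }
  assume tor: "kz.tor (pieces s \<beta> B) (pieces s \<beta> A) 0 j"
  then obtain c where c: "c \<in> kz.chains 0 j (pieces s \<beta> B)"
    and nb: "\<And>w. w \<in> kz.chains (Suc 0) j (pieces s \<beta> B) \<Longrightarrow> \<exists>Y. c Y - kz.bd w Y \<notin> pieces s \<beta> A (j - int 0)"
    unfolding kz.tor_def by blast
  show "\<exists>k<r. b k = j"
  proof (rule ccontr)
    assume no: "\<not> (\<exists>k<r. b k = j)"
    have "c {} \<in> pieces s \<beta> B j"
      using kz.chainsD[OF c, of "{}"] by simp
    then obtain f where f: "f \<in> gr r b j" "c {} - lincomb r g f \<in> pieces s \<beta> A j"
      using min_gens_lift[OF gens B A AB] by blast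
    \<comment> \<open>A nonzero constant coefficient at \<open>k\<close> would require a generator
      of degree exactly \<open>j\<close>.\<close>
    have "Poly_Mapping.lookup (f k) 0 = 0" for k
    proof (cases "k < r")
      case True
      then have "b k \<noteq> j" using no by blast
      then show ?thesis using f(1) unfolding gr_iff forms_iff by (metis diff_eq_eq add_0 mdeg_zero of_nat_0)
    qed (use f(1) in \<open>simp add: gr_iff\<close>)
    then obtain u where u: "\<And>v. u v \<in> gr r b (j - 1)" "f = (\<Sum>v\<in>UNIV. vscale (xvar v) (u v))"
      using in_irrelevant_part[OF f(1)] by blast
    define w where "w Y = (if card Y = 1 then lincomb r g (u (THE v. v \<in> Y)) else 0)" for Y :: "'v set"
    have "lincomb r g (u v) \<in> pieces s \<beta> B (j - 1)" for v
      using lincomb_gr[OF g(1) u(1)] lincomb_in_subspace[OF sub(2) g(2)] by (auto simp: pieces_def)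
    then have w: "w \<in> kz.chains (Suc 0) j (pieces s \<beta> B)"
      by (auto simp: kz.chains_def w_def)
    obtain Y where Y: "c Y - kz.bd w Y \<notin> pieces s \<beta> A j"
      using nb[OF w] by auto
    show False
    proof (cases "Y = {}")
      case True
      have "kz.bd w {} = lincomb r g f"
        by (simp add: bd0 u(2) lincomb_sum lincomb_scale w_def)
      then show False using Y f(2) True by simp
    next
      case False
      then have "kz.bd w Y = 0"
        by (auto simp: kz.bd_def w_def card_insert_if intro!: sum.neutral)
      moreover have "c Y = 0"
        using False kz.chainsD0[OF c, of Y] by simp
      ultimately show False
        using Y kz.gfam_zero[OF gfam_pieces[OF sub(1)]] by simp
    qed
  qed
qed

section \<open>Minimal resolutions and regularity\<close>

text \<open>A minimal resolution kept as successive choices of generators. Relations are taken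
  modulo \<open>A\<close> only at index 0; from the first syzygy module on, everything lies in a
  free module.\<close>

definition syz_chain :: "nat \<Rightarrow> (nat \<Rightarrow> int) \<Rightarrow> (nat \<Rightarrow> ('a::field, 'v::finite) mpol) set \<Rightarrow>
    (nat \<Rightarrow> ('a, 'v) mpol) set \<Rightarrow> (nat \<Rightarrow> nat) \<Rightarrow> (nat \<Rightarrow> nat \<Rightarrow> int) \<Rightarrow>
    (nat \<Rightarrow> nat \<Rightarrow> nat \<Rightarrow> ('a, 'v) mpol) \<Rightarrow> bool"
  where "syz_chain s \<beta> B A r b g \<longleftrightarrow> min_gens s \<beta> B A (r 0) (b 0) (g 0) \<and>
    (\<forall>i. min_gens (r i) (b i) (syz (r i) (g i) (if i = 0 then A else {0})) {0}
      (r (Suc i)) (b (Suc i)) (g (Suc i)))"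

lemma syz_chain_hsub:
  assumes chain: "syz_chain s \<beta> B A r b g" and A: "hsub s \<beta> A"
  shows "hsub (r i) (b i) (syz (r i) (g i) (if i = 0 then A else {0}))"
proof (cases i)
  case 0
  then show ?thesis
    using hsub_syz[OF A] chain by (auto simp: syz_chain_def min_gens_def)
next
  case (Suc i')
  have "g i k \<in> gr (r i') (b i') (b i k)" if "k < r i" for k
    using chain that unfolding syz_chain_def min_gens_def Suc by blast
  from hsub_syz[OF hsub_zero this] show ?thesis by (simp add: Suc)
qed

lemma zero_subset_hsub: "hsub s \<beta> A \<Longrightarrow> {0} \<subseteq> A"
  by (simp add: hsub_def vm.subspace_0)

text \<open>Dimension shifting reduces homological degree \<open>i\<close> to degree 0 of the
  \<open>i\<close>-th syzygy module, where \<open>tor_0_iff\<close> reads off the degrees of its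
  minimal generators.\<close>

lemma syz_chain_tor:
  fixes B :: "(nat \<Rightarrow> ('a::field, 'v::finite) mpol) set"
  assumes chain: "syz_chain s \<beta> B A r b g" and B: "hsub s \<beta> B" and A: "hsub s \<beta> A" and AB: "A \<subseteq> B"
  shows "kz.tor (pieces s \<beta> B) (pieces s \<beta> A) i j \<longleftrightarrow> (\<exists>k<r i. b i k = j)"
proof -
  let ?Z = "\<lambda>i. syz (r i) (g i) (if i = 0 then A else {0})"
  have gens: "min_gens (r n) (b n) (?Z n) {0} (r (Suc n)) (b (Suc n)) (g (Suc n))" for n
    using chain by (simp add: syz_chain_def)
  have gens0: "min_gens s \<beta> B A (r 0) (b 0) (g 0)"
    using chain by (simp add: syz_chain_def)
  note Z = syz_chain_hsub[OF chain A]
  have *: "kz.tor (pieces (r n) (b n) (?Z n)) (pieces (r n) (b n) {0}) i j \<longleftrightarrow>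
      (\<exists>k<r (Suc (n + i)). b (Suc (n + i)) k = j)" for n i
  proof (induction i arbitrary: n)
    case 0
    show ?case
      unfolding add_0_right by (rule tor_0_iff[OF gens Z hsub_zero zero_subset_hsub[OF Z]])
  next
    case (Suc i)
    have "kz.tor (pieces (r n) (b n) (?Z n)) (pieces (r n) (b n) {0}) (Suc i) j \<longleftrightarrow>
        kz.tor (pieces (r (Suc n)) (b (Suc n)) (?Z (Suc n))) (pieces (r (Suc n)) (b (Suc n)) {0}) i j"
      using tor_Suc_iff_syz[OF gens[of n] Z hsub_zero zero_subset_hsub[OF Z], of i j]
      by (simp only: Suc_not_Zero if_False)
    then show ?case
      unfolding Suc[of "Suc n"] by (simp only: add_Suc add_Suc_right)
  qed
  show ?thesis
  proof (cases i)
    case 0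
    then show ?thesis using tor_0_iff[OF gens0 B A AB] by (simp only:)
  next
    case (Suc i')
    then show ?thesis
      using tor_Suc_iff_syz[OF gens0 B A AB, of i' j] *[of 0 i'] by (simp only: add_0 if_True refl)
  qed
qed

lemma syz_chain_exists:
  fixes B :: "(nat \<Rightarrow> ('a::field, 'v::finite) mpol) set"
  assumes B: "hsub s \<beta> B" and A: "hsub s \<beta> A"
  obtains r b g where "syz_chain s \<beta> B A r b g"
proof -
  \<comment> \<open>Besides the generators, the state records the submodule \<open>A'\<close> modulo
    which relations are taken: \<open>A\<close> at the start and \<open>{0}\<close>
    afterwards.\<close>
  define P where "P n x \<longleftrightarrow> (case x of (r, b, g, A') \<Rightarrow>
      hsub r b (syz r g A') \<and> (n = (0::nat) \<longrightarrow> A' = A \<and> min_gens s \<beta> B A r b g) \<and> (n \<noteq> 0 \<longrightarrow> A' = {0}))"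
    for n and x :: "nat \<times> (nat \<Rightarrow> int) \<times> (nat \<Rightarrow> nat \<Rightarrow> ('a, 'v) mpol) \<times> (nat \<Rightarrow> ('a, 'v) mpol) set"
  define Q where "Q x y \<longleftrightarrow> (case (x, y) of ((r, b, g, A'), (r', b', g', A'')) \<Rightarrow>
      min_gens r b (syz r g A') {0} r' b' g')"
    for x y :: "nat \<times> (nat \<Rightarrow> int) \<times> (nat \<Rightarrow> nat \<Rightarrow> ('a, 'v) mpol) \<times> (nat \<Rightarrow> ('a, 'v) mpol) set"
  have "\<exists>f. \<forall>n. P n (f n) \<and> Q (f n) (f (Suc n))"
  proof (rule dependent_nat_choice)
    obtain r b g where g: "min_gens s \<beta> B A r b g"
      using min_gens_exist[OF B A] by blast
    then have "hsub r b (syz r g A)"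
      by (intro hsub_syz[OF A]) (simp add: min_gens_def)
    then show "\<exists>x. P 0 x"
      using g by (intro exI[of _ "(r, b, g, A)"]) (simp add: P_def)
  next
    fix x and n :: nat assume Px: "P n x"
    obtain r b g A' where x: "x = (r, b, g, A')" by (cases x)
    have Z: "hsub r b (syz r g A')" using Px by (simp add: P_def x)
    obtain r' b' g' where g': "min_gens r b (syz r g A') {0} r' b' g'"
      using min_gens_exist[OF Z hsub_zero] by blast
    then have "hsub r' b' (syz r' g' {0})"
      by (intro hsub_syz[OF hsub_zero[of r b]]) (simp add: min_gens_def)
    then show "\<exists>y. P (Suc n) y \<and> Q x y"
      using g' by (intro exI[of _ "(r', b', g', {0})"]) (simp add: P_def Q_def x)
  qed
  then obtain f where f: "\<And>n. P n (f n)" "\<And>n. Q (f n) (f (Suc n))" by blast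
  define r b g where "r n = fst (f n)" and "b n = fst (snd (f n))" and "g n = fst (snd (snd (f n)))" for n
  have A': "snd (snd (snd (f n))) = (if n = 0 then A else {0})" for n
    using f(1)[of n] by (auto simp: P_def split: prod.splits)
  have "min_gens s \<beta> B A (r 0) (b 0) (g 0)"
    using f(1)[of 0] by (auto simp: P_def r_def b_def g_def split: prod.splits)
  moreover have "min_gens (r n) (b n) (syz (r n) (g n) (if n = 0 then A else {0})) {0}
      (r (Suc n)) (b (Suc n)) (g (Suc n))" for n
    using f(2)[of n] unfolding A'[symmetric] by (auto simp: Q_def r_def b_def g_def split: prod.splits)
  ultimately show ?thesis
    by (intro that[of r b g]) (simp add: syz_chain_def)
qed

text \<open>Finite regularity: the ranks in a syzygy chain are finite, and only homological degrees
  up to the number of variables matter.\<close>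

lemma tor_bounded:
  fixes B :: "(nat \<Rightarrow> ('a::field, 'v::finite) mpol) set"
  assumes B: "hsub s \<beta> B" and A: "hsub s \<beta> A" and AB: "A \<subseteq> B"
  shows "\<exists>c. \<forall>i j. kz.tor (pieces s \<beta> B) (pieces s \<beta> A) i j \<longrightarrow> j - int i \<le> c"
proof -
  obtain r b g where chain: "syz_chain s \<beta> B A r b g"
    using syz_chain_exists[OF B A] .
  let ?S = "\<Union>i\<le>CARD('v). (\<lambda>k. b i k - int i) ` {..<r i}"
  have "j - int i \<le> Max ?S" if tor: "kz.tor (pieces s \<beta> B) (pieces s \<beta> A) i j" for i j
  proof (rule Max_ge)
    show "finite ?S" by simp
    have "vm.subspace A" using A by (simp add: hsub_def)
    then have "i \<le> CARD('v)"
      using kz.tor_card_le[OF gfam_pieces tor] by simp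
    then show "j - int i \<in> ?S"
      using tor unfolding syz_chain_tor[OF chain B A AB] by auto
  qed
  then show ?thesis by blast
qed

section \<open>Resolutions given by matrices and chains of syzygies\<close>

lemma free_map_eq_lincomb:
  assumes "\<And>k. k < r \<Longrightarrow> g k \<in> free_carrier s" "\<And>k l. k < r \<Longrightarrow> l < s \<Longrightarrow> M l k = g k l"
  shows "free_map r s M v = lincomb r g v"
proof (rule ext)
  fix l
  show "free_map r s M v l = lincomb r g v l"
  proof (cases "l < s")
    case True
    then show ?thesis
      using assms(2) by (simp add: free_map_def lincomb_apply mult.commute)
  next
    case False
    then have "g k l = 0" if "k < r" for k
      using assms(1)[OF that] by (simp add: free_carrier_def)
    then show ?thesis using False by (simp add: free_map_def lincomb_apply)
  qed
qed

lemma const_coeff_mult_0: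
  fixes p q :: "('a::field, 'v::finite) mpol"
  assumes "Poly_Mapping.lookup q 0 = 0"
  shows "Poly_Mapping.lookup (p * q) 0 = 0"
proof (rule ccontr)
  assume "Poly_Mapping.lookup (p * q) 0 \<noteq> 0"
  then obtain m n where "0 = m + n" "n \<in> Poly_Mapping.keys q"
    using keys_mult[of p q] by (force simp: in_keys_iff)
  moreover from this have "n = 0"
    using mdeg_add[of m n] by (simp flip: mdeg_eq_0_iff)
  ultimately show False using assms by (simp add: in_keys_iff)
qed

lemma lincomb_const_coeff:
  assumes "\<And>k. k < r \<Longrightarrow> Poly_Mapping.lookup (g k l) 0 = 0"
  shows "Poly_Mapping.lookup (lincomb r g v l) 0 = 0"
  unfolding lincomb_apply lookup_sum by (rule sum.neutral) (simp add: assms const_coeff_mult_0)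

lemma lincomb_image:
  assumes gens: "min_gens s \<beta> Z {0} r b g" and Z: "hsub s \<beta> Z"
  shows "lincomb r g ` free_carrier r = Z"
proof
  show "lincomb r g ` free_carrier r \<subseteq> Z"
    using gens Z by (auto simp: min_gens_def hsub_def intro!: lincomb_in_subspace)
  show "Z \<subseteq> lincomb r g ` free_carrier r"
    using gens by (fastforce simp: min_gens_def)
qed

definition basis :: "nat \<Rightarrow> nat \<Rightarrow> ('a::field, 'v::finite) mpol"
  where "basis k = (\<lambda>l. if l = k then 1 else 0)"

lemma basis_free: "k < r \<Longrightarrow> basis k \<in> free_carrier r"
  by (auto simp: basis_def free_carrier_def)

lemma lincomb_basis:
  assumes "k < r"
  shows "lincomb r g (basis k) = g k"
proof (rule ext)
  fix l
  have "lincomb r g (basis k) l = (\<Sum>i<r. if i = k then g k l else 0)"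
    unfolding lincomb_apply by (rule sum.cong[OF refl]) (auto simp: basis_def)
  then show "lincomb r g (basis k) l = g k l" using assms by simp
qed

text \<open>The bridge from module records to subquotients of a free module: \<open>\<pi>\<close>
  induces a graded isomorphism from B/A to \<open>N\<close>. It is a map on the whole function type
  and is constrained on \<open>B\<close> only.\<close>

locale presented =
  fixes N :: "(('a::field, 'v::finite) mpol, 'n) graded_module" (structure)
    and s :: nat and \<beta> :: "nat \<Rightarrow> int" and B A :: "(nat \<Rightarrow> ('a, 'v) mpol) set"
    and \<pi> :: "(nat \<Rightarrow> ('a, 'v) mpol) \<Rightarrow> 'n"
  assumes B: "hsub s \<beta> B" and A: "hsub s \<beta> A" and AB: "A \<subseteq> B"
    and abelian: "abelian_group N"
    and \<pi>_add: "\<lbrakk>u \<in> B; v \<in> B\<rbrakk> \<Longrightarrow> \<pi> (u + v) = \<pi> u \<oplus> \<pi> v"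
    and \<pi>_scale: "u \<in> B \<Longrightarrow> \<pi> (vscale p u) = p \<odot> \<pi> u"
    and \<pi>_carrier: "\<pi> ` B = carrier N"
    and \<pi>_grade: "\<pi> ` pieces s \<beta> B j = grade N j"
    and \<pi>_zero: "u \<in> B \<Longrightarrow> \<pi> u = \<zero> \<longleftrightarrow> u \<in> A"
begin

interpretation N: abelian_group N by (rule abelian)

lemma subB: "vm.subspace B" using B by (simp add: hsub_def)

lemma \<pi>_eq: "u \<in> B \<Longrightarrow> v \<in> B \<Longrightarrow> \<pi> u = \<pi> v \<longleftrightarrow> u - v \<in> A"
proof -
  assume uv: "u \<in> B" "v \<in> B"
  then have d: "u - v \<in> B" by (rule vm.subspace_diff[OF subB])
  have carr: "\<pi> u \<in> carrier N" "\<pi> v \<in> carrier N" "\<pi> (u - v) \<in> carrier N"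
    using uv d \<pi>_carrier by blast+
  have "\<pi> u = \<pi> (u - v) \<oplus> \<pi> v"
    using \<pi>_add[OF d uv(2)] by simp
  then have "\<pi> u = \<pi> v \<longleftrightarrow> \<pi> (u - v) = \<zero>"
    using carr by (metis N.add.r_cancel_one)
  then show ?thesis using \<pi>_zero[OF d] by simp
qed

lemma augmentation_lincomb:
  assumes "\<And>k. k < r \<Longrightarrow> g k \<in> B"
  shows "augmentation N r (\<lambda>k. \<pi> (g k)) v = \<pi> (lincomb r g v)"
  using assms
proof (induction r)
  case 0
  have "(0 :: nat \<Rightarrow> ('a, 'v) mpol) \<in> B" "(0 :: nat \<Rightarrow> ('a, 'v) mpol) \<in> A"
    using subB A by (auto simp: hsub_def vm.subspace_0)
  then have "\<pi> 0 = \<zero>"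
    using \<pi>_zero by blast
  moreover have "lincomb 0 g v = 0"
    by (simp only: lincomb_def lessThan_0 sum.empty)
  ultimately show ?case
    by (simp only: augmentation_def lessThan_0 N.finsum_empty)
next
  case (Suc r)
  have carr: "v k \<odot> \<pi> (g k) \<in> carrier N" if "k < Suc r" for k
    using Suc.prems[OF that] \<pi>_scale[of "g k" "v k"] \<pi>_carrier vm.subspace_scale[OF subB, of "g k" "v k"]
    by (metis imageI)
  have "augmentation N (Suc r) (\<lambda>k. \<pi> (g k)) v =
      v r \<odot> \<pi> (g r) \<oplus> augmentation N r (\<lambda>k. \<pi> (g k)) v"
    unfolding augmentation_def lessThan_Suc using carr by (subst N.finsum_insert) auto
  also have "\<dots> = \<pi> (vscale (v r) (g r)) \<oplus> \<pi> (lincomb r g v)"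
    using Suc \<pi>_scale by simp
  also have "\<dots> = \<pi> (vscale (v r) (g r) + lincomb r g v)"
    using Suc.prems lincomb_in_subspace[OF subB, of r g v] vm.subspace_scale[OF subB]
    by (intro \<pi>_add[symmetric]) auto
  also have "vscale (v r) (g r) + lincomb r g v = lincomb (Suc r) g v"
    by (simp only: lincomb_def sum.lessThan_Suc add.commute)
  finally show ?case .
qed

lemma resolution_of_syz_chain:
  assumes chain: "syz_chain s \<beta> B A r b g"
  shows "minimal_graded_free_resolution N r b (\<lambda>k. \<pi> (g 0 k)) (\<lambda>i l k. g (Suc i) k l)"
proof -
  let ?Z = "\<lambda>i. syz (r i) (g i) (if i = 0 then A else {0})"
  have gens: "min_gens (r n) (b n) (?Z n) {0} (r (Suc n)) (b (Suc n)) (g (Suc n))" for n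
    using chain by (simp add: syz_chain_def)
  have gens0: "min_gens s \<beta> B A (r 0) (b 0) (g 0)"
    using chain by (simp add: syz_chain_def)
  note Z = syz_chain_hsub[OF chain A]
  have gB: "g 0 k \<in> B" "g 0 k \<in> gr s \<beta> (b 0 k)" if "k < r 0" for k
    using gens0 that by (auto simp: min_gens_def)
  have gZ: "g (Suc i) k \<in> ?Z i" "g (Suc i) k \<in> gr (r i) (b i) (b (Suc i) k)" if "k < r (Suc i)" for i k
    using gens[of i] that unfolding min_gens_def by blast+
  have aug: "augmentation N (r 0) (\<lambda>k. \<pi> (g 0 k)) v = \<pi> (lincomb (r 0) (g 0) v)" for v
    by (rule augmentation_lincomb) (rule gB)
  have linB: "lincomb (r 0) (g 0) v \<in> B" for v
    by (rule lincomb_in_subspace[OF subB]) (rule gB)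
  have fm: "free_map (r (Suc i)) (r i) (\<lambda>l k. g (Suc i) k l) v = lincomb (r (Suc i)) (g (Suc i)) v" for i v
    by (rule free_map_eq_lincomb) (use gZ(2) gr_subset in blast)+
  have im: "free_map (r (Suc i)) (r i) (\<lambda>l k. g (Suc i) k l) ` free_carrier (r (Suc i)) = ?Z i" for i
    using lincomb_image[OF gens Z] by (simp add: fm)
  show ?thesis
    unfolding minimal_graded_free_resolution_def
  proof (intro conjI allI impI)
    show "\<pi> (g 0 k) \<in> grade N (b 0 k)" if "k < r 0" for k
      using gB[OF that] \<pi>_grade[of "b 0 k"] by (auto simp: pieces_def)
    show "g (Suc i) k l \<in> forms (b (Suc i) k - b i l)" if "k < r (Suc i)" "l < r i" for i k l
      using gZ(2)[OF that(1)] by (simp add: gr_iff)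
    show "augmentation N (r 0) (\<lambda>k. \<pi> (g 0 k)) ` free_carrier (r 0) = carrier N"
      unfolding aug
    proof
      show "(\<lambda>v. \<pi> (lincomb (r 0) (g 0) v)) ` free_carrier (r 0) \<subseteq> carrier N"
        using linB \<pi>_carrier by blast
      show "carrier N \<subseteq> (\<lambda>v. \<pi> (lincomb (r 0) (g 0) v)) ` free_carrier (r 0)"
      proof
        fix y assume "y \<in> carrier N"
        then obtain x where x: "x \<in> B" "y = \<pi> x" using \<pi>_carrier by blast
        then obtain v where "v \<in> free_carrier (r 0)" "x - lincomb (r 0) (g 0) v \<in> A"
          using gens0 by (auto simp: min_gens_def)
        then show "y \<in> (\<lambda>v. \<pi> (lincomb (r 0) (g 0) v)) ` free_carrier (r 0)"
          using \<pi>_eq[OF x(1) linB, of v] x(2) by auto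
      qed
    qed
    show "{v \<in> free_carrier (r 0). augmentation N (r 0) (\<lambda>k. \<pi> (g 0 k)) v = \<zero>} =
        free_map (r 1) (r 0) (\<lambda>l k. g (Suc 0) k l) ` free_carrier (r 1)"
      using im[of 0] by (simp add: aug \<pi>_zero[OF linB] syz_def)
    show "{v \<in> free_carrier (r (Suc i)). free_map (r (Suc i)) (r i) (\<lambda>l k. g (Suc i) k l) v = (\<lambda>_. 0)} =
        free_map (r (Suc (Suc i))) (r (Suc i)) (\<lambda>l k. g (Suc (Suc i)) k l) ` free_carrier (r (Suc (Suc i)))" for i
      unfolding im fm by (simp add: syz_def zero_fun_def)
    show "Poly_Mapping.lookup (g (Suc i) k l) 0 = 0" if "k < r (Suc i)" "l < r i" for i k l
    proof (cases i)
      case 0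
      then show ?thesis using gens0 gZ(1)[OF that(1)] by (simp add: min_gens_def)
    next
      case (Suc i')
      then show ?thesis using gens[of i'] gZ(1)[OF that(1)] by (simp add: min_gens_def)
    qed
  qed
qed

text \<open>Since \<open>reg\<close> takes a supremum over all minimal resolutions, each one has to
  be related to Koszul homology. Its generators are lifted along \<open>\<pi>\<close>, the columns
  of its matrices become the higher generators, and exactness turns images into syzygy
  modules.\<close>

lemma syz_chain_of_resolution:
  assumes res: "minimal_graded_free_resolution N r b g M"
  obtains g' where "syz_chain s \<beta> B A r b g'"
proof -
  have "\<forall>k. \<exists>u. k < r 0 \<longrightarrow> u \<in> B \<and> u \<in> gr s \<beta> (b 0 k) \<and> \<pi> u = g k"
  proof
    fix k
    show "\<exists>u. k < r 0 \<longrightarrow> u \<in> B \<and> u \<in> gr s \<beta> (b 0 k) \<and> \<pi> u = g k"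
    proof (cases "k < r 0")
      case True
      then have "g k \<in> \<pi> ` pieces s \<beta> B (b 0 k)"
        using res by (simp add: minimal_graded_free_resolution_def \<pi>_grade)
      then show ?thesis by (auto simp: pieces_def)
    qed simp
  qed
  then obtain g0 where g0: "\<And>k. k < r 0 \<Longrightarrow> g0 k \<in> B" "\<And>k. k < r 0 \<Longrightarrow> g0 k \<in> gr s \<beta> (b 0 k)"
    "\<And>k. k < r 0 \<Longrightarrow> \<pi> (g0 k) = g k"
    by metis
  define G where "G i = (case i of 0 \<Rightarrow> g0 | Suc i' \<Rightarrow> (\<lambda>k l. if l < r i' then M i' l k else 0))" for i
  have G0: "G 0 = g0" and GS: "G (Suc i) k l = (if l < r i then M i l k else 0)" for i k l
    by (simp_all add: G_def)
  let ?Z = "\<lambda>i. syz (r i) (G i) (if i = 0 then A else {0})"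
  have linB: "lincomb (r 0) g0 v \<in> B" for v
    by (rule lincomb_in_subspace[OF subB]) (rule g0)
  have "augmentation N (r 0) g v = augmentation N (r 0) (\<lambda>k. \<pi> (g0 k)) v" for v
    unfolding augmentation_def
  proof (rule N.finsum_cong')
    show "(\<lambda>k. v k \<odot> \<pi> (g0 k)) \<in> {..<r 0} \<rightarrow> carrier N"
    proof
      fix k assume "k \<in> {..<r 0}"
      then show "v k \<odot> \<pi> (g0 k) \<in> carrier N"
        using g0(1)[of k] \<pi>_scale[of "g0 k" "v k"] \<pi>_carrier vm.subspace_scale[OF subB, of "g0 k" "v k"]
        by (metis imageI lessThan_iff)
    qed
  qed (use g0(3) in auto)
  then have aug: "augmentation N (r 0) g v = \<pi> (lincomb (r 0) g0 v)" for v
    using augmentation_lincomb[OF g0(1)] by simp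
  have G_free: "G (Suc i) k \<in> free_carrier (r i)" for i k
    by (simp add: free_carrier_def GS)
  have fm: "free_map (r (Suc i)) (r i) (M i) v = lincomb (r (Suc i)) (G (Suc i)) v" for i v
    by (rule free_map_eq_lincomb) (simp_all add: G_free GS)
  have im: "lincomb (r (Suc i)) (G (Suc i)) ` free_carrier (r (Suc i)) = ?Z i" for i
  proof (cases i)
    case 0
    have "{v \<in> free_carrier (r 0). augmentation N (r 0) g v = \<zero>} =
      free_map (r (Suc 0)) (r 0) (M 0) ` free_carrier (r (Suc 0))"
      using res by (simp add: minimal_graded_free_resolution_def)
    then show ?thesis
      using 0 by (simp add: fm aug \<pi>_zero[OF linB] syz_def G0)
  next
    case (Suc i')
    have "{v \<in> free_carrier (r i). free_map (r i) (r i') (M i') v = (\<lambda>_. 0)} =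
      free_map (r (Suc i)) (r i) (M i) ` free_carrier (r (Suc i))"
      using res unfolding minimal_graded_free_resolution_def Suc by blast
    then show ?thesis
      unfolding Suc fm by (simp add: syz_def zero_fun_def)
  qed
  \<comment> \<open>By exactness every syzygy is a combination of the columns of the next matrix,
    whose entries have no constant term.\<close>
  have minimal: "Poly_Mapping.lookup (v l) 0 = 0" if v: "v \<in> ?Z i" for i v l
  proof -
    have "Poly_Mapping.lookup (G (Suc i) k l) 0 = 0" if "k < r (Suc i)" for k
      using that res by (simp add: GS minimal_graded_free_resolution_def)
    moreover obtain w where "v = lincomb (r (Suc i)) (G (Suc i)) w"
      using v unfolding im[symmetric] by blast
    ultimately show ?thesis by (simp add: lincomb_const_coeff)
  qed
  have "min_gens s \<beta> B A (r 0) (b 0) (G 0)"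
    unfolding min_gens_def
  proof (intro conjI allI impI ballI)
    fix x assume x: "x \<in> B"
    then have "\<pi> x \<in> augmentation N (r 0) g ` free_carrier (r 0)"
      using res \<pi>_carrier by (auto simp: minimal_graded_free_resolution_def)
    then obtain v where "v \<in> free_carrier (r 0)" "\<pi> x = \<pi> (lincomb (r 0) g0 v)"
      by (auto simp: aug)
    then show "\<exists>v\<in>free_carrier (r 0). x - lincomb (r 0) (G 0) v \<in> A"
      using \<pi>_eq[OF x linB] by (auto simp: G0)
  qed (use g0 minimal[of _ 0] in \<open>auto simp: G0\<close>)
  moreover have "min_gens (r i) (b i) (?Z i) {0} (r (Suc i)) (b (Suc i)) (G (Suc i))" for i
    unfolding min_gens_def
  proof (intro conjI allI impI ballI)
    fix k assume k: "k < r (Suc i)"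
    show "G (Suc i) k \<in> ?Z i"
      unfolding im[symmetric] using basis_free[OF k] lincomb_basis[OF k, of "G (Suc i)"] by (metis imageI)
    have "M i l k \<in> forms (b (Suc i) k - b i l)" if "l < r i" for l
      using res k that by (simp add: minimal_graded_free_resolution_def)
    then show "G (Suc i) k \<in> gr (r i) (b i) (b (Suc i) k)"
      by (simp add: gr_iff GS)
  next
    fix x assume "x \<in> ?Z i"
    then obtain v where "v \<in> free_carrier (r (Suc i))" "x = lincomb (r (Suc i)) (G (Suc i)) v"
      unfolding im[symmetric] by blast
    then show "\<exists>v\<in>free_carrier (r (Suc i)). x - lincomb (r (Suc i)) (G (Suc i)) v \<in> {0}"
      by (intro bexI[of _ v]) simp_all
  next
    fix v k assume "v \<in> syz (r (Suc i)) (G (Suc i)) {0}"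
    then show "Poly_Mapping.lookup (v k) 0 = 0"
      using minimal[of v "Suc i"] by simp
  qed
  ultimately show ?thesis
    by (intro that[of G]) (simp add: syz_chain_def)
qed

text \<open>Both sets of degrees agree: every minimal resolution yields a syzygy chain, some syzygy
  chain exists and yields a resolution, and \<open>syz_chain_tor\<close> computes the degrees in
  either.\<close>

theorem reg_eq:
  "reg N = Sup {ereal (real_of_int (j - int i)) | i j. kz.tor (pieces s \<beta> B) (pieces s \<beta> A) i j}"
proof -
  have "{ereal (real_of_int (b i k - int i)) | r b g M i k.
      minimal_graded_free_resolution N r b g M \<and> k < r i} =
    {ereal (real_of_int (j - int i)) | i j. kz.tor (pieces s \<beta> B) (pieces s \<beta> A) i j}" (is "?L = ?R")
  proof
    show "?L \<subseteq> ?R"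
    proof
      fix x assume "x \<in> ?L"
      then obtain r b g M i k where x: "x = ereal (real_of_int (b i k - int i))"
        and res: "minimal_graded_free_resolution N r b g M" and k: "k < r i" by blast
      obtain g' where "syz_chain s \<beta> B A r b g'" by (rule syz_chain_of_resolution[OF res])
      from syz_chain_tor[OF this B A AB, of i "b i k"] show "x \<in> ?R"
        using x k by blast
    qed
    obtain r b g where chain: "syz_chain s \<beta> B A r b g"
      using syz_chain_exists[OF B A] .
    show "?R \<subseteq> ?L"
    proof
      fix x assume "x \<in> ?R"
      then obtain i j where x: "x = ereal (real_of_int (j - int i))"
        and "kz.tor (pieces s \<beta> B) (pieces s \<beta> A) i j" by blast
      then obtain k where "k < r i" "b i k = j"
        using syz_chain_tor[OF chain B A AB] by blast
      then show "x \<in> ?L"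
        using resolution_of_syz_chain[OF chain] x by blast
    qed
  qed
  then show ?thesis by (simp only: reg_def)
qed

lemma reg_eqI:
  assumes "\<And>i j. kz.tor (pieces s \<beta> B) (pieces s \<beta> A) i j \<Longrightarrow> j - int i \<le> \<rho>"
    and "kz.tor (pieces s \<beta> B) (pieces s \<beta> A) i (\<rho> + int i)"
  shows "reg N = ereal (real_of_int \<rho>)"
  unfolding reg_eq
proof (rule Sup_eqI)
  fix y assume "y \<in> {ereal (real_of_int (j - int i)) |i j. kz.tor (pieces s \<beta> B) (pieces s \<beta> A) i j}"
  then show "y \<le> ereal (real_of_int \<rho>)"
    using assms(1) by (auto simp del: of_int_diff)
next
  fix y assume "\<And>z. z \<in> {ereal (real_of_int (j - int i)) |i j. kz.tor (pieces s \<beta> B) (pieces s \<beta> A) i j} \<Longrightarrow> z \<le> y"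
  from this[of "ereal (real_of_int (\<rho> + int i - int i))"] show "ereal (real_of_int \<rho>) \<le> y"
    using assms(2) by force
qed

end

section \<open>Regularity of powers\<close>

text \<open>Nothing of B/A lies one degree lower, so every boundary in degree \<open>l\<close>
  vanishes modulo \<open>A\<close> and \<open>v\<close> stays a nonzero class.\<close>

lemma (in koszul) tor_lowest:
  assumes A: "gfam A" and v: "v \<in> B l" "v \<notin> A l" and low: "B (l - 1) \<subseteq> A (l - 1)"
  shows "tor B A 0 l"
proof -
  define c where "c Y = (if Y = {} then v else 0)" for Y :: "'v set"
  have "c \<in> chains 0 l B"
    using v(1) by (auto simp: chains_def c_def)
  moreover have "bd c Y \<in> A (l - int 0 + 1)" for Y
    using gfam_zero[OF A] by (simp add: bd_def c_def)
  moreover have "c {} - bd w {} \<notin> A l" if w: "w \<in> chains (Suc 0) l B" for w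
  proof
    assume mem: "c {} - bd w {} \<in> A l"
    have "\<xi> u (w {u}) \<in> A l" for u
    proof -
      have "w {u} \<in> A (l - 1)"
        using chainsD[OF w, of "{u}"] low by auto
      from gfam_xi[OF A this, of u] show ?thesis by simp
    qed
    then have "bd w {} \<in> A l"
      unfolding bd_def by (intro gfam_sum[OF A] gfam_ksign[OF A]) simp
    from gfam_add[OF A mem this] show False
      using v(2) by (simp add: c_def)
  qed
  ultimately show ?thesis
    unfolding tor_def by (intro bexI[of _ c]) auto
qed

lemma subspace_sums:
  assumes "vm.subspace S" "vm.subspace T"
  shows "vm.subspace {u + v | u v. u \<in> S \<and> v \<in> T}"
proof (rule vm.subspaceI)
  show "0 \<in> {u + v | u v. u \<in> S \<and> v \<in> T}"
    using assms by (metis (mono_tags, lifting) add_0 mem_Collect_eq vm.subspace_0)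
  fix x assume "x \<in> {u + v | u v. u \<in> S \<and> v \<in> T}"
  then obtain a b where ab: "x = a + b" "a \<in> S" "b \<in> T" by blast
  show "vscale c x \<in> {u + v | u v. u \<in> S \<and> v \<in> T}" for c
    using ab assms vm.subspace_scale unfolding ab(1) vm.scale_right_distrib by blast
  fix y assume "y \<in> {u + v | u v. u \<in> S \<and> v \<in> T}"
  then obtain a' b' where ab': "y = a' + b'" "a' \<in> S" "b' \<in> T" by blast
  have "x + y = (a + a') + (b + b')"
    by (simp add: ab(1) ab'(1) algebra_simps)
  moreover have "a + a' \<in> S" "b + b' \<in> T"
    using ab ab' assms by (auto intro: vm.subspace_add)
  ultimately show "x + y \<in> {u + v | u v. u \<in> S \<and> v \<in> T}" by blast
qed

definition zdeg :: "nat \<Rightarrow> int" where "zdeg = (\<lambda>_. 0)"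

lemma vcomp_eq_sum:
  assumes "finite L" "\<And>m. Poly_Mapping.lookup p m \<noteq> 0 \<Longrightarrow> int (mdeg m) \<in> L"
  shows "vcomp b j (vscale p u) = (\<Sum>l\<in>L. vscale (hcomp l p) (vcomp b (j - l) u))"
proof -
  have "(\<Sum>l\<in>L. hcomp l p) = p"
    using assms by (rule sum_hcomp)
  then have "vscale p u = (\<Sum>l\<in>L. vscale (hcomp l p) u)"
    by (metis vm.scale_sum_left)
  then have "vcomp b j (vscale p u) = (\<Sum>l\<in>L. vcomp b j (vscale (hcomp l p) u))"
    by (simp only: vcomp_sum)
  also have "\<dots> = (\<Sum>l\<in>L. vscale (hcomp l p) (vcomp b (j - l) u))"
    by (intro sum.cong refl vcomp_scale hcomp_in_forms)
  finally show ?thesis .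
qed

lemma vcomp_span:
  assumes S: "\<And>x j. x \<in> S \<Longrightarrow> vcomp b j x \<in> vm.span S" and x: "x \<in> vm.span S"
  shows "vcomp b j x \<in> vm.span S"
  using x
proof (induction rule: vm.span_induct_alt)
  case base
  then show ?case by (metis vcomp_zero vm.span_zero)
next
  case (step p x y)
  have "vcomp b j (vscale p x) =
      (\<Sum>l\<in>(\<lambda>m. int (mdeg m)) ` Poly_Mapping.keys p. vscale (hcomp l p) (vcomp b (j - l) x))"
    by (rule vcomp_eq_sum) (auto simp: in_keys_iff)
  also have "\<dots> \<in> vm.span S"
    by (intro vm.span_sum vm.span_scale S step)
  finally show ?case
    unfolding vcomp_add by (rule vm.span_add) (rule step)
qed

section \<open>Elements killed by powers of the irrelevant ideal\<close>

fun sat_step :: "nat \<Rightarrow> (nat \<Rightarrow> ('a::field, 'v::finite) mpol) set \<Rightarrow> nat \<Rightarrow> (nat \<Rightarrow> ('a, 'v) mpol) set"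
  where
    "sat_step r U 0 = U"
  | "sat_step r U (Suc k) = {v \<in> free_carrier r. \<forall>w. vscale (xvar w) v \<in> sat_step r U k}"

text \<open>\<open>sat_step r U k\<close> is the colon of \<open>U\<close> by the
  \<open>k\<close>-th power of the irrelevant ideal, built one variable at a time. The union is the
  preimage in the free module of the submodule \<open>H\<close> of \<open>M\<close>.\<close>

definition sat :: "nat \<Rightarrow> (nat \<Rightarrow> ('a::field, 'v::finite) mpol) set \<Rightarrow> (nat \<Rightarrow> ('a, 'v) mpol) set"
  where "sat r U = (\<Union>k. sat_step r U k)"

lemma hsub_sat_step: "hsub r b U \<Longrightarrow> hsub r b (sat_step r U k)"
proof (induction k)
  case (Suc k)
  then have IH: "hsub r b (sat_step r U k)" by simp
  show ?case
    unfolding hsub_def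
  proof (intro conjI ballI allI)
    show "vm.subspace (sat_step r U (Suc k))"
    proof (rule vm.subspaceI)
      have sub: "vm.subspace (sat_step r U k)" using IH by (simp add: hsub_def)
      show "0 \<in> sat_step r U (Suc k)"
        using vm.subspace_0[OF sub] vm.subspace_0[OF subspace_free_carrier]
        by (simp only: sat_step.simps mem_Collect_eq vm.scale_zero_right simp_thms)
      show "x + y \<in> sat_step r U (Suc k)" if "x \<in> sat_step r U (Suc k)" "y \<in> sat_step r U (Suc k)" for x y
        using that vm.subspace_add[OF sub] vm.subspace_add[OF subspace_free_carrier]
        unfolding sat_step.simps mem_Collect_eq vm.scale_right_distrib by blast
      show "vscale c x \<in> sat_step r U (Suc k)" if "x \<in> sat_step r U (Suc k)" for c x
        using that vm.subspace_scale[OF sub] vm.subspace_scale[OF subspace_free_carrier]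
        unfolding sat_step.simps mem_Collect_eq vm.scale_left_commute[of _ c] by blast
    qed
    show "sat_step r U (Suc k) \<subseteq> free_carrier r" by auto
    fix u j assume u: "u \<in> sat_step r U (Suc k)"
    have "vscale (xvar w) (vcomp b j u) \<in> sat_step r U k" for w
    proof -
      have "vcomp b (j + 1) (vscale (xvar w) u) \<in> sat_step r U k"
        using u IH by (auto simp: hsub_def)
      then show ?thesis
        using vcomp_scale[OF xvar_in_forms, of b "j + 1" w u] by simp
    qed
    moreover have "vcomp b j u \<in> free_carrier r"
      using u vcomp_in_gr[of u r b j] gr_subset by auto
    ultimately show "vcomp b j u \<in> sat_step r U (Suc k)" by simp
  qed
qed simp

lemma sat_step_mono: "hsub r b U \<Longrightarrow> i \<le> k \<Longrightarrow> sat_step r U i \<subseteq> sat_step r U k"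
proof -
  assume U: "hsub r b U"
  have "sat_step r U k \<subseteq> sat_step r U (Suc k)" for k
    using hsub_sat_step[OF U, of k] by (auto simp: hsub_def vm.subspace_scale)
  then show "i \<le> k \<Longrightarrow> sat_step r U i \<subseteq> sat_step r U k"
    by (rule lift_Suc_mono_le)
qed

lemma hsub_sat:
  assumes U: "hsub r b U"
  shows "hsub r b (sat r U)"
  unfolding hsub_def
proof (intro conjI ballI allI)
  note step = hsub_sat_step[OF U, unfolded hsub_def]
  show "vm.subspace (sat r U)"
    unfolding vm.subspace_def
  proof (intro conjI ballI allI)
    show "0 \<in> sat r U"
      using vm.subspace_0[of "sat_step r U 0"] step[of 0] unfolding sat_def by blast
    fix x assume "x \<in> sat r U"
    then obtain i where i: "x \<in> sat_step r U i" by (auto simp: sat_def)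
    show "vscale c x \<in> sat r U" for c
      using i step[of i] by (auto simp: sat_def intro: vm.subspace_scale)
    fix y assume "y \<in> sat r U"
    then obtain k where "y \<in> sat_step r U k" by (auto simp: sat_def)
    then have "x \<in> sat_step r U (max i k)" "y \<in> sat_step r U (max i k)"
      using i sat_step_mono[OF U, of i "max i k"] sat_step_mono[OF U, of k "max i k"] by auto
    then show "x + y \<in> sat r U"
      using step[of "max i k"] by (auto simp: sat_def intro: vm.subspace_add)
  qed
  show "sat r U \<subseteq> free_carrier r"
    using step by (auto simp: sat_def)
  show "vcomp b j u \<in> sat r U" if "u \<in> sat r U" for u j
    using that step unfolding sat_def by blast
qed

text \<open>There are finitely many variables, so the largest of the exponents serves all of
  them.\<close>

lemma sat_saturated:
  fixes v :: "nat \<Rightarrow> ('a::field, 'v::finite) mpol"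
  assumes U: "hsub r b U" and v: "v \<in> free_carrier r" "\<And>w. vscale (xvar w) v \<in> sat r U"
  shows "v \<in> sat r U"
proof -
  have "\<forall>w. \<exists>k. vscale (xvar w) v \<in> sat_step r U k"
    using v(2) by (simp add: sat_def)
  then obtain k where k: "\<And>w. vscale (xvar w) v \<in> sat_step r U (k w)" by metis
  let ?K = "Max (range k)"
  have "vscale (xvar w) v \<in> sat_step r U ?K" for w
  proof -
    have "k w \<le> ?K" by (rule Max_ge) auto
    then show ?thesis using k sat_step_mono[OF U] by blast
  qed
  then have "v \<in> sat_step r U (Suc ?K)" using v(1) by simp
  then show ?thesis unfolding sat_def by blast
qed

lemma subset_sat: "U \<subseteq> sat r U"
  unfolding sat_def using sat_step.simps(1) by blast

text \<open>Induction on the power that kills \<open>v\<close> modulo \<open>U\<close>: the products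
  with the variables already lie in \<open>U\<close>, so otherwise \<open>v\<close> would be a socle
  element of J/U and give top homology above the bound.\<close>

lemma no_socle_above_regularity:
  fixes U :: "(nat \<Rightarrow> ('a::field, 'v::finite) mpol) set"
  assumes U: "hsub r b U" and J: "hsub r b J"
    and bound: "\<And>i j. kz.tor (pieces r b J) (pieces r b U) i j \<Longrightarrow> j - int i \<le> \<rho>"
    and v: "v \<in> J" "v \<in> gr r b l" "v \<in> sat r U" and l: "l > \<rho>"
  shows "v \<in> U"
proof -
  have sub: "vm.subspace U" "vm.subspace J" using U J by (auto simp: hsub_def)
  obtain k where "v \<in> sat_step r U k" using v(3) by (auto simp: sat_def)
  then show ?thesis
    using v(1,2) l
  proof (induction k arbitrary: v l)
    case (Suc k)
    have "vscale (xvar w) v \<in> pieces r b U (l + 1)" for w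
    proof -
      have "vscale (xvar w) v \<in> gr r b (l + 1)"
        using gr_scale[OF xvar_in_forms Suc.prems(3)] by (simp add: add.commute)
      moreover have "vscale (xvar w) v \<in> J"
        using Suc.prems(2) sub by (simp add: vm.subspace_scale)
      moreover have "vscale (xvar w) v \<in> sat_step r U k"
        using Suc.prems(1) by simp
      moreover have "l + 1 > \<rho>" using Suc.prems(4) by simp
      ultimately have "vscale (xvar w) v \<in> U" by (intro Suc.IH[of _ "l + 1"])
      then show ?thesis
        using \<open>vscale (xvar w) v \<in> gr r b (l + 1)\<close> unfolding pieces_def by blast
    qed
    then have "kz.tor (pieces r b J) (pieces r b U) CARD('v) (l + int CARD('v))"
      if "v \<notin> U"
      using Suc.prems that by (intro kz.tor_top gfam_pieces sub) (auto simp: pieces_def)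
    then show ?case
      using bound[of "CARD('v)" "l + int CARD('v)"] Suc.prems(4) by fastforce
  qed simp
qed

text \<open>Descending induction on the degree, starting where \<open>J\<close> is everything. The
  products of \<open>v\<close> with the variables decompose by induction; their
  \<open>J\<close>-parts satisfy the Koszul relations modulo \<open>U\<close>, so vanishing homology
  one step below the top makes them the multiples of a single \<open>a\<close>, and
  \<open>v - a\<close> is again killed by a power.\<close>

lemma eventually_full_imp_decomposition:
  fixes U :: "(nat \<Rightarrow> ('a::field, 'v::finite) mpol) set"
  assumes U: "hsub r b U" and J: "hsub r b J"
    and bound: "\<And>i j. kz.tor (pieces r b J) (pieces r b U) i j \<Longrightarrow> j - int i \<le> \<rho>"
    and full: "\<And>j. j \<ge> j0 \<Longrightarrow> gr r b j \<subseteq> J"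
    and v: "v \<in> gr r b j" and j: "j \<ge> \<rho>"
  shows "\<exists>a. a \<in> J \<and> a \<in> gr r b j \<and> v - a \<in> sat r U"
  using v j
proof (induction "nat (j0 - j)" arbitrary: v j)
  case 0
  then have "v \<in> J" using full[of j] by auto
  moreover have "v - v \<in> sat r U"
    using hsub_sat[OF U] by (simp add: hsub_def vm.subspace_0)
  ultimately show ?case using 0 by blast
next
  case (Suc n)
  have sub: "vm.subspace U" "vm.subspace J" "vm.subspace (sat r U)"
    using U J hsub_sat[OF U] by (auto simp: hsub_def)
  have xg: "vscale (xvar w) u \<in> gr r b (i + 1)" if "u \<in> gr r b i" for u w i
    using gr_scale[OF xvar_in_forms that] by (simp add: add.commute)
  have "\<exists>a. a \<in> J \<and> a \<in> gr r b (j + 1) \<and> vscale (xvar w) v - a \<in> sat r U" for w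
    using Suc.hyps(2) Suc.prems by (intro Suc.hyps(1) xg) auto
  then obtain m where m: "\<And>w. m w \<in> J" "\<And>w. m w \<in> gr r b (j + 1)"
    "\<And>w. vscale (xvar w) v - m w \<in> sat r U"
    by metis
  \<comment> \<open>The \<open>m w\<close> agree with the multiples of \<open>v\<close> modulo
    \<open>sat r U\<close>, so the difference lies in \<open>J\<close> and in
    \<open>sat r U\<close>. Its degree exceeds \<open>\<rho>\<close>, which puts it into
    \<open>U\<close>.\<close>
  have syz: "vscale (xvar u) (m w) - vscale (xvar w) (m u) \<in> pieces r b U (j + 1 + 1)" for u w
  proof -
    let ?x = "vscale (xvar u) (m w) - vscale (xvar w) (m u)"
    have "?x = vscale (xvar w) (vscale (xvar u) v - m u) - vscale (xvar u) (vscale (xvar w) v - m w)"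
      by (simp add: vm.scale_right_diff_distrib mult.commute[of "xvar w"])
    also have "\<dots> \<in> sat r U"
      by (intro vm.subspace_diff vm.subspace_scale sub m)
    finally have "?x \<in> sat r U" .
    moreover have "?x \<in> gr r b (j + 1 + 1)"
      by (intro gr_diff xg m)
    moreover have "?x \<in> J"
      by (intro vm.subspace_diff vm.subspace_scale sub m)
    ultimately have "?x \<in> U"
      using no_socle_above_regularity[OF U J bound, of ?x "j + 1 + 1"] Suc.prems by simp
    then show ?thesis using \<open>?x \<in> gr r b (j + 1 + 1)\<close> by (simp add: pieces_def)
  qed
  \<comment> \<open>The coefficients have degree \<open>j + 1\<close>, which is strictly above
    \<open>\<rho>\<close> even when \<open>j = \<rho>\<close>; this admits the boundary degree in
    the statement.\<close>
  have ntor: "\<not> kz.tor (pieces r b J) (pieces r b U) (CARD('v) - 1) (j + 1 + int (CARD('v) - 1))"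
    using bound[of "CARD('v) - 1" "j + 1 + int (CARD('v) - 1)"] Suc.prems by fastforce
  obtain a where a: "a \<in> pieces r b J (j + 1 - 1)" "\<And>w. vscale (xvar w) a - m w \<in> pieces r b U (j + 1)"
    using kz.tor_subtop[OF gfam_pieces[OF sub(1)] gfam_pieces[OF sub(2)] _ syz ntor] m
    by (metis (no_types, lifting) IntI pieces_def)
  have aJ: "a \<in> J" "a \<in> gr r b j" using a(1) by (auto simp: pieces_def)
  have "vscale (xvar w) (v - a) \<in> sat r U" for w
  proof -
    have "vscale (xvar w) a - m w \<in> sat r U"
      using a(2)[of w] subset_sat by (auto simp: pieces_def)
    then have "(vscale (xvar w) v - m w) - (vscale (xvar w) a - m w) \<in> sat r U"
      by (rule vm.subspace_diff[OF sub(3) m(3)])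
    moreover have "(vscale (xvar w) v - m w) - (vscale (xvar w) a - m w) = vscale (xvar w) (v - a)"
      by (simp add: vm.scale_right_diff_distrib)
    ultimately show ?thesis by (simp only:)
  qed
  moreover have "v - a \<in> free_carrier r"
    using gr_diff[OF Suc.prems(1) aJ(2)] gr_subset by blast
  ultimately have "v - a \<in> sat r U"
    by (rule sat_saturated[OF U, rotated])
  then show ?case using aJ by blast
qed

section \<open>The filtration of a presented module by powers of an ideal\<close>

locale ideal_powers =
  fixes r :: nat and U :: "(nat \<Rightarrow> ('a::field, 'v::finite) mpol) set" and Bs :: "('a, 'v) mpol set"
    and d :: nat
  assumes U: "hsub r zdeg U" and Bs: "Bs \<subseteq> forms (int d)" and d: "d > 0"
begin

text \<open>The submodule \<open>I\<^sup>tF\<close> of the free module \<open>F\<close>, obtained by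
  multiplying with the generating forms repeatedly; the power of the ideal itself is not
  formed.\<close>

primrec G :: "nat \<Rightarrow> (nat \<Rightarrow> ('a, 'v) mpol) set" where
  "G 0 = free_carrier r"
| "G (Suc t) = vm.span {vscale p v | p v. p \<in> Bs \<and> v \<in> G t}"

text \<open>The preimage of \<open>I\<^sup>tM\<close> in \<open>F\<close>, where
  \<open>M = F/U\<close>. Accordingly J t/U stands for \<open>I\<^sup>tM\<close> and F/J t for
  \<open>M/I\<^sup>tM\<close>; their homologies are \<open>T t\<close> and
  \<open>Q t\<close>.\<close>

definition J :: "nat \<Rightarrow> (nat \<Rightarrow> ('a, 'v) mpol) set"
  where "J t = {u + v | u v. u \<in> G t \<and> v \<in> U}"

abbreviation V :: "int \<Rightarrow> (nat \<Rightarrow> ('a, 'v) mpol) set"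
  where "V \<equiv> gr r zdeg"

abbreviation T :: "nat \<Rightarrow> nat \<Rightarrow> int \<Rightarrow> bool"
  where "T t \<equiv> kz.tor (pieces r zdeg (J t)) (pieces r zdeg U)"

abbreviation Q :: "nat \<Rightarrow> nat \<Rightarrow> int \<Rightarrow> bool"
  where "Q t \<equiv> kz.tor (pieces r zdeg (free_carrier r)) (pieces r zdeg (J t))"

lemma subU: "vm.subspace U" using U by (simp add: hsub_def)

lemma G_antimono: "G (Suc t) \<subseteq> G t"
proof (induction t)
  case 0
  show ?case
    unfolding G.simps
    by (rule vm.span_minimal) (auto intro: vm.subspace_scale[OF subspace_free_carrier] subspace_free_carrier)
next
  case (Suc t)
  then show ?case
    unfolding G.simps(2)[of "Suc t"] G.simps(2)[of t] using Suc by (intro vm.span_mono) auto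
qed

lemma G_free: "G t \<subseteq> free_carrier r"
  using G_antimono by (induction t) auto

lemma subG: "vm.subspace (G t)"
  by (cases t) (auto simp: subspace_free_carrier)

lemma hsub_G: "hsub r zdeg (G t)"
proof (induction t)
  case 0
  then show ?case by (simp add: hsub_free_carrier)
next
  case (Suc t)
  have "vcomp zdeg j x \<in> vm.span {vscale p v | p v. p \<in> Bs \<and> v \<in> G t}"
    if x: "x \<in> {vscale p v | p v. p \<in> Bs \<and> v \<in> G t}" for x j
  proof -
    obtain p v where pv: "x = vscale p v" "p \<in> Bs" "v \<in> G t" using x by blast
    have "vcomp zdeg j x = vscale p (vcomp zdeg (j - int d) v)"
      unfolding pv(1) by (rule vcomp_scale) (use pv(2) Bs in auto)
    moreover have "vcomp zdeg (j - int d) v \<in> G t"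
      using Suc pv(3) by (simp add: hsub_def)
    ultimately show ?thesis
      using pv(2) by (auto intro!: vm.span_base)
  qed
  from vcomp_span[OF this] show ?case
    using G_free[of "Suc t"] subG[of "Suc t"] by (simp add: hsub_def)
qed

lemma GJ: "G t \<subseteq> J t"
  unfolding J_def using vm.subspace_0[OF subU] by (metis (mono_tags, lifting) add.right_neutral mem_Collect_eq subsetI)

lemma UJ: "U \<subseteq> J t"
  unfolding J_def using vm.subspace_0[OF subG[of t]] by (metis (mono_tags, lifting) add.left_neutral mem_Collect_eq subsetI)

lemma subJ: "vm.subspace (J t)"
  unfolding J_def by (rule subspace_sums[OF subG subU])

lemma J_free: "J t \<subseteq> free_carrier r"
proof
  fix x assume "x \<in> J t"
  then obtain u v where "x = u + v" "u \<in> G t" "v \<in> U" by (auto simp: J_def)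
  then show "x \<in> free_carrier r"
    using G_free[of t] U vm.subspace_add[OF subspace_free_carrier, of u r v] unfolding hsub_def by blast
qed

lemma hsub_J: "hsub r zdeg (J t)"
  unfolding hsub_def
proof (intro conjI ballI allI subJ J_free)
  fix x j assume "x \<in> J t"
  then obtain u v where uv: "x = u + v" "u \<in> G t" "v \<in> U" by (auto simp: J_def)
  then have "vcomp zdeg j u \<in> J t" "vcomp zdeg j v \<in> J t"
    using hsub_G[of t] U GJ[of t] UJ[of t] unfolding hsub_def by blast+
  then show "vcomp zdeg j x \<in> J t"
    unfolding uv(1) vcomp_add by (rule vm.subspace_add[OF subJ])
qed

lemma J_antimono: "s \<le> t \<Longrightarrow> J t \<subseteq> J s"
  by (rule lift_Suc_antimono_le) (use G_antimono in \<open>auto simp: J_def; blast\<close>)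

lemma J_mult:
  assumes "p \<in> Bs" "v \<in> J t"
  shows "vscale p v \<in> J (Suc t)"
proof -
  obtain g u where gu: "v = g + u" "g \<in> G t" "u \<in> U" using assms(2) by (auto simp: J_def)
  have "vscale p g \<in> G (Suc t)" using gu(2) assms(1) by (auto intro!: vm.span_base)
  moreover have "vscale p u \<in> U" using gu(3) by (rule vm.subspace_scale[OF subU])
  ultimately show ?thesis
    unfolding gu(1) vm.scale_right_distrib J_def by blast
qed

lemma G_low: "v \<in> G t \<Longrightarrow> j < int d * int t \<Longrightarrow> vcomp zdeg j v = 0"
proof (induction t arbitrary: v j)
  case 0
  then have "vcomp zdeg j v \<in> V j" by (simp add: vcomp_in_gr)
  then have "vcomp zdeg j v k = 0" for k
    using forms_neg[of "vcomp zdeg j v k" j] 0 by (auto simp: gr_iff zdeg_def)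
  then show ?case by (simp add: fun_eq_iff)
next
  case (Suc t)
  from Suc.prems(1) have "v \<in> vm.span {vscale p v | p v. p \<in> Bs \<and> v \<in> G t}" by simp
  then show ?case
    using Suc.prems(2)
  proof (induction rule: vm.span_induct_alt)
    case base
    show ?case by (rule vcomp_zero)
  next
    case (step q x y)
    obtain p v where pv: "x = vscale p v" "p \<in> Bs" "v \<in> G t" using step.hyps by blast
    have x: "vcomp zdeg i x = 0" if "i \<le> j" for i
    proof -
      have "vcomp zdeg i x = vscale p (vcomp zdeg (i - int d) v)"
        unfolding pv(1) by (rule vcomp_scale) (use pv(2) Bs in auto)
      also have "vcomp zdeg (i - int d) v = 0"
        by (rule Suc.IH[OF pv(3)]) (use step.prems that in \<open>simp add: algebra_simps\<close>)
      finally show ?thesis by (simp only: vm.scale_zero_right)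
    qed
    have "vcomp zdeg j (vscale q x) =
      (\<Sum>l\<in>(\<lambda>m. int (mdeg m)) ` Poly_Mapping.keys q. vscale (hcomp l q) (vcomp zdeg (j - l) x))"
      by (rule vcomp_eq_sum) (auto simp: in_keys_iff)
    also have "\<dots> = 0"
    proof (intro sum.neutral ballI)
      fix l assume "l \<in> (\<lambda>m. int (mdeg m)) ` Poly_Mapping.keys q"
      then have "vcomp zdeg (j - l) x = 0" by (intro x) auto
      then show "vscale (hcomp l q) (vcomp zdeg (j - l) x) = 0" by (simp only: vm.scale_zero_right)
    qed
    finally have "vcomp zdeg j (vscale q x) = 0" .
    then show ?case
      using step by (simp only: vcomp_add add_0_left)
  qed
qed

text \<open>\<open>F\<close> starts in degree 0 and every factor from \<open>Bs\<close> raises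
  degrees by \<open>d\<close>, so \<open>I\<^sup>tM\<close> is zero below degree
  \<open>dt\<close>.\<close>

lemma J_low:
  assumes "v \<in> J t" "v \<in> V j" "j < int d * int t"
  shows "v \<in> U"
proof -
  obtain g u where gu: "v = g + u" "g \<in> G t" "u \<in> U" using assms(1) by (auto simp: J_def)
  have "v = vcomp zdeg j v" using vcomp_gr[OF assms(2), of j] by simp
  also have "\<dots> = vcomp zdeg j u"
    unfolding gu(1) vcomp_add G_low[OF gu(2) assms(3)] by (rule add_0_left)
  also have "\<dots> \<in> U" using gu(3) U by (simp add: hsub_def)
  finally show ?thesis .
qed

text \<open>The degree \<open>j\<close> part of \<open>IM\<close> is spanned by products of the
  generating forms with elements of degree \<open>j - d\<close>: multipliers can be absorbed into
  the module element before the component is taken. \<open>K\<close> is kept general since it serves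
  for \<open>J (Suc t)\<close> and for its sum with \<open>sat r U\<close>.\<close>

lemma J_1_subset:
  assumes K: "vm.subspace K" "U \<subseteq> K" and gen: "\<And>p w. p \<in> Bs \<Longrightarrow> w \<in> V (j - int d) \<Longrightarrow> vscale p w \<in> K"
    and x: "x \<in> J 1" "x \<in> V j"
  shows "x \<in> K"
proof -
  obtain g u where gu: "x = g + u" "g \<in> G 1" "u \<in> U" using x(1) by (auto simp: J_def)
  from gu(2) have "g \<in> vm.span {vscale p v | p v. p \<in> Bs \<and> v \<in> G 0}" by simp
  then have "vcomp zdeg j g \<in> K"
  proof (induction rule: vm.span_induct_alt)
    case base
    then show ?case by (metis vcomp_zero vm.subspace_0 K(1))
  next
    case (step q y z)
    obtain p v where pv: "y = vscale p v" "p \<in> Bs" "v \<in> free_carrier r" using step by auto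
    have "vcomp zdeg j (vscale q y) = vcomp zdeg j (vscale p (vscale q v))"
      unfolding pv(1) by (simp only: vm.scale_left_commute)
    also have "\<dots> = vscale p (vcomp zdeg (j - int d) (vscale q v))"
      by (rule vcomp_scale) (use pv(2) Bs in auto)
    also have "\<dots> \<in> K"
      by (intro gen pv(2) vcomp_in_gr vm.subspace_scale[OF subspace_free_carrier] pv(3))
    finally show ?case
      unfolding vcomp_add by (rule vm.subspace_add[OF K(1)]) (rule step)
  qed
  moreover have "vcomp zdeg j u \<in> K" using gu(3) U K(2) by (auto simp: hsub_def)
  moreover have "x = vcomp zdeg j g + vcomp zdeg j u"
    using vcomp_gr[OF x(2), of j] unfolding gu(1) vcomp_add by simp
  ultimately show ?thesis
    using vm.subspace_add[OF K(1)] by metis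
qed

lemma J_Suc_full:
  assumes "V (j - int d) \<subseteq> J t" "V j \<subseteq> J 1"
  shows "V j \<subseteq> J (Suc t)"
proof
  fix x assume "x \<in> V j"
  then show "x \<in> J (Suc t)"
    using assms by (intro J_1_subset[of "J (Suc t)" j x] subJ UJ J_mult) auto
qed

text \<open>The graded forms of the two length hypotheses: \<open>M/IM\<close> vanishes in all large
  degrees, and \<open>M\<close> is nonzero in every degree \<ge> 0.\<close>

context
  fixes j1 :: int
  assumes fin: "\<And>j. j \<ge> j1 \<Longrightarrow> V j \<subseteq> J 1"
    and nonfin: "\<And>j. j \<ge> 0 \<Longrightarrow> \<not> V j \<subseteq> U"
begin

lemma J_full: "t \<ge> 1 \<Longrightarrow> \<exists>j0. \<forall>j\<ge>j0. V j \<subseteq> J t"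
proof (induction t rule: nat_induct_at_least)
  case base
  then show ?case using fin by blast
next
  case (Suc t)
  then obtain j0 where j0: "\<And>j. j \<ge> j0 \<Longrightarrow> V j \<subseteq> J t" by blast
  have "V j \<subseteq> J (Suc t)" if "j \<ge> max (j0 + int d) j1" for j
    using that by (intro J_Suc_full j0 fin) auto
  then show ?case by blast
qed

text \<open>As \<open>d > 0\<close>, the degree \<open>dt - 1\<close> is nonnegative, so
  \<open>M\<close> is nonzero there, whereas \<open>I\<^sup>tM\<close> starts only in degree
  \<open>dt\<close>. This is the source of \<open>f\<^sub>t \<ge> 0\<close>.\<close>

lemma J_not_full_low: "t \<ge> 1 \<Longrightarrow> \<not> V (int d * int t - 1) \<subseteq> J t"
proof
  assume t: "t \<ge> 1" and sub: "V (int d * int t - 1) \<subseteq> J t"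
  have "1 * 1 \<le> int d * int t" using t d by (intro mult_mono) auto
  then have "\<not> V (int d * int t - 1) \<subseteq> U" by (intro nonfin) simp
  then show False using J_low[of _ t "int d * int t - 1"] sub by auto
qed

lemma quot_end: "\<exists>E. t \<ge> 1 \<longrightarrow> \<not> V E \<subseteq> J t \<and> (\<forall>j>E. V j \<subseteq> J t)"
proof (cases "t \<ge> 1")
  case True
  then obtain j0 where j0: "\<And>j. j \<ge> j0 \<Longrightarrow> V j \<subseteq> J t" using J_full by blast
  let ?l = "int d * int t - 1"
  let ?S = "{j \<in> {?l..j0}. \<not> V j \<subseteq> J t}"
  have fin: "finite ?S" by (rule finite_subset[OF _ finite_atLeastAtMost_int[of ?l j0]]) blast
  have "?l \<in> ?S"
    using J_not_full_low[OF True] j0[of ?l] by force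
  then have "Max ?S \<in> ?S" "\<And>j. j \<in> ?S \<Longrightarrow> j \<le> Max ?S" "?l \<le> Max ?S"
    using Max_in[OF fin] Max_ge[OF fin] by blast+
  moreover have "V j \<subseteq> J t" if "j > Max ?S" for j
  proof (rule ccontr)
    assume n: "\<not> V j \<subseteq> J t"
    then have "j < j0" using j0[of j] by force
    then have "j \<in> ?S" using n that calculation(3) by simp
    then show False using calculation(2)[of j] that by simp
  qed
  ultimately show ?thesis by blast
qed simp

text \<open>The top degree of \<open>M/I\<^sup>tM\<close>, that is
  \<open>dt + f\<^sub>t - 1\<close>.\<close>

definition E :: "nat \<Rightarrow> int" where "E t = (SOME E. t \<ge> 1 \<longrightarrow> \<not> V E \<subseteq> J t \<and> (\<forall>j>E. V j \<subseteq> J t))"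

lemma E: "t \<ge> 1 \<Longrightarrow> \<not> V (E t) \<subseteq> J t" "t \<ge> 1 \<Longrightarrow> j > E t \<Longrightarrow> V j \<subseteq> J t"
proof -
  have "t \<ge> 1 \<longrightarrow> \<not> V (E t) \<subseteq> J t \<and> (\<forall>j>E t. V j \<subseteq> J t)"
    unfolding E_def by (rule someI_ex[OF quot_end])
  then show "t \<ge> 1 \<Longrightarrow> \<not> V (E t) \<subseteq> J t" "t \<ge> 1 \<Longrightarrow> j > E t \<Longrightarrow> V j \<subseteq> J t"
    by simp_all
qed

lemma E_ge: "t \<ge> 1 \<Longrightarrow> E t + 1 \<ge> int d * int t"
  using E(2)[of t "int d * int t - 1"] J_not_full_low[of t] by force

lemma E_Suc: "t \<ge> 1 \<Longrightarrow> E (Suc t) \<le> E t + int d"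
proof (rule ccontr)
  assume t: "t \<ge> 1" and "\<not> E (Suc t) \<le> E t + int d"
  then have "V (E (Suc t)) \<subseteq> J (Suc t)"
    using E(2)[OF t, of "E (Suc t)"] E(2)[OF t, of "E (Suc t) - int d"] J_antimono[of 1 t]
    by (intro J_Suc_full) auto
  then show False using E(1)[of "Suc t"] by simp
qed

lemma Q_bound:
  assumes "t \<ge> 1" "Q t i j"
  shows "j - int i \<le> E t"
proof (rule ccontr)
  assume "\<not> j - int i \<le> E t"
  then have "V (j - int i) \<subseteq> J t" using E(2)[OF assms(1)] by simp
  then show False
    using kz.tor_quotientD[OF gfam_pieces[OF subJ] gfam_pieces[OF subspace_free_carrier] assms(2)]
      gr_subset by (auto simp: pieces_def)
qed

lemma Q_top:
  assumes "t \<ge> 1"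
  shows "Q t CARD('v) (E t + int CARD('v))"
proof -
  obtain v where v: "v \<in> V (E t)" "v \<notin> J t" using E(1)[OF assms] by blast
  have "vscale (xvar w) v \<in> pieces r zdeg (J t) (E t + 1)" for w
  proof -
    have "vscale (xvar w) v \<in> V (E t + 1)"
      using gr_scale[OF xvar_in_forms v(1), of w] by (simp add: add.commute)
    then show ?thesis using E(2)[OF assms, of "E t + 1"] by (auto simp: pieces_def)
  qed
  moreover have "v \<in> pieces r zdeg (free_carrier r) (E t)" "v \<notin> pieces r zdeg (J t) (E t)"
    using v by (simp_all add: pieces_free) (simp add: pieces_def)
  ultimately show ?thesis
    by (intro kz.tor_top[of _ _ v] gfam_pieces subJ subspace_free_carrier)
qed

text \<open>The lowest degree of \<open>I\<^sup>tM\<close> carries a minimal generator, and it is at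
  least \<open>dt\<close>. This gives \<open>e\<^sub>t \<ge> 0\<close> and also shows that the set
  defining the regularity is nonempty.\<close>

lemma T_lowest: "t \<ge> 1 \<Longrightarrow> \<exists>l\<ge>int d * int t. T t 0 l"
proof -
  assume t: "t \<ge> 1"
  let ?low = "int d * int t"
  obtain j0 where j0: "\<And>j. j \<ge> j0 \<Longrightarrow> V j \<subseteq> J t" using J_full t by blast
  let ?P = "\<lambda>n. \<not> J t \<inter> V (?low + int n) \<subseteq> U"
  have "?P (nat (max j0 0))"
  proof -
    have "?low \<ge> 0" by simp
    then have "?low + int (nat (max j0 0)) \<ge> j0" "?low + int (nat (max j0 0)) \<ge> 0" by linarith+
    then show ?thesis
      using j0 nonfin[of "?low + int (nat (max j0 0))"] by blast
  qed
  then obtain n where n: "?P n" "\<And>m. m < n \<Longrightarrow> \<not> ?P m"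
    using exists_least_iff[of ?P] by blast
  let ?l = "?low + int n"
  have "pieces r zdeg (J t) (?l - 1) \<subseteq> pieces r zdeg U (?l - 1)"
  proof (cases n)
    case 0
    then show ?thesis using J_low[of _ t "?l - 1"] by (auto simp: pieces_def)
  next
    case (Suc m)
    then show ?thesis using n(2)[of m] by (auto simp: pieces_def)
  qed
  moreover obtain v where "v \<in> J t" "v \<in> V ?l" "v \<notin> U" using n(1) by blast
  ultimately have "T t 0 ?l"
    by (intro kz.tor_lowest[of _ v] gfam_pieces subU) (auto simp: pieces_def)
  then show ?thesis by (intro exI[of _ ?l]) simp
qed

lemma T_max: "\<exists>\<rho>. t \<ge> 1 \<longrightarrow> (\<forall>i j. T t i j \<longrightarrow> j - int i \<le> \<rho>) \<and> (\<exists>i. T t i (\<rho> + int i))"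
proof (cases "t \<ge> 1")
  case True
  obtain l where l: "T t 0 l" using T_lowest[OF True] by blast
  obtain c where c: "\<And>i j. T t i j \<Longrightarrow> j - int i \<le> c"
    using tor_bounded[OF hsub_J U UJ, of t] by blast
  let ?S = "{\<rho> \<in> {l..c}. \<exists>i. T t i (\<rho> + int i)}"
  have fin: "finite ?S" by (rule finite_subset[OF _ finite_atLeastAtMost_int[of l c]]) blast
  have "l \<in> ?S" using l c[OF l] by (auto intro: exI[of _ 0])
  then have max: "Max ?S \<in> ?S" "\<And>x. x \<in> ?S \<Longrightarrow> x \<le> Max ?S"
    using Max_in[OF fin] Max_ge[OF fin] by blast+
  have "j - int i \<le> Max ?S" if T: "T t i j" for i j
  proof (cases "j - int i \<ge> l")
    case True
    have "T t i ((j - int i) + int i)" using T by simp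
    then have "j - int i \<in> ?S" using True c[OF T] by (simp only: mem_Collect_eq atLeastAtMost_iff) blast
    then show ?thesis by (rule max(2))
  next
    case False
    then show ?thesis using max(1) by auto
  qed
  then show ?thesis using max(1) by blast
qed simp

text \<open>The regularity of \<open>I\<^sup>tM\<close>, that is \<open>dt + e\<^sub>t\<close>. The
  maximum exists since the degrees are nonempty by \<open>T_lowest\<close> and bounded by
  \<open>tor_bounded\<close>.\<close>

definition R :: "nat \<Rightarrow> int"
  where "R t = (SOME \<rho>. t \<ge> 1 \<longrightarrow> (\<forall>i j. T t i j \<longrightarrow> j - int i \<le> \<rho>) \<and> (\<exists>i. T t i (\<rho> + int i)))"

lemma R_bound: "t \<ge> 1 \<Longrightarrow> T t i j \<Longrightarrow> j - int i \<le> R t"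
  and R_attained: "t \<ge> 1 \<Longrightarrow> \<exists>i. T t i (R t + int i)"
proof -
  have "t \<ge> 1 \<longrightarrow> (\<forall>i j. T t i j \<longrightarrow> j - int i \<le> R t) \<and> (\<exists>i. T t i (R t + int i))"
    unfolding R_def by (rule someI_ex[OF T_max])
  then show "t \<ge> 1 \<Longrightarrow> T t i j \<Longrightarrow> j - int i \<le> R t" "t \<ge> 1 \<Longrightarrow> \<exists>i. T t i (R t + int i)"
    by blast+
qed

lemma R_ge: "t \<ge> 1 \<Longrightarrow> R t \<ge> int d * int t"
  using T_lowest[of t] R_bound[of t 0] by force

lemma R_Suc:
  assumes t: "t \<ge> 1"
  shows "R (Suc t) \<le> R t + int d"
proof -
  have bound: "j - int i \<le> R t" if "T t i j" for i j using R_bound[OF t that] .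
  obtain j0 where j0: "\<And>j. j \<ge> j0 \<Longrightarrow> V j \<subseteq> J t" using J_full t by blast
  have H: "hsub r zdeg (sat r U)" by (rule hsub_sat[OF U])
  then have subH: "vm.subspace (sat r U)" by (simp add: hsub_def)
  \<comment> \<open>Elements of degree \<open>l - d \<ge> R t\<close> decompose into
    \<open>J t\<close> plus \<open>sat r U\<close>. Multiplying by a form from \<open>Bs\<close>
    sends the first part to \<open>J (Suc t)\<close>, so only the part in \<open>sat r U\<close>
    remains to be removed.\<close>
  have key: "J t \<inter> V l \<subseteq> J (Suc t)" if l: "l \<ge> R t + int d" for l
  proof
    fix v assume v: "v \<in> J t \<inter> V l"
    let ?K = "{a + h | a h. a \<in> J (Suc t) \<and> h \<in> sat r U}"
    have "v \<in> ?K"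
    proof (rule J_1_subset)
      show "vm.subspace ?K" by (rule subspace_sums[OF subJ subH])
      show "U \<subseteq> ?K"
      proof
        fix u assume "u \<in> U"
        then have "u \<in> J (Suc t)" using UJ by blast
        moreover have "0 \<in> sat r U" by (rule vm.subspace_0[OF subH])
        moreover have "u = u + 0" by simp
        ultimately show "u \<in> ?K" by blast
      qed
      show "v \<in> J 1" "v \<in> V l" using v J_antimono[OF t] by auto
      fix p w assume p: "p \<in> Bs" and w: "w \<in> V (l - int d)"
      obtain a where a: "a \<in> J t" "w - a \<in> sat r U"
        using eventually_full_imp_decomposition[OF U hsub_J bound j0 w] l by auto
      have "vscale p w = vscale p a + vscale p (w - a)"
        by (simp add: vm.scale_right_diff_distrib)
      moreover have "vscale p a \<in> J (Suc t)" by (rule J_mult[OF p a(1)])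
      moreover have "vscale p (w - a) \<in> sat r U" by (rule vm.subspace_scale[OF subH a(2)])
      ultimately show "vscale p w \<in> ?K" by blast
    qed
    then obtain a h where ah: "v = a + h" "a \<in> J (Suc t)" "h \<in> sat r U" by blast
    have v_eq: "v = vcomp zdeg l a + vcomp zdeg l h"
      using vcomp_gr[of v r zdeg l l] v unfolding ah(1) vcomp_add by simp
    have a': "vcomp zdeg l a \<in> J (Suc t)" using ah(2) hsub_J by (simp add: hsub_def)
    have h': "vcomp zdeg l h \<in> sat r U" "vcomp zdeg l h \<in> V l"
      using ah(3) H by (auto simp: hsub_def intro: vcomp_in_gr)
    \<comment> \<open>The leftover part lies in \<open>J t\<close> as well. Because
      \<open>d > 0\<close>, its degree is above \<open>R t\<close>, where \<open>J t\<close> and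
      \<open>sat r U\<close> meet only in \<open>U\<close>.\<close>
    have "vcomp zdeg l h = v - vcomp zdeg l a" using v_eq by simp
    also have "\<dots> \<in> J t"
      using v a' J_antimono[of t "Suc t"] by (intro vm.subspace_diff[OF subJ]) auto
    finally have "vcomp zdeg l h \<in> U"
      using no_socle_above_regularity[OF U hsub_J bound _ h'(2,1)] l d by simp
    then show "v \<in> J (Suc t)"
      using v_eq a' UJ vm.subspace_add[OF subJ] by (metis subsetD)
  qed
  obtain i where i: "T (Suc t) i (R (Suc t) + int i)" using R_attained[of "Suc t"] by auto
  have "T t i (R (Suc t) + int i) \<or>
      kz.tor (pieces r zdeg (J t)) (pieces r zdeg (J (Suc t))) (Suc i) (R (Suc t) + int i)"
    using J_antimono[of t "Suc t"] UJ
    by (intro kz.tor_long_exact[OF gfam_pieces[OF subJ] gfam_pieces[OF subJ] _ _ i]) (auto simp: pieces_def)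
  then show ?thesis
  proof
    assume "T t i (R (Suc t) + int i)"
    then show ?thesis using bound by fastforce
  next
    assume "kz.tor (pieces r zdeg (J t)) (pieces r zdeg (J (Suc t))) (Suc i) (R (Suc t) + int i)"
    \<comment> \<open>Homological degree \<open>i + 1\<close> at total degree
      \<open>R (Suc t) + i\<close> sees the module in degree \<open>R (Suc t) - 1\<close>, so the
      strict bound below \<open>R t + d\<close> becomes the claimed weak one.\<close>
    then have "\<not> J t \<inter> V (R (Suc t) - 1) \<subseteq> J (Suc t)"
      using kz.tor_quotientD[OF gfam_pieces[OF subJ] gfam_pieces[OF subJ]] by (fastforce simp: pieces_def)
    then show ?thesis using key[of "R (Suc t) - 1"] by force
  qed
qed

text \<open>Once \<open>dt\<close> exceeds the regularity of \<open>M\<close>, the homology of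
  \<open>M\<close> cannot account for the regularity of \<open>I\<^sup>tM\<close>, and
  \<open>H\<close> is zero in the degrees concerned; only the connecting map from
  \<open>M/I\<^sup>tM\<close> remains.\<close>

lemma R_eq_E: "\<exists>t0\<ge>1. \<forall>t\<ge>t0. R t = E t + 1"
proof -
  have F: "hsub r zdeg (free_carrier r)" by (rule hsub_free_carrier)
  have UF: "U \<subseteq> free_carrier r" using U by (simp add: hsub_def)
  obtain c where c: "\<And>i j. kz.tor (pieces r zdeg (free_carrier r)) (pieces r zdeg U) i j \<Longrightarrow> j - int i \<le> c"
    using tor_bounded[OF F U UF] by blast
  \<comment> \<open>The threshold makes \<open>t > c\<close>, hence \<open>dt > c\<close> because
    \<open>d \<ge> 1\<close>.\<close>
  have "R t = E t + 1" if t: "t \<ge> max 1 (nat (c + 1))" for t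
  proof (rule antisym)
    have t1: "t \<ge> 1" and "c < int t" using t by auto
    moreover have "1 * int t \<le> int d * int t" using d by (intro mult_right_mono) auto
    ultimately have ct: "c < int d * int t" by linarith
    obtain i where i: "T t i (R t + int i)" using R_attained[OF t1] by auto
    have "kz.tor (pieces r zdeg (free_carrier r)) (pieces r zdeg U) i (R t + int i) \<or> Q t (Suc i) (R t + int i)"
      using UJ J_free
      by (intro kz.tor_long_exact[OF gfam_pieces[OF subJ] gfam_pieces[OF subspace_free_carrier] _ _ i])
        (auto simp: pieces_def)
    then show "R t \<le> E t + 1"
    proof
      assume "kz.tor (pieces r zdeg (free_carrier r)) (pieces r zdeg U) i (R t + int i)"
      then show ?thesis using c[of i "R t + int i"] ct E_ge[OF t1] by simp
    next
      assume "Q t (Suc i) (R t + int i)"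
      then show ?thesis using Q_bound[OF t1, of "Suc i" "R t + int i"] by simp
    qed
    show "E t + 1 \<le> R t"
    proof (rule ccontr)
      assume less: "\<not> E t + 1 \<le> R t"
      then have Ec: "E t > c" using R_ge[OF t1] ct by simp
      obtain j0 where j0: "\<And>j. j \<ge> j0 \<Longrightarrow> V j \<subseteq> J t" using J_full t1 by blast
      \<comment> \<open>If \<open>R t \<le> E t\<close>, then \<open>M = I\<^sup>tM + H\<close> in
        degree \<open>E t\<close>; that degree exceeds \<open>c\<close>, so \<open>H\<close>
        contributes nothing, against \<open>M/I\<^sup>tM\<close> being nonzero there.\<close>
      have "V (E t) \<subseteq> J t"
      proof
        fix v assume v: "v \<in> V (E t)"
        obtain a where a: "a \<in> J t" "a \<in> V (E t)" "v - a \<in> sat r U"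
          using eventually_full_imp_decomposition[OF U hsub_J R_bound[OF t1] j0 v] less by auto
        have va: "v - a \<in> V (E t)" by (rule gr_diff[OF v a(2)])
        have "v - a \<in> U"
          by (rule no_socle_above_regularity[OF U F c _ va a(3) Ec]) (use va gr_subset in blast)+
        then have "(v - a) + a \<in> J t" using UJ a(1) by (intro vm.subspace_add[OF subJ]) auto
        then show "v \<in> J t" by (simp only: diff_add_cancel)
      qed
      then show False using E(1)[OF t1] by simp
    qed
  qed
  then show ?thesis by (intro exI[of _ "max 1 (nat (c + 1))"]) simp
qed

end

end

lemma antitone_int_INF:
  fixes e :: "nat \<Rightarrow> int"
  assumes dec: "\<And>t. t \<ge> 1 \<Longrightarrow> e (Suc t) \<le> e t" and nonneg: "\<And>t. t \<ge> 1 \<Longrightarrow> e t \<ge> 0"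
  shows "\<exists>t0\<ge>1. \<forall>t\<ge>t0. e t = (INF s\<in>{1..}. e s)"
proof -
  obtain t0 where t0: "t0 \<ge> 1" "\<And>t. t \<ge> 1 \<Longrightarrow> nat (e t0) \<le> nat (e t)"
    using ex_has_least_nat[of "\<lambda>t. t \<ge> 1" 1 "\<lambda>t. nat (e t)"] by auto
  have least: "e t0 \<le> e t" if "t \<ge> 1" for t
    using t0(2)[OF that] nonneg[OF that] nonneg[OF t0(1)] by simp
  have inf: "(INF s\<in>{1..}. e s) = e t0"
    by (rule cInf_eq_minimum) (use t0(1) least in auto)
  have "e t \<le> e t0" if "t \<ge> t0" for t
    using that
  proof (induction t rule: nat_induct_at_least)
    case (Suc t)
    then show ?case using dec[of t] t0(1) by simp
  qed simp
  then show ?thesis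
    using least t0(1) inf by (intro exI[of _ t0]) (auto intro: antisym)
qed

section \<open>Submodules and composition series\<close>

lemma (in Module.module) submodule_Inter:
  assumes "\<F> \<noteq> {}" "\<And>H. H \<in> \<F> \<Longrightarrow> submodule H R M"
  shows "submodule (\<Inter>\<F>) R M"
proof (rule submoduleI)
  show "\<Inter>\<F> \<subseteq> carrier M"
    using assms submoduleE(1) by blast
  show "\<zero>\<^bsub>M\<^esub> \<in> \<Inter>\<F>"
    using assms(2) subgroup.one_closed[OF submodule.axioms(1)] by fastforce
  show "\<ominus>\<^bsub>M\<^esub> a \<in> \<Inter>\<F>" if "a \<in> \<Inter>\<F>" for a
    using that assms(2) submoduleE(3) by blast
  show "a \<oplus>\<^bsub>M\<^esub> b \<in> \<Inter>\<F>" if "a \<in> \<Inter>\<F>" "b \<in> \<Inter>\<F>" for a b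
    using that assms(2) submoduleE(5) by blast
  show "a \<odot>\<^bsub>M\<^esub> x \<in> \<Inter>\<F>" if "a \<in> carrier R" "x \<in> \<Inter>\<F>" for a x
    using that assms(2) submoduleE(4) by blast
qed

lemma (in Module.module) generated_submodule:
  assumes "S \<subseteq> carrier M"
  shows "submodule (generated_submodule R M S) R M"
  unfolding generated_submodule_def hull_def
  by (rule submodule_Inter) (use assms carrier_is_submodule in auto)

lemma generated_submodule_minimal:
  "submodule N R M \<Longrightarrow> S \<subseteq> N \<Longrightarrow> generated_submodule R M S \<subseteq> N"
  unfolding generated_submodule_def by (rule hull_minimal)

lemma subset_generated_submodule: "S \<subseteq> generated_submodule R M S"
  unfolding generated_submodule_def by (rule hull_subset)

lemma generated_submodule_mono: "S \<subseteq> S' \<Longrightarrow> generated_submodule R M S \<subseteq> generated_submodule R M S'"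
  unfolding generated_submodule_def by (rule hull_mono)

text \<open>One step of a composition series, as a relation, so that series can be extended and
  concatenated through its reflexive transitive closure.\<close>

definition covers :: "('r, 'x) ring_scheme \<Rightarrow> ('r, 'm, 'y) module_scheme \<Rightarrow> 'm set \<Rightarrow> 'm set \<Rightarrow> bool"
  where "covers R M D Y \<longleftrightarrow> submodule D R M \<and> submodule Y R M \<and> D \<subset> Y \<and>
    \<not> (\<exists>L. submodule L R M \<and> D \<subset> L \<and> L \<subset> Y)"

lemma finite_length_if_covers:
  assumes carr: "submodule (carrier M) R M" and chain: "(covers R M)\<^sup>*\<^sup>* {\<zero>\<^bsub>M\<^esub>} (carrier M)"
  shows "finite_length R M"
proof -
  obtain l where "(covers R M ^^ l) {\<zero>\<^bsub>M\<^esub>} (carrier M)"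
    using rtranclp_imp_relpowp[OF chain] by blast
  then obtain N where N: "N 0 = {\<zero>\<^bsub>M\<^esub>}" "N l = carrier M" "\<And>i. i < l \<Longrightarrow> covers R M (N i) (N (Suc i))"
    unfolding relpowp_fun_conv by blast
  have "submodule (N i) R M" if "i \<le> l" for i
    using that N(3)[of i] N(2) carr by (cases "i = l") (auto simp: covers_def)
  then show ?thesis
    unfolding finite_length_def using N(1,2) N(3)[unfolded covers_def]
    by (intro exI[of _ N] exI[of _ l] conjI allI impI) blast+
qed

lemma sum_lookup_single: "(\<Sum>m\<in>Poly_Mapping.keys p. Poly_Mapping.single m (Poly_Mapping.lookup p m)) = p"
  for p :: "('a::field, 'v::finite) mpol"
proof (rule poly_mapping_eqI)
  fix n
  have "Poly_Mapping.lookup (\<Sum>m\<in>Poly_Mapping.keys p. Poly_Mapping.single m (Poly_Mapping.lookup p m)) n =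
      (\<Sum>m\<in>Poly_Mapping.keys p. if m = n then Poly_Mapping.lookup p n else 0)"
    unfolding lookup_sum by (rule sum.cong) (auto simp: lookup_single when_def)
  then show "Poly_Mapping.lookup (\<Sum>m\<in>Poly_Mapping.keys p. Poly_Mapping.single m (Poly_Mapping.lookup p m)) n =
      Poly_Mapping.lookup p n"
    by (simp add: in_keys_iff)
qed

lemma monomial_step:
  fixes m :: "'v::finite \<Rightarrow>\<^sub>0 nat"
  assumes "m \<noteq> 0"
  obtains w n where "Poly_Mapping.single m (c :: 'a::field) = xvar w * Poly_Mapping.single n c"
    "mdeg m = Suc (mdeg n)"
proof -
  obtain w where w: "Poly_Mapping.lookup m w > 0"
    using assms by (metis gr0I lookup_zero poly_mapping_eqI)
  define n where "n = m - Poly_Mapping.single w 1"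
  have m: "m = Poly_Mapping.single w 1 + n"
    by (rule poly_mapping_eqI) (use w in \<open>auto simp: n_def lookup_add lookup_minus lookup_single when_def\<close>)
  show ?thesis
    by (rule that[of w n]) (simp_all add: m xvar_def mult_single mdeg_add)
qed

context graded_module
begin

lemma poly_smult:
  "x \<in> carrier M \<Longrightarrow> p \<odot> x \<in> carrier M"
  "x \<in> carrier M \<Longrightarrow> (p + q) \<odot> x = p \<odot> x \<oplus> q \<odot> x"
  "x \<in> carrier M \<Longrightarrow> (p * q) \<odot> x = p \<odot> (q \<odot> x)"
  "x \<in> carrier M \<Longrightarrow> 1 \<odot> x = x"
  "x \<in> carrier M \<Longrightarrow> 0 \<odot> x = \<zero>"
  using smult_closed[of p x] smult_l_distr[of p q x] smult_assoc1[of p q x] smult_one[of x] smult_l_null[of x]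
  by (simp_all add: ring_of_type_algebra_def)

lemma poly_smult_r:
  "x \<in> carrier M \<Longrightarrow> y \<in> carrier M \<Longrightarrow> p \<odot> (x \<oplus> y) = p \<odot> x \<oplus> p \<odot> y"
  "p \<odot> \<zero> = \<zero>"
  using smult_r_distr[of p x y] smult_r_null[of p] by (simp_all add: ring_of_type_algebra_def)

lemma poly_submoduleI:
  assumes "H \<subseteq> carrier M" "\<zero> \<in> H" "\<And>x y. x \<in> H \<Longrightarrow> y \<in> H \<Longrightarrow> x \<oplus> y \<in> H"
    "\<And>p x. x \<in> H \<Longrightarrow> p \<odot> x \<in> H"
  shows "submodule H polyring M"
proof (rule submoduleI)
  fix a assume a: "a \<in> H"
  then have aM: "a \<in> carrier M" using assms(1) by blast
  have "(-1 + 1) \<odot> a = \<zero>" using aM by (simp add: poly_smult)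
  then have "(-1) \<odot> a \<oplus> a = \<zero>"
    unfolding poly_smult(2)[OF aM] using aM by (simp add: poly_smult)
  then have "\<ominus> a = (-1) \<odot> a"
    using aM poly_smult(1)[OF aM] by (metis M.minus_equality)
  then show "\<ominus> a \<in> H" using assms(4)[OF a] by simp
qed (use assms in auto)

lemma submodule_facts:
  assumes "submodule H polyring M"
  shows "H \<subseteq> carrier M" "\<zero> \<in> H" "\<And>x y. x \<in> H \<Longrightarrow> y \<in> H \<Longrightarrow> x \<oplus> y \<in> H"
    "\<And>p x. x \<in> H \<Longrightarrow> p \<odot> x \<in> H" "\<And>x. x \<in> H \<Longrightarrow> \<ominus> x \<in> H"
  using submoduleE[OF assms] subgroup.one_closed[OF submodule.axioms(1)[OF assms]]
  by (auto simp: ring_of_type_algebra_def)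

text \<open>Adjoining the elements of \<open>S\<close> one at a time, each new quotient is generated
  by an element that all variables kill. It is zero or a one-dimensional vector space over the
  field, hence simple.\<close>

lemma covers_generated:
  assumes "finite S" "S \<subseteq> carrier M" and D: "submodule D polyring M"
    and soc: "\<And>y w. y \<in> S \<Longrightarrow> xvar w \<odot> y \<in> D"
  shows "(covers polyring M)\<^sup>*\<^sup>* D (generated_submodule polyring M (D \<union> S))"
  using assms(1,2,4)
proof (induction S)
  case empty
  have "generated_submodule polyring M D = D"
    unfolding generated_submodule_def by (rule hull_same[of "\<lambda>N. submodule N polyring M", OF D])
  then show ?case by simp
next
  case (insert y S)
  let ?X = "generated_submodule polyring M (D \<union> S)"
  let ?Y = "generated_submodule polyring M (D \<union> insert y S)"
  have XM: "D \<subseteq> carrier M" by (rule submodule_facts[OF D])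
  have subX: "submodule ?X polyring M" and subY: "submodule ?Y polyring M"
    using insert.prems XM by (auto intro!: generated_submodule)
  have XX: "D \<union> S \<subseteq> ?X" by (rule subset_generated_submodule)
  have XY: "?X \<subseteq> ?Y" by (rule generated_submodule_mono) auto
  have yM: "y \<in> carrier M" using insert.prems by simp
  have IH: "(covers polyring M)\<^sup>*\<^sup>* D ?X"
    using insert by auto
  show ?case
  proof (cases "y \<in> ?X")
    case True
    have "?Y \<subseteq> ?X"
      by (rule generated_submodule_minimal[OF subX]) (use True XX in auto)
    then have "?Y = ?X" using XY by simp
    then show ?thesis using IH by simp
  next
    case False
    define K where "K c = Poly_Mapping.single (0 :: 'v \<Rightarrow>\<^sub>0 nat) (c :: 'a)" for c
    have mono: "Poly_Mapping.single m c \<odot> y \<in> ?X" if "m \<noteq> 0" for m :: "'v \<Rightarrow>\<^sub>0 nat" and c :: 'a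
    proof -
      obtain w n where wn: "Poly_Mapping.single m c = xvar w * Poly_Mapping.single n c"
        and "mdeg m = Suc (mdeg n)"
        by (rule monomial_step[OF \<open>m \<noteq> 0\<close>])
      have "Poly_Mapping.single m c \<odot> y = Poly_Mapping.single n c \<odot> (xvar w \<odot> y)"
        unfolding wn mult.commute[of "xvar w"] by (rule poly_smult(3)[OF yM])
      moreover have "xvar w \<odot> y \<in> ?X" using insert.prems(2) XX by auto
      ultimately show ?thesis using submodule_facts(4)[OF subX] by simp
    qed
    \<comment> \<open>Modulo \<open>?X\<close> a polynomial acts on \<open>y\<close> through its
      constant coefficient, since every other monomial contains a variable.\<close>
    have reduce: "\<exists>x\<in>?X. p \<odot> y = x \<oplus> K (Poly_Mapping.lookup p 0) \<odot> y" for p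
    proof -
      have "\<exists>x\<in>?X. (\<Sum>m\<in>S. Poly_Mapping.single m (Poly_Mapping.lookup p m)) \<odot> y = x" if "finite S" "0 \<notin> S" for S
        using that
      proof (induction S)
        case empty
        then show ?case using submodule_facts(2)[OF subX] yM by (simp add: poly_smult)
      next
        case (insert m S)
        then have "m \<noteq> 0" by auto
        from mono[OF this, of "Poly_Mapping.lookup p m"] show ?case
          using insert submodule_facts(3)[OF subX] by (simp add: poly_smult(2)[OF yM])
      qed
      from this[of "Poly_Mapping.keys p - {0}"] obtain x where
        x: "x \<in> ?X" "(\<Sum>m\<in>Poly_Mapping.keys p - {0}. Poly_Mapping.single m (Poly_Mapping.lookup p m)) \<odot> y = x"
        by auto
      have "p = (\<Sum>m\<in>Poly_Mapping.keys p - {0}. Poly_Mapping.single m (Poly_Mapping.lookup p m)) + K (Poly_Mapping.lookup p 0)"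
      proof (cases "(0 :: 'v \<Rightarrow>\<^sub>0 nat) \<in> Poly_Mapping.keys p")
        case True
        then show ?thesis
          using sum_lookup_single[of p] by (simp add: K_def sum.remove add.commute)
      next
        case False
        then show ?thesis
          using sum_lookup_single[of p] by (simp add: K_def in_keys_iff)
      qed
      then have "p \<odot> y = x \<oplus> K (Poly_Mapping.lookup p 0) \<odot> y"
        using x(2) poly_smult(2)[OF yM] by metis
      then show ?thesis using x(1) by blast
    qed
    \<comment> \<open>Scalar multiples of \<open>y\<close> already suffice: \<open>?Z\<close> is
      closed under all polynomials by \<open>reduce\<close>, so it contains
      \<open>?Y\<close>.\<close>
    let ?Z = "{x \<oplus> K c \<odot> y | x c. x \<in> ?X}"
    have XM': "?X \<subseteq> carrier M" by (rule submodule_facts[OF subX])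
    have KM: "K c \<odot> y \<in> carrier M" for c using yM by (rule poly_smult)
    have Kadd: "K (a + b) \<odot> y = K a \<odot> y \<oplus> K b \<odot> y" for a b
      using poly_smult(2)[OF yM] by (simp add: K_def single_add)
    have K0: "K 0 \<odot> y = \<zero>" using yM by (simp add: K_def poly_smult)
    have "submodule ?Z polyring M"
    proof (rule poly_submoduleI)
      show "?Z \<subseteq> carrier M" using XM' KM by auto
      show "\<zero> \<in> ?Z"
      proof -
        have "\<zero> = \<zero> \<oplus> K 0 \<odot> y" by (simp add: K0)
        then show ?thesis using submodule_facts(2)[OF subX] by blast
      qed
      show "u \<oplus> v \<in> ?Z" if uv: "u \<in> ?Z" "v \<in> ?Z" for u v
      proof -
        obtain x c x' c' where *: "u = x \<oplus> K c \<odot> y" "x \<in> ?X" "v = x' \<oplus> K c' \<odot> y" "x' \<in> ?X"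
          using uv by blast
        have "u \<oplus> v = (x \<oplus> x') \<oplus> K (c + c') \<odot> y"
          unfolding *(1,3) Kadd using * XM' KM by (simp add: subset_iff M.a_ac)
        then show ?thesis using submodule_facts(3)[OF subX *(2,4)] by blast
      qed
      show "p \<odot> u \<in> ?Z" if u: "u \<in> ?Z" for p u
      proof -
        obtain x c where *: "u = x \<oplus> K c \<odot> y" "x \<in> ?X" using u by blast
        obtain x' where x': "x' \<in> ?X" "(p * K c) \<odot> y = x' \<oplus> K (Poly_Mapping.lookup (p * K c) 0) \<odot> y"
          using reduce by blast
        have px: "p \<odot> x \<in> ?X" by (rule submodule_facts(4)[OF subX *(2)])
        have "p \<odot> u = p \<odot> x \<oplus> (p * K c) \<odot> y"
          unfolding *(1) using * XM' KM yM by (simp add: poly_smult poly_smult_r subset_iff)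
        also have "\<dots> = (p \<odot> x \<oplus> x') \<oplus> K (Poly_Mapping.lookup (p * K c) 0) \<odot> y"
          unfolding x'(2) using px x'(1) XM' KM by (simp add: subset_iff M.a_assoc)
        finally show ?thesis using submodule_facts(3)[OF subX px x'(1)] by blast
      qed
    qed
    moreover have "?X \<subseteq> ?Z"
    proof
      fix x assume x: "x \<in> ?X"
      then have "x = x \<oplus> K 0 \<odot> y" using XM' by (auto simp: K0)
      then show "x \<in> ?Z" using x by blast
    qed
    moreover have "y \<in> ?Z"
    proof -
      have "y = \<zero> \<oplus> K 1 \<odot> y" using yM by (simp add: K_def poly_smult)
      then show ?thesis using submodule_facts(2)[OF subX] by blast
    qed
    ultimately have YZ: "?Y \<subseteq> ?Z"
      using XX by (intro generated_submodule_minimal) auto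
    have "covers polyring M ?X ?Y"
      unfolding covers_def
    proof (intro conjI subX subY)
      have "y \<in> ?Y" using subset_generated_submodule[of "D \<union> insert y S"] by auto
      then show "?X \<subset> ?Y" using XY False by auto
      show "\<not> (\<exists>L. submodule L polyring M \<and> ?X \<subset> L \<and> L \<subset> ?Y)"
      proof
        assume "\<exists>L. submodule L polyring M \<and> ?X \<subset> L \<and> L \<subset> ?Y"
        then obtain L where L: "submodule L polyring M" "?X \<subset> L" "L \<subset> ?Y" by blast
        then obtain z where z: "z \<in> L" "z \<notin> ?X" by blast
        then obtain x c where xc: "z = x \<oplus> K c \<odot> y" "x \<in> ?X" using L(3) YZ by blast
        have c: "c \<noteq> 0"
          using z(2) xc XM' by (auto simp: K0)
        have xL: "x \<in> L" using xc(2) L(2) by blast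
        have "K c \<odot> y = \<ominus> x \<oplus> z"
          unfolding xc(1) using xc(2) XM' KM by (simp add: subset_iff M.r_neg1)
        then have "K c \<odot> y \<in> L"
          using submodule_facts(3,5)[OF L(1)] xL z(1) by simp
        then have "K (1 / c) \<odot> (K c \<odot> y) \<in> L" by (rule submodule_facts(4)[OF L(1)])
        moreover have "K (1 / c) \<odot> (K c \<odot> y) = y"
          unfolding poly_smult(3)[OF yM, symmetric] using c yM by (simp add: K_def mult_single poly_smult)
        ultimately have "y \<in> L" by simp
        then have "?Y \<subseteq> L"
          using XX L(2) by (intro generated_submodule_minimal[OF L(1)]) auto
        then show False using L(3) by blast
      qed
    qed
    with IH show ?thesis by (rule rtranclp.rtrancl_into_rtrancl)
  qed
qed

section \<open>Graded presentations\<close>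

lemma grade_facts:
  "grade M j \<subseteq> carrier M" "\<zero> \<in> grade M j"
  "x \<in> grade M j \<Longrightarrow> y \<in> grade M j \<Longrightarrow> x \<oplus> y \<in> grade M j"
  using subgroup.subset[OF grade_subgroup[of j]] subgroup.one_closed[OF grade_subgroup[of j]]
    subgroup.m_closed[OF grade_subgroup[of j]] by auto

text \<open>Directness of the grading with one common finite index set instead of the exact
  supports, which may differ between the two families.\<close>

lemma grade_family_unique:
  assumes "\<And>j. c j \<in> grade M j" "\<And>j. c' j \<in> grade M j" "finite L"
    "\<And>j. j \<notin> L \<Longrightarrow> c j = \<zero>" "\<And>j. j \<notin> L \<Longrightarrow> c' j = \<zero>" "finsum M c L = finsum M c' L"
  shows "c = c'"
proof -
  have red: "finsum M a L = finsum M a {j. a j \<noteq> \<zero>}" "finite {j. a j \<noteq> \<zero>}"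
    if "\<And>j. a j \<in> grade M j" "\<And>j. j \<notin> L \<Longrightarrow> a j = \<zero>" for a
  proof -
    have sub: "{j. a j \<noteq> \<zero>} \<subseteq> L" using that(2) by blast
    have carr: "a \<in> D \<rightarrow> carrier M" for D
      using that(1) grade_facts(1) by blast
    show "finsum M a L = finsum M a {j. a j \<noteq> \<zero>}"
      by (rule M.add.finprod_mono_neutral_cong_right) (use sub assms(3) carr in auto)
    show "finite {j. a j \<noteq> \<zero>}"
      using sub assms(3) by (rule finite_subset)
  qed
  have "finsum M c L \<in> carrier M"
    using assms(1) grade_facts(1) by (intro M.finsum_closed) blast
  from grade_direct_sum[OF this] show ?thesis
    using assms red[of c] red[of c'] by (metis (no_types, lifting))
qed

end

locale generated_graded_module = graded_module M
  for M :: "(('a::field, 'v::finite) mpol, 'm) graded_module" (structure) +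
  fixes r :: nat and g :: "nat \<Rightarrow> 'm"
  assumes g: "k < r \<Longrightarrow> g k \<in> grade M 0"
    and gen: "generated_submodule polyring M (g ` {..<r}) = carrier M"
begin

definition \<pi> :: "(nat \<Rightarrow> ('a, 'v) mpol) \<Rightarrow> 'm" where "\<pi> = augmentation M r g"

lemma gM: "k < r \<Longrightarrow> g k \<in> carrier M"
  using g grade_facts(1) by blast

lemma \<pi>_carr: "\<pi> v \<in> carrier M"
  unfolding \<pi>_def augmentation_def using gM by (intro M.finsum_closed) (auto simp: poly_smult)

lemma \<pi>_add: "\<pi> (u + v) = \<pi> u \<oplus> \<pi> v"
proof -
  have "\<pi> (u + v) = (\<Oplus>k\<in>{..<r}. u k \<odot> g k \<oplus> v k \<odot> g k)"
    unfolding \<pi>_def augmentation_def using gM by (intro M.finsum_cong') (auto simp: poly_smult)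
  also have "\<dots> = \<pi> u \<oplus> \<pi> v"
    unfolding \<pi>_def augmentation_def using gM by (intro M.finsum_addf) (auto simp: poly_smult)
  finally show ?thesis .
qed

lemma \<pi>_scale: "\<pi> (vscale p v) = p \<odot> \<pi> v"
proof -
  have "p \<odot> \<pi> v = (\<Oplus>k\<in>{..<r}. p \<odot> (v k \<odot> g k))"
    unfolding \<pi>_def augmentation_def using gM
    by (intro finsum_smult_ldistr) (auto simp: poly_smult ring_of_type_algebra_def)
  also have "\<dots> = \<pi> (vscale p v)"
    unfolding \<pi>_def augmentation_def using gM by (intro M.finsum_cong') (auto simp: poly_smult)
  finally show ?thesis by simp
qed

lemma \<pi>_0: "\<pi> 0 = \<zero>"
  using \<pi>_scale[of 0 0] poly_smult(5)[OF \<pi>_carr[of 0]] by (simp only: vm.scale_zero_left)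

lemma \<pi>_eq_iff: "\<pi> u = \<pi> v \<longleftrightarrow> \<pi> (u - v) = \<zero>"
proof -
  have "\<pi> u = \<pi> (u - v) \<oplus> \<pi> v"
    using \<pi>_add[of "u - v" v] by (simp only: diff_add_cancel)
  then show ?thesis
    using \<pi>_carr by (metis M.add.r_cancel_one)
qed

lemma \<pi>_basis:
  assumes "k < r"
  shows "\<pi> (basis k) = g k"
proof -
  have "\<pi> (basis k) = (\<Oplus>i\<in>{..<r}. if k = i then g i else \<zero>)"
    unfolding \<pi>_def augmentation_def using gM by (intro M.finsum_cong') (auto simp: basis_def poly_smult)
  also have "\<dots> = g k"
    using assms gM by (intro M.finsum_singleton) auto
  finally show ?thesis .
qed

lemma \<pi>_sum: "\<pi> (sum f S) = finsum M (\<lambda>x. \<pi> (f x)) S" if "finite S"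
  using that
proof (induction S)
  case empty
  then show ?case using \<pi>_0 by (simp only: sum.empty M.finsum_empty)
next
  case (insert x S)
  then show ?case
    unfolding sum.insert[OF insert(1,2)] \<pi>_add insert.IH using insert(1,2) \<pi>_carr
    by (intro M.finsum_insert[symmetric]) auto
qed

lemma submodule_image:
  assumes "vm.subspace W"
  shows "submodule (\<pi> ` W) polyring M"
proof (rule poly_submoduleI)
  show "\<pi> ` W \<subseteq> carrier M" using \<pi>_carr by blast
  show "\<zero> \<in> \<pi> ` W" using vm.subspace_0[OF assms] \<pi>_0 by (metis imageI)
  show "x \<oplus> y \<in> \<pi> ` W" if "x \<in> \<pi> ` W" "y \<in> \<pi> ` W" for x y
    using that vm.subspace_add[OF assms] \<pi>_add by (smt (verit) imageE imageI)
  show "p \<odot> x \<in> \<pi> ` W" if "x \<in> \<pi> ` W" for p x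
    using that vm.subspace_scale[OF assms] \<pi>_scale by (smt (verit) imageE imageI)
qed

lemma subspace_preimage:
  assumes "submodule N polyring M"
  shows "vm.subspace {v \<in> free_carrier r. \<pi> v \<in> N}"
  using submodule_facts[OF assms] subspace_free_carrier[of r]
  unfolding vm.subspace_def mem_Collect_eq \<pi>_add \<pi>_scale \<pi>_0 by blast

lemma \<pi>_onto: "\<pi> ` free_carrier r = carrier M"
proof
  show "\<pi> ` free_carrier r \<subseteq> carrier M" using \<pi>_carr by blast
  have "g ` {..<r} \<subseteq> \<pi> ` free_carrier r"
  proof
    fix y assume "y \<in> g ` {..<r}"
    then obtain k where "k < r" "y = g k" by blast
    then show "y \<in> \<pi> ` free_carrier r"
      using \<pi>_basis[of k] basis_free[of k r] by (metis imageI)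
  qed
  then show "carrier M \<subseteq> \<pi> ` free_carrier r"
    using generated_submodule_minimal[OF submodule_image[OF subspace_free_carrier]] gen by metis
qed

lemma \<pi>_gr: "v \<in> gr r zdeg j \<Longrightarrow> \<pi> v \<in> grade M j"
proof -
  assume v: "v \<in> gr r zdeg j"
  have "finsum M (\<lambda>k. v k \<odot> g k) S \<in> grade M j" if "finite S" "S \<subseteq> {..<r}" for S
    using that
  proof (induction S)
    case (insert k S)
    have "v k \<odot> g k \<in> grade M (j + 0)"
      using v insert.prems g by (intro grade_smult) (auto simp: gr_iff zdeg_def)
    moreover have "(\<lambda>k. v k \<odot> g k) \<in> S \<rightarrow> carrier M" "v k \<odot> g k \<in> carrier M"
      using insert.prems gM by (auto simp: poly_smult subset_iff)
    ultimately show ?case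
      using insert grade_facts(3) by (simp add: M.finsum_insert)
  qed (simp add: grade_facts)
  then show ?thesis unfolding \<pi>_def augmentation_def by simp
qed

text \<open>The images of the components of \<open>v\<close> and the family concentrated in degree
  \<open>i\<close> both decompose the same element, so they coincide. Hence the kernel of
  \<open>\<pi>\<close> is homogeneous and homogeneous elements have homogeneous preimages.\<close>

lemma \<pi>_vcomp:
  assumes v: "v \<in> free_carrier r" and x: "\<pi> v \<in> grade M i"
  shows "\<pi> (vcomp zdeg j v) = (if j = i then \<pi> v else \<zero>)"
proof -
  obtain L where L: "finite L" "v = (\<Sum>l\<in>L. vcomp zdeg l v)" using sum_vcomp[OF v] by blast
  define c where "c l = (if l \<in> L then \<pi> (vcomp zdeg l v) else \<zero>)" for l
  have c_eq: "c l = \<pi> (vcomp zdeg l v)" for l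
  proof (cases "l \<in> L")
    case False
    have "vcomp zdeg l v = (\<Sum>l'\<in>L. vcomp zdeg l (vcomp zdeg l' v))"
      using arg_cong[OF L(2), of "vcomp zdeg l"] by (simp only: vcomp_sum)
    also have "\<dots> = 0"
      using False vcomp_gr[OF vcomp_in_gr[OF v]] by (intro sum.neutral) auto
    finally show ?thesis using False \<pi>_0 by (simp only: c_def if_False)
  qed (simp add: c_def)
  define c' where "c' l = (if l = i then \<pi> v else \<zero>)" for l
  have cg: "c l \<in> grade M l" for l
    using \<pi>_gr[OF vcomp_in_gr[OF v]] by (simp add: c_eq)
  have carr: "c l \<in> carrier M" for l using cg grade_facts(1) by blast
  have "c = c'"
  proof (rule grade_family_unique[of _ _ "insert i L"])
    show "c l \<in> grade M l" for l by (rule cg)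
    show "c' l \<in> grade M l" for l using x grade_facts(2) by (simp add: c'_def)
    show "c l = \<zero>" if "l \<notin> insert i L" for l using that by (simp add: c_def)
    have "finsum M c (insert i L) = finsum M c L"
      by (rule M.add.finprod_mono_neutral_cong_right) (use L(1) carr in \<open>auto simp: c_def \<pi>_carr\<close>)
    also have "\<dots> = finsum M (\<lambda>l. \<pi> (vcomp zdeg l v)) L"
      using \<pi>_carr by (intro M.finsum_cong') (auto simp: c_eq)
    also have "\<dots> = \<pi> v"
      using \<pi>_sum[OF L(1), of "\<lambda>l. vcomp zdeg l v"] L(2) by metis
    also have "\<dots> = (\<Oplus>l\<in>insert i L. if i = l then \<pi> v else \<zero>)"
      by (rule M.finsum_singleton[symmetric]) (use L(1) \<pi>_carr in auto)
    also have "\<dots> = finsum M c' (insert i L)"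
      using \<pi>_carr by (intro M.finsum_cong') (auto simp: c'_def)
    finally show "finsum M c (insert i L) = finsum M c' (insert i L)" .
  qed (use L(1) in \<open>auto simp: c'_def\<close>)
  then show ?thesis using c_eq[of j] by (simp add: c'_def)
qed

lemma \<pi>_gr_onto: "\<pi> ` gr r zdeg j = grade M j"
proof
  show "\<pi> ` gr r zdeg j \<subseteq> grade M j" using \<pi>_gr by blast
  show "grade M j \<subseteq> \<pi> ` gr r zdeg j"
  proof
    fix x assume x: "x \<in> grade M j"
    then obtain v where v: "v \<in> free_carrier r" "x = \<pi> v"
      using grade_facts(1) \<pi>_onto by blast
    then show "x \<in> \<pi> ` gr r zdeg j"
      using \<pi>_vcomp[OF v(1), of j j] vcomp_in_gr[OF v(1), of zdeg j] x
      by (intro image_eqI[of _ _ "vcomp zdeg j v"]) auto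
  qed
qed

definition U :: "(nat \<Rightarrow> ('a, 'v) mpol) set" where "U = {v \<in> free_carrier r. \<pi> v = \<zero>}"

lemma hsub_U: "hsub r zdeg U"
  unfolding hsub_def
proof (intro conjI ballI allI)
  have "submodule {\<zero>} polyring M"
    by (rule poly_submoduleI) (auto simp: poly_smult_r)
  from subspace_preimage[OF this] show "vm.subspace U" by (simp add: U_def)
  show "U \<subseteq> free_carrier r" by (auto simp: U_def)
  fix u j assume "u \<in> U"
  then have u: "u \<in> free_carrier r" "\<pi> u = \<zero>" by (auto simp: U_def)
  have "\<pi> (vcomp zdeg j u) = \<zero>"
    using \<pi>_vcomp[OF u(1), of j j] u(2) grade_facts(2) by simp
  then show "vcomp zdeg j u \<in> U"
    using vcomp_in_gr[OF u(1), of zdeg j] gr_subset[of r zdeg j] by (auto simp: U_def)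
qed

lemma \<pi>_eq_U: "u \<in> free_carrier r \<Longrightarrow> v \<in> free_carrier r \<Longrightarrow> \<pi> u = \<pi> v \<longleftrightarrow> u - v \<in> U"
  using vm.subspace_diff[OF subspace_free_carrier, of u r v] by (simp add: U_def \<pi>_eq_iff)

text \<open>If \<open>M\<close> vanished in degree \<open>j\<close>, the submodules generated by all
  multiples of the generators with monomials of degree 0, 1, ... would descend from \<open>M\<close>
  to zero in \<open>j\<close> steps. Each step refines to finitely many simple quotients by
  \<open>covers_generated\<close>, so \<open>M\<close> would have finite length.\<close>

lemma gr_not_subset_U:
  assumes infinite: "\<not> finite_length polyring M" and j: "j \<ge> 0"
  shows "\<not> gr r zdeg j \<subseteq> U"
proof
  assume sub: "gr r zdeg j \<subseteq> U"
  define S where "S i = (\<lambda>(k, m). \<pi> (vscale (Poly_Mapping.single m 1) (basis k))) ` ({..<r} \<times> {m :: 'v \<Rightarrow>\<^sub>0 nat. mdeg m = i})" for i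
  have finS: "finite (S i)" for i
  proof -
    have "finite {m :: 'v \<Rightarrow>\<^sub>0 nat. mdeg m = i}"
      by (rule finite_subset[OF _ finite_mdeg_le[of i]]) auto
    then show ?thesis unfolding S_def by blast
  qed
  have SM: "S i \<subseteq> carrier M" for i unfolding S_def using \<pi>_carr by auto
  let ?W = "\<lambda>i. generated_submodule polyring M (S i)"
  have subW: "submodule (?W i) polyring M" for i by (rule generated_submodule[OF SM])
  have step: "xvar w \<odot> y \<in> ?W (Suc i)" if "y \<in> S i" for w y i
  proof -
    obtain k m where km: "k < r" "mdeg m = i" "y = \<pi> (vscale (Poly_Mapping.single m 1) (basis k))"
      using \<open>y \<in> S i\<close> by (auto simp: S_def)
    have "xvar w \<odot> y = \<pi> (vscale (Poly_Mapping.single (Poly_Mapping.single w 1 + m) 1) (basis k))"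
      unfolding km(3) \<pi>_scale[symmetric] vm.scale_scale xvar_def mult_single by simp
    moreover have "mdeg (Poly_Mapping.single w 1 + m) = Suc i"
      using km(2) by (simp add: mdeg_add)
    ultimately have "xvar w \<odot> y \<in> S (Suc i)"
      unfolding S_def using km(1) by (intro image_eqI[of _ _ "(k, Poly_Mapping.single w 1 + m)"]) auto
    then show ?thesis by (rule subsetD[OF subset_generated_submodule])
  qed
  have mono: "?W (Suc i) \<subseteq> ?W i" for i
  proof (rule generated_submodule_minimal[OF subW])
    show "S (Suc i) \<subseteq> ?W i"
    proof
      fix y assume "y \<in> S (Suc i)"
      then obtain k m where km: "k < r" "mdeg m = Suc i" "y = \<pi> (vscale (Poly_Mapping.single m 1) (basis k))"
        by (auto simp: S_def)
      then have "m \<noteq> 0" by auto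
      then obtain w n where wn: "Poly_Mapping.single m (1::'a) = xvar w * Poly_Mapping.single n 1" "mdeg m = Suc (mdeg n)"
        by (rule monomial_step)
      have "y = xvar w \<odot> \<pi> (vscale (Poly_Mapping.single n 1) (basis k))"
        unfolding km(3) wn(1) \<pi>_scale[symmetric] vm.scale_scale by simp
      moreover have "\<pi> (vscale (Poly_Mapping.single n 1) (basis k)) \<in> S i"
        using km wn by (auto simp: S_def)
      ultimately show "y \<in> ?W i"
        using submodule_facts(4)[OF subW] subsetD[OF subset_generated_submodule] by metis
    qed
  qed
  have cov: "(covers polyring M)\<^sup>*\<^sup>* (?W (Suc i)) (?W i)" for i
  proof -
    have "(covers polyring M)\<^sup>*\<^sup>* (?W (Suc i)) (generated_submodule polyring M (?W (Suc i) \<union> S i))"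
      by (rule covers_generated[OF finS SM subW step])
    moreover have "generated_submodule polyring M (?W (Suc i) \<union> S i) = ?W i"
    proof
      show "generated_submodule polyring M (?W (Suc i) \<union> S i) \<subseteq> ?W i"
        using mono[of i] subset_generated_submodule[of "S i"]
        by (intro generated_submodule_minimal[OF subW]) auto
      show "?W i \<subseteq> generated_submodule polyring M (?W (Suc i) \<union> S i)"
        by (rule generated_submodule_mono) auto
    qed
    ultimately show ?thesis by simp
  qed
  have chain: "(covers polyring M)\<^sup>*\<^sup>* (?W i) (?W 0)" for i
  proof (induction i)
    case (Suc i)
    then show ?case using cov[of i] by (rule rtranclp_trans[rotated])
  qed simp
  have "?W 0 = carrier M"
  proof
    show "?W 0 \<subseteq> carrier M" using submodule_facts(1)[OF subW] .
    have "g ` {..<r} \<subseteq> S 0"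
    proof
      fix y assume "y \<in> g ` {..<r}"
      then obtain k where k: "k < r" "y = g k" by blast
      then have "y = \<pi> (vscale (Poly_Mapping.single 0 1) (basis k))"
        using \<pi>_basis by simp
      then show "y \<in> S 0" unfolding S_def using k(1) by (intro image_eqI[of _ _ "(k, 0)"]) auto
    qed
    then show "carrier M \<subseteq> ?W 0"
      unfolding gen[symmetric] by (rule generated_submodule_mono)
  qed
  moreover have "?W (nat j) = {\<zero>}"
  proof
    have "S (nat j) \<subseteq> {\<zero>}"
    proof
      fix y assume "y \<in> S (nat j)"
      then obtain k m where km: "k < r" "mdeg m = nat j" "y = \<pi> (vscale (Poly_Mapping.single m 1) (basis k))"
        by (auto simp: S_def)
      have "basis k \<in> gr r zdeg 0"
        using km(1) by (auto simp: gr_iff basis_def zdeg_def forms_iff lookup_one when_def)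
      then have "vscale (Poly_Mapping.single m 1) (basis k) \<in> gr r zdeg j"
        using gr_scale[OF single_in_forms, of "basis k" r zdeg 0 m 1] km(2) j by simp
      then show "y \<in> {\<zero>}" using sub km(3) by (auto simp: U_def)
    qed
    moreover have "submodule {\<zero>} polyring M"
      by (rule poly_submoduleI) (auto simp: poly_smult_r)
    ultimately show "?W (nat j) \<subseteq> {\<zero>}" by (intro generated_submodule_minimal)
    show "{\<zero>} \<subseteq> ?W (nat j)" using submodule_facts(2)[OF subW] by simp
  qed
  ultimately have "finite_length polyring M"
    using chain[of "nat j"] carrier_is_submodule by (intro finite_length_if_covers) auto
  then show False using infinite by simp
qed

end

section \<open>From composition series to vanishing in large degrees\<close>

lemma (in presented) submodule_image:
  assumes W: "vm.subspace W" "W \<subseteq> B"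
  shows "submodule (\<pi> ` W) polyring N"
proof (rule submodule.intro)
  interpret N: abelian_group N by (rule abelian)
  have carr: "\<pi> w \<in> carrier N" if "w \<in> W" for w
    using that W(2) \<pi>_carrier by blast
  have zero: "\<pi> 0 = \<zero>"
    using \<pi>_zero[of 0] vm.subspace_0[OF subB] A vm.subspace_0[of A] by (simp add: hsub_def)
  show "subgroup (\<pi> ` W) (add_monoid N)"
  proof (rule N.add.subgroupI)
    show "\<pi> ` W \<subseteq> carrier N" using carr by blast
    show "\<pi> ` W \<noteq> {}" using vm.subspace_0[OF W(1)] by blast
    show "\<ominus> a \<in> \<pi> ` W" if "a \<in> \<pi> ` W" for a
    proof -
      obtain w where w: "w \<in> W" "a = \<pi> w" using \<open>a \<in> \<pi> ` W\<close> by blast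
      have nw: "- w \<in> W" by (rule vm.subspace_neg[OF W(1) w(1)])
      have "\<pi> (- w) \<oplus> \<pi> w = \<zero>"
        using \<pi>_add[of "- w" w] w(1) nw W(2) zero by (simp only: subset_iff ab_left_minus)
      then have "\<ominus> a = \<pi> (- w)"
        using N.minus_equality carr w nw by simp
      then show ?thesis using nw by simp
    qed
    show "a \<oplus> b \<in> \<pi> ` W" if "a \<in> \<pi> ` W" "b \<in> \<pi> ` W" for a b
    proof -
      obtain v w where "v \<in> W" "a = \<pi> v" "w \<in> W" "b = \<pi> w"
        using \<open>a \<in> \<pi> ` W\<close> \<open>b \<in> \<pi> ` W\<close> by blast
      then show ?thesis
        using \<pi>_add[of v w] W(2) vm.subspace_add[OF W(1)] by (metis imageI subsetD)
    qed
  qed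
  show "submodule_axioms (\<pi> ` W) polyring N"
  proof
    fix a x assume "x \<in> \<pi> ` W"
    then obtain w where "w \<in> W" "x = \<pi> w" by blast
    then show "a \<odot> x \<in> \<pi> ` W"
      using \<pi>_scale[of w a] W(2) vm.subspace_scale[OF W(1)] by (metis imageI subsetD)
  qed
qed

text \<open>Preimages under \<open>\<pi>\<close> turn a composition series of \<open>N\<close> into
  a chain from \<open>A\<close> to \<open>B\<close> that admits no submodule strictly between
  neighbours.\<close>

lemma (in presented) finite_length_chain:
  assumes "finite_length polyring N"
  shows "\<exists>L l. L 0 = A \<and> L l = B \<and> (\<forall>i\<le>l. vm.subspace (L i)) \<and> (\<forall>i<l. L i \<subseteq> L (Suc i) \<and>
    (\<forall>W. vm.subspace W \<longrightarrow> L i \<subseteq> W \<longrightarrow> W \<subseteq> L (Suc i) \<longrightarrow> W = L i \<or> W = L (Suc i)))"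
proof -
  obtain P l where P0: "P 0 = {\<zero>}" "P l = carrier N" "\<forall>i\<le>l. submodule (P i) polyring N"
    "\<forall>i<l. P i \<subset> P (Suc i) \<and> \<not> (\<exists>L. submodule L polyring N \<and> P i \<subset> L \<and> L \<subset> P (Suc i))"
    using assms unfolding finite_length_def by (elim exE conjE)
  then have P: "P 0 = {\<zero>}" "P l = carrier N" "\<And>i. i \<le> l \<Longrightarrow> submodule (P i) polyring N"
    by simp_all
  have P_simple: "Q = P i \<or> Q = P (Suc i)"
    if "i < l" "submodule Q polyring N" "P i \<subseteq> Q" "Q \<subseteq> P (Suc i)" for i Q
  proof (rule ccontr)
    assume "\<not> (Q = P i \<or> Q = P (Suc i))"
    then have "P i \<subset> Q" "Q \<subset> P (Suc i)" using that by auto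
    then show False using P0(4) that by blast
  qed
  define L where "L i = {v \<in> B. \<pi> v \<in> P i}" for i
  have zero: "\<pi> 0 = \<zero>"
    using \<pi>_zero[of 0] vm.subspace_0[OF subB] A vm.subspace_0[of A] by (simp add: hsub_def)
  have PN: "P i \<subseteq> carrier N" "\<zero> \<in> P i" "\<And>x y. x \<in> P i \<Longrightarrow> y \<in> P i \<Longrightarrow> x \<oplus> y \<in> P i"
    "\<And>p x. x \<in> P i \<Longrightarrow> p \<odot> x \<in> P i" if "i \<le> l" for i
    using subgroup.subset[OF submodule.axioms(1)[OF P(3)[OF that]]]
      subgroup.one_closed[OF submodule.axioms(1)[OF P(3)[OF that]]]
      subgroup.m_closed[OF submodule.axioms(1)[OF P(3)[OF that]]]
      submodule.smult_closed[OF P(3)[OF that]]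
    by (simp_all add: ring_of_type_algebra_def)
  show ?thesis
  proof (rule exI[of _ L], rule exI[of _ l], intro conjI allI impI)
    show "L 0 = A" using \<pi>_zero AB by (auto simp: L_def P(1))
    show "L l = B" using \<pi>_carrier by (auto simp: L_def P(2))
    show sub: "vm.subspace (L i)" if "i \<le> l" for i
    proof (rule vm.subspaceI)
      show "0 \<in> L i" using PN(2)[OF that] zero vm.subspace_0[OF subB] by (simp only: L_def mem_Collect_eq simp_thms)
      show "x + y \<in> L i" if "x \<in> L i" "y \<in> L i" for x y
        using that PN(3)[OF \<open>i \<le> l\<close>] vm.subspace_add[OF subB] by (simp add: L_def \<pi>_add)
      show "vscale c x \<in> L i" if "x \<in> L i" for c x
        using that PN(4)[OF \<open>i \<le> l\<close>] vm.subspace_scale[OF subB] by (simp add: L_def \<pi>_scale)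
    qed
    show "L i \<subseteq> L (Suc i)" if "i < l" for i
      using P0(4) that by (auto simp: L_def)
    fix i W assume i: "i < l" and W: "vm.subspace W" "L i \<subseteq> W" "W \<subseteq> L (Suc i)"
    have WB: "W \<subseteq> B" using W(3) by (auto simp: L_def)
    have lower: "P i \<subseteq> \<pi> ` W"
    proof
      fix x assume x: "x \<in> P i"
      then obtain v where "v \<in> B" "x = \<pi> v" using PN(1)[of i] i \<pi>_carrier by force
      then show "x \<in> \<pi> ` W" using x W(2) by (auto simp: L_def)
    qed
    have upper: "\<pi> ` W \<subseteq> P (Suc i)" using W(3) by (auto simp: L_def)
    have AW: "A \<subseteq> W"
    proof
      fix a assume "a \<in> A"
      then have "a \<in> B" "\<pi> a = \<zero>" using AB \<pi>_zero by auto
      then show "a \<in> W" using PN(2)[of i] i W(2) by (auto simp: L_def)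
    qed
    \<comment> \<open>\<open>W\<close> contains the kernel \<open>A\<close>, so it is determined by
      its image and simplicity can be applied there.\<close>
    have W_eq: "W = {v \<in> B. \<pi> v \<in> \<pi> ` W}"
    proof (intro equalityI subsetI)
      fix v assume "v \<in> {v \<in> B. \<pi> v \<in> \<pi> ` W}"
      then obtain w where w: "v \<in> B" "w \<in> W" "\<pi> v = \<pi> w" by blast
      then have "v - w \<in> W" using \<pi>_eq[of v w] WB AW by blast
      from vm.subspace_add[OF W(1) this w(2)] show "v \<in> W" by (simp only: diff_add_cancel)
    qed (use WB in auto)
    have "\<pi> ` W = P i \<or> \<pi> ` W = P (Suc i)"
      by (rule P_simple[OF i submodule_image[OF W(1) WB] lower upper])
    then show "W = L i \<or> W = L (Suc i)"
      using W_eq unfolding L_def by metis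
  qed
qed

context ideal_powers
begin

text \<open>The chain need not be homogeneous, so it is compared with the filtration
  \<open>D\<close> by lowest occurring degree. Induction along the chain shows that, for large
  \<open>j\<close>, an element of order \<ge> \<open>j\<close> agrees modulo \<open>J 1\<close> with
  one of order > \<open>j\<close>. For a form of degree \<open>j\<close> the component of degree
  \<open>j\<close> then lies in \<open>J 1\<close>, which is homogeneous.\<close>

lemma eventually_full_if_chain:
  assumes L0: "L 0 = J 1" and Ll: "L l = free_carrier r" and sub: "\<And>i. i \<le> l \<Longrightarrow> vm.subspace (L i)"
    and simple: "\<And>i W. \<lbrakk>i < l; vm.subspace W; L i \<subseteq> W; W \<subseteq> L (Suc i)\<rbrakk> \<Longrightarrow> W = L i \<or> W = L (Suc i)"
    and mono: "\<And>i. i < l \<Longrightarrow> L i \<subseteq> L (Suc i)"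
  shows "\<exists>j1. \<forall>j\<ge>j1. V j \<subseteq> J 1"
proof -
  define D :: "int \<Rightarrow> (nat \<Rightarrow> ('a, 'v) mpol) set" where "D j = {v \<in> free_carrier r. \<forall>i<j. vcomp zdeg i v = 0}" for j :: int
  have subD: "vm.subspace (D j)" for j
  proof (rule vm.subspaceI)
    show "0 \<in> D j"
      using vm.subspace_0[OF subspace_free_carrier[of r]] unfolding D_def mem_Collect_eq
      by (metis vcomp_zero)
    show "x + y \<in> D j" if "x \<in> D j" "y \<in> D j" for x y
      using that vm.subspace_add[OF subspace_free_carrier[of r]]
      unfolding D_def mem_Collect_eq vcomp_add by (metis add_0_left)
    show "vscale c x \<in> D j" if x: "x \<in> D j" for c x
    proof -
      have "vcomp zdeg i (vscale c x) = 0" if "i < j" for i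
      proof -
        have "vcomp zdeg i (vscale c x) =
          (\<Sum>l\<in>(\<lambda>m. int (mdeg m)) ` Poly_Mapping.keys c. vscale (hcomp l c) (vcomp zdeg (i - l) x))"
          by (rule vcomp_eq_sum) (auto simp: in_keys_iff)
        also have "\<dots> = 0"
        proof (intro sum.neutral ballI)
          fix l assume "l \<in> (\<lambda>m. int (mdeg m)) ` Poly_Mapping.keys c"
          then have "i - l < j" using that by auto
          then have "vcomp zdeg (i - l) x = 0" using x by (simp only: D_def mem_Collect_eq)
          then show "vscale (hcomp l c) (vcomp zdeg (i - l) x) = 0" by (simp only: vm.scale_zero_right)
        qed
        finally show ?thesis .
      qed
      then show ?thesis
        using x vm.subspace_scale[OF subspace_free_carrier[of r]] unfolding D_def mem_Collect_eq by blast
    qed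
  qed
  have D_anti: "D j \<subseteq> D i" if "i \<le> j" for i j using that by (auto simp: D_def)
  let ?S = "\<lambda>j. {a + b | a b. a \<in> D (j + 1) \<and> b \<in> L 0}"
  have "\<exists>j0. \<forall>j\<ge>j0. D j \<inter> L i \<subseteq> ?S j" if "i \<le> l" for i
    using that
  proof (induction i)
    case 0
    have "L 0 \<subseteq> ?S j" for j
    proof
      fix x assume "x \<in> L 0"
      moreover have "x = 0 + x" by simp
      ultimately show "x \<in> ?S j" using vm.subspace_0[OF subD[of "j + 1"]] by blast
    qed
    then show ?case by blast
  next
    case (Suc i)
    then have "i \<le> l" by simp
    from Suc.IH[OF this] obtain j0 where "\<forall>j\<ge>j0. D j \<inter> L i \<subseteq> ?S j" by (elim exE)
    then have j0: "\<And>j. j \<ge> j0 \<Longrightarrow> D j \<inter> L i \<subseteq> ?S j" by (elim allE impE)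
    have il: "i < l" using Suc.prems by simp
    show ?case
    proof (cases "\<exists>j'. D j' \<inter> L (Suc i) \<subseteq> L i")
      case True
      then obtain j' where j': "D j' \<inter> L (Suc i) \<subseteq> L i" by blast
      have "D j \<inter> L (Suc i) \<subseteq> ?S j" if "j \<ge> max j0 j'" for j
        using that j0[of j] j' D_anti[of j' j] by auto
      then show ?thesis by blast
    next
      \<comment> \<open>Elements of \<open>L (Suc i)\<close> of arbitrarily high order escape
        \<open>L i\<close>. By simplicity those of order > \<open>j\<close> together with
        \<open>L i\<close> make up all of \<open>L (Suc i)\<close>, so \<open>x\<close> can be
        reduced to an element of \<open>L i\<close>.\<close>
      case False
      have "D j \<inter> L (Suc i) \<subseteq> ?S j" if j: "j \<ge> j0" for j
      proof
        fix x assume x: "x \<in> D j \<inter> L (Suc i)"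
        let ?W = "{a + b | a b. a \<in> D (j + 1) \<inter> L (Suc i) \<and> b \<in> L i}"
        have "vm.subspace ?W"
          using subD sub[of i] sub[of "Suc i"] il by (intro subspace_sums vm.subspace_inter) auto
        moreover have LW: "L i \<subseteq> ?W"
        proof
          fix b assume "b \<in> L i"
          moreover have "b = 0 + b" by simp
          moreover have "0 \<in> D (j + 1) \<inter> L (Suc i)"
            using vm.subspace_0[OF subD[of "j + 1"]] vm.subspace_0[OF sub[OF Suc.prems]] by (rule IntI)
          ultimately show "b \<in> ?W" by blast
        qed
        moreover have "?W \<subseteq> L (Suc i)"
        proof
          fix w assume "w \<in> ?W"
          then obtain a b where "w = a + b" "a \<in> L (Suc i)" "b \<in> L (Suc i)"
            using mono[OF il] by blast
          then show "w \<in> L (Suc i)" using vm.subspace_add[OF sub[of "Suc i"]] il by simp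
        qed
        moreover have "?W \<noteq> L i"
        proof
          assume W: "?W = L i"
          have "D (j + 1) \<inter> L (Suc i) \<subseteq> ?W"
          proof
            fix a assume "a \<in> D (j + 1) \<inter> L (Suc i)"
            moreover have "a = a + 0" by simp
            moreover have "0 \<in> L i" using vm.subspace_0[OF sub[of i]] il by simp
            ultimately show "a \<in> ?W" by blast
          qed
          then show False using W False by blast
        qed
        ultimately have "?W = L (Suc i)" using simple[OF il] by blast
        then obtain a b where ab: "x = a + b" "a \<in> D (j + 1)" "b \<in> L i" using x by blast
        \<comment> \<open>The correction \<open>a\<close> has higher order than \<open>j\<close>, so
          \<open>b\<close> still has order \<ge> \<open>j\<close> and the induction hypothesis
          applies to it.\<close>
        have "b = x - a" using ab(1) by simp
        then have "b \<in> D j" using vm.subspace_diff[OF subD[of j], of x a] x ab(2) D_anti[of j "j + 1"] by auto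
        then obtain a' b' where ab': "b = a' + b'" "a' \<in> D (j + 1)" "b' \<in> L 0"
          using j0[OF j] ab(3) by blast
        have "x = (a + a') + b'" using ab(1) ab'(1) by (simp add: add.assoc)
        moreover have "a + a' \<in> D (j + 1)" by (rule vm.subspace_add[OF subD ab(2) ab'(2)])
        ultimately show "x \<in> ?S j" using ab'(3) by blast
      qed
      then show ?thesis by blast
    qed
  qed
  from this[OF order_refl] obtain j0 where j0: "\<And>j. j \<ge> j0 \<Longrightarrow> D j \<inter> L l \<subseteq> ?S j" by blast
  have "V j \<subseteq> J 1" if j: "j \<ge> j0" for j
  proof
    fix v assume v: "v \<in> V j"
    have vfree: "v \<in> free_carrier r" using v gr_subset by blast
    have "vcomp zdeg i v = 0" if "i < j" for i
      using vcomp_gr[OF v, of i] that by (simp only: if_False less_irrefl) simp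
    then have "v \<in> D j" using vfree by (simp only: D_def mem_Collect_eq simp_thms) simp
    then obtain a b where ab: "v = a + b" "a \<in> D (j + 1)" "b \<in> J 1"
      using j0[OF j] vfree Ll L0 by blast
    have "vcomp zdeg j a = 0" using ab(2) unfolding D_def mem_Collect_eq by simp
    then have "vcomp zdeg j v = vcomp zdeg j b"
      unfolding ab(1) vcomp_add by (simp only: add_0_left)
    then have "v = vcomp zdeg j b" using vcomp_gr[OF v, of j] by (simp only: if_True refl)
    also have "\<dots> \<in> J 1" using ab(3) hsub_J[of 1] by (simp add: hsub_def)
    finally show "v \<in> J 1" .
  qed
  then show ?thesis by blast
qed

end

section \<open>Powers of the ideal acting on the module, and their presentations\<close>

locale module_powers = generated_graded_module M r g
  for M :: "(('a::field, 'v::finite) mpol, 'm) graded_module" (structure) and r g +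
  fixes Bs :: "('a, 'v) mpol set" and I :: "('a, 'v) mpol set" and d :: nat
  assumes Bs: "Bs \<subseteq> forms (int d)" and d: "d > 0" and I: "I = genideal polyring Bs"
begin

sublocale ip: ideal_powers r U Bs d
  by unfold_locales (rule hsub_U Bs d)+

abbreviation P :: "nat \<Rightarrow> 'm set" where "P t \<equiv> power_smult I t M"

abbreviation Bspan :: "'m set \<Rightarrow> 'm set"
  where "Bspan N \<equiv> generated_submodule polyring M {b \<odot> y | b y. b \<in> Bs \<and> y \<in> N}"

lemma Bs_I: "Bs \<subseteq> I"
  unfolding I by (rule R.genideal_self) (simp add: ring_of_type_algebra_def)

lemma subBspan: "N \<subseteq> carrier M \<Longrightarrow> submodule (Bspan N) polyring M"
  by (rule generated_submodule) (auto simp: poly_smult)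

text \<open>The polynomials that multiply \<open>N\<close> into \<open>Bspan N\<close> form an ideal
  containing \<open>Bs\<close>, hence contain \<open>I\<close>.\<close>

lemma I_smult:
  assumes N: "N \<subseteq> carrier M" and q: "q \<in> I" and y: "y \<in> N"
  shows "q \<odot> y \<in> Bspan N"
proof -
  note H = submodule_facts[OF subBspan[OF N]]
  let ?Q = "{q. \<forall>y\<in>N. q \<odot> y \<in> Bspan N}"
  have "ideal ?Q polyring"
  proof (rule idealI)
    show "ring (polyring :: ('a, 'v) mpol ring)" by (rule R.ring_axioms)
    show "subgroup ?Q (add_monoid (polyring :: ('a, 'v) mpol ring))"
    proof (rule R.add.subgroupI)
      show "?Q \<subseteq> carrier polyring" by (simp add: ring_of_type_algebra_def)
      have "0 \<in> ?Q" using N H(2) by (auto simp: poly_smult)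
      then show "?Q \<noteq> {}" by blast
      show "a \<oplus>\<^bsub>polyring\<^esub> b \<in> ?Q" if "a \<in> ?Q" "b \<in> ?Q" for a b
      proof -
        have "(a + b) \<odot> y \<in> Bspan N" if "y \<in> N" for y
          using that \<open>a \<in> ?Q\<close> \<open>b \<in> ?Q\<close> N H(3) poly_smult(2)[of y a b] by auto
        then show ?thesis by (simp add: ring_of_type_algebra_def)
      qed
      show "\<ominus>\<^bsub>polyring\<^esub> a \<in> ?Q" if a: "a \<in> ?Q" for a
      proof -
        have "a \<oplus>\<^bsub>polyring\<^esub> (- a) = \<zero>\<^bsub>polyring\<^esub>"
          by (simp add: ring_of_type_algebra_def)
        then have "\<ominus>\<^bsub>polyring\<^esub> a = - a"
          by (intro R.minus_equality) (simp_all add: ring_of_type_algebra_def)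
        moreover have "(- a) \<odot> y \<in> Bspan N" if "y \<in> N" for y
          using a that H(4)[of "a \<odot> y" "- 1"] N poly_smult(3)[of y "- 1" a] by auto
        ultimately show ?thesis by simp
      qed
    qed
    show "x \<otimes>\<^bsub>polyring\<^esub> a \<in> ?Q" "a \<otimes>\<^bsub>polyring\<^esub> x \<in> ?Q" if a: "a \<in> ?Q" for a x
    proof -
      have "(x * a) \<odot> y \<in> Bspan N" if "y \<in> N" for y
        using a that N H(4)[of "a \<odot> y" x] poly_smult(3)[of y x a] by auto
      then show "x \<otimes>\<^bsub>polyring\<^esub> a \<in> ?Q" "a \<otimes>\<^bsub>polyring\<^esub> x \<in> ?Q"
        by (simp_all add: ring_of_type_algebra_def mult.commute)
    qed
  qed
  moreover have "Bs \<subseteq> ?Q"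
    using subset_generated_submodule[of "{b \<odot> y | b y. b \<in> Bs \<and> y \<in> N}" polyring M] by blast
  ultimately have "I \<subseteq> ?Q"
    unfolding I by (rule R.genideal_minimal)
  then show ?thesis using q y by blast
qed

lemma ideal_smult_eq: "ideal_smult polyring I M = Bspan (carrier M)"
proof
  show "ideal_smult polyring I M \<subseteq> Bspan (carrier M)"
    unfolding ideal_smult_def using I_smult[OF order_refl]
    by (intro generated_submodule_minimal subBspan) auto
  show "Bspan (carrier M) \<subseteq> ideal_smult polyring I M"
    unfolding ideal_smult_def using Bs_I by (intro generated_submodule_mono) blast
qed

lemma subP: "submodule (P t) polyring M"
  unfolding ideal_smult_def by (rule generated_submodule) (auto simp: poly_smult)

lemma P_0: "P 0 = carrier M"
proof
  show "P 0 \<subseteq> carrier M" by (rule submodule_facts[OF subP])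
  have one: "I [^]\<^bsub>ideals_set polyring\<^esub> (0::nat) = carrier polyring"
    by (simp add: nat_pow_def ideals_set_def)
  show "carrier M \<subseteq> P 0"
  proof
    fix x assume x: "x \<in> carrier M"
    have "1 \<odot> x \<in> P 0"
      unfolding ideal_smult_def one
      by (rule subsetD[OF subset_generated_submodule], rule CollectI, intro exI conjI refl)
        (use x in \<open>simp_all add: ring_of_type_algebra_def\<close>)
    then show "x \<in> P 0" by (simp only: poly_smult(4)[OF x])
  qed
qed

text \<open>Identifies the powers in the monoid of ideals with repeated multiplication by the
  generating forms, the form in which \<open>ip.G\<close> is defined.\<close>

lemma P_Suc: "P (Suc t) = Bspan (P t)"
proof
  have PM: "P t \<subseteq> carrier M" by (rule submodule_facts[OF subP])
  let ?It = "I [^]\<^bsub>ideals_set polyring\<^esub> t"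
  have pow: "I [^]\<^bsub>ideals_set polyring\<^esub> Suc t = ideal_prod polyring ?It I"
    by (simp add: nat_pow_def ideals_set_def)
  have gen: "a \<odot> x \<in> P t" if "a \<in> ?It" "x \<in> carrier M" for a x
    unfolding ideal_smult_def by (rule subsetD[OF subset_generated_submodule]) (use that in blast)
  note H = submodule_facts[OF subBspan[OF PM]]
  have "c \<odot> x \<in> Bspan (P t)" if "c \<in> ideal_prod polyring ?It I" and x: "x \<in> carrier M" for c x
    using that(1)
  proof (induction rule: ideal_prod.induct)
    case (prod i j)
    have "(i * j) \<odot> x = j \<odot> (i \<odot> x)"
      unfolding mult.commute[of i] by (rule poly_smult(3)[OF x])
    also have "\<dots> \<in> Bspan (P t)" by (rule I_smult[OF PM prod(2) gen[OF prod(1) x]])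
    finally show ?case by (simp add: ring_of_type_algebra_def)
  next
    case (sum s1 s2)
    then have "(s1 + s2) \<odot> x \<in> Bspan (P t)"
      unfolding poly_smult(2)[OF x] by (intro H(3))
    then show ?case by (simp add: ring_of_type_algebra_def)
  qed
  then show "P (Suc t) \<subseteq> Bspan (P t)"
    unfolding pow ideal_smult_def[of polyring "ideal_prod polyring ?It I"]
    by (intro generated_submodule_minimal subBspan PM) blast
  have gen': "a \<odot> x \<in> P (Suc t)" if "a \<in> ideal_prod polyring ?It I" "x \<in> carrier M" for a x
    unfolding ideal_smult_def pow by (rule subsetD[OF subset_generated_submodule]) (use that in blast)
  note H' = submodule_facts[OF subP[of "Suc t"]]
  have "b \<odot> y \<in> P (Suc t)" if b: "b \<in> Bs" and y: "y \<in> P t" for b y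
  proof -
    \<comment> \<open>\<open>P t\<close> is known only through its generators; the elements that
      \<open>b\<close> multiplies into \<open>P (Suc t)\<close> form a submodule, so the generators
      are enough to check.\<close>
    let ?N = "{y \<in> carrier M. b \<odot> y \<in> P (Suc t)}"
    have "submodule ?N polyring M"
    proof (rule poly_submoduleI)
      show "p \<odot> x \<in> ?N" if "x \<in> ?N" for p x
      proof -
        have "b \<odot> (p \<odot> x) = p \<odot> (b \<odot> x)"
          using that poly_smult(3)[of x b p] poly_smult(3)[of x p b] by (simp add: mult.commute)
        then show ?thesis using that H'(4) by (simp add: poly_smult)
      qed
    qed (use H' in \<open>auto simp: poly_smult_r\<close>)
    moreover have "{a \<odot> x | a x. a \<in> ?It \<and> x \<in> carrier M} \<subseteq> ?N"
    proof
      fix z assume "z \<in> {a \<odot> x | a x. a \<in> ?It \<and> x \<in> carrier M}"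
      then obtain a x where ax: "z = a \<odot> x" "a \<in> ?It" "x \<in> carrier M" by blast
      have "a * b \<in> ideal_prod polyring ?It I"
        using ideal_prod.prod[OF ax(2), of b I polyring] b Bs_I by (auto simp: ring_of_type_algebra_def)
      from gen'[OF this ax(3)] have "b \<odot> z \<in> P (Suc t)"
        unfolding ax(1) poly_smult(3)[OF ax(3), symmetric] by (simp add: mult.commute)
      then show "z \<in> ?N" using ax by (simp add: poly_smult)
    qed
    ultimately have "P t \<subseteq> ?N"
      unfolding ideal_smult_def[of polyring ?It] by (rule generated_submodule_minimal)
    then show ?thesis using y by blast
  qed
  then show "Bspan (P t) \<subseteq> P (Suc t)"
    by (intro generated_submodule_minimal[OF subP]) blast
qed

lemma ideal_smult_P: "ideal_smult polyring I M = P 1"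
  unfolding ideal_smult_eq One_nat_def P_Suc P_0 ..

lemma \<pi>_G: "\<pi> ` ip.G t = P t"
proof (induction t)
  case 0
  show ?case unfolding ip.G.simps(1) P_0 by (rule \<pi>_onto)
next
  case (Suc t)
  have PM: "P t \<subseteq> carrier M" by (rule submodule_facts[OF subP])
  let ?S = "{vscale p v | p v. p \<in> Bs \<and> v \<in> ip.G t}"
  show ?case
    unfolding ip.G.simps P_Suc
  proof
    have "?S \<subseteq> {v \<in> free_carrier r. \<pi> v \<in> Bspan (P t)}"
    proof
      fix x assume "x \<in> ?S"
      then obtain p v where pv: "x = vscale p v" "p \<in> Bs" "v \<in> ip.G t" by blast
      then have "x \<in> free_carrier r"
        using ip.G_free[of t] vm.subspace_scale[OF subspace_free_carrier] by blast
      moreover have "\<pi> v \<in> P t" using pv(3) Suc by blast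
      then have "\<pi> x \<in> Bspan (P t)"
        unfolding pv(1) \<pi>_scale by (intro subsetD[OF subset_generated_submodule]) (use pv(2) in blast)
      ultimately show "x \<in> {v \<in> free_carrier r. \<pi> v \<in> Bspan (P t)}" by blast
    qed
    then have "vm.span ?S \<subseteq> {v \<in> free_carrier r. \<pi> v \<in> Bspan (P t)}"
      by (intro vm.span_minimal subspace_preimage subBspan PM)
    then show "\<pi> ` vm.span ?S \<subseteq> Bspan (P t)" by blast
    show "Bspan (P t) \<subseteq> \<pi> ` vm.span ?S"
    proof (rule generated_submodule_minimal[OF submodule_image[OF vm.subspace_span]])
      show "{b \<odot> y | b y. b \<in> Bs \<and> y \<in> P t} \<subseteq> \<pi> ` vm.span ?S"
      proof
        fix z assume "z \<in> {b \<odot> y | b y. b \<in> Bs \<and> y \<in> P t}"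
        then obtain b y where "z = b \<odot> y" "b \<in> Bs" "y \<in> P t" by blast
        then obtain v where bv: "z = b \<odot> \<pi> v" "b \<in> Bs" "v \<in> ip.G t"
          unfolding Suc[symmetric] by blast
        have "vscale b v \<in> vm.span ?S" by (rule vm.span_base) (use bv in blast)
        then show "z \<in> \<pi> ` vm.span ?S" unfolding bv(1) \<pi>_scale[symmetric] by blast
      qed
    qed
  qed
qed

lemma J_iff: "v \<in> ip.J t \<longleftrightarrow> v \<in> free_carrier r \<and> \<pi> v \<in> P t"
proof
  assume v: "v \<in> ip.J t"
  then obtain a u where au: "v = a + u" "a \<in> ip.G t" "u \<in> U" by (auto simp: ip.J_def)
  have "\<pi> v = \<pi> a" using au(3) \<pi>_carr unfolding au(1) \<pi>_add by (simp add: U_def)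
  then have "\<pi> v \<in> P t" using au(2) \<pi>_G by blast
  then show "v \<in> free_carrier r \<and> \<pi> v \<in> P t" using v ip.J_free by blast
next
  assume v: "v \<in> free_carrier r \<and> \<pi> v \<in> P t"
  then obtain a where a: "a \<in> ip.G t" "\<pi> v = \<pi> a" using \<pi>_G by (metis imageE)
  then have "v - a \<in> U" using \<pi>_eq_U[of v a] v ip.G_free[of t] by blast
  moreover have "v = a + (v - a)" by simp
  ultimately show "v \<in> ip.J t" unfolding ip.J_def using a(1) by blast
qed

lemma presented_sub: "presented (graded_sub M (P t)) r zdeg (ip.J t) U \<pi>"
proof (rule presented.intro)
  show "hsub r zdeg (ip.J t)" by (rule ip.hsub_J)
  show "hsub r zdeg U" by (rule hsub_U)
  show "U \<subseteq> ip.J t" by (rule ip.UJ)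
  have "abelian_group (M\<lparr>carrier := P t\<rparr>)"
    using submodule.submodule_is_module[OF subP module_axioms] by (simp add: Module.module_def)
  then show "abelian_group (graded_sub M (P t))"
    by (simp add: graded_sub_def abelian_group_def abelian_monoid_def abelian_group_axioms_def)
  show "\<pi> (u + v) = \<pi> u \<oplus>\<^bsub>graded_sub M (P t)\<^esub> \<pi> v" for u v
    by (simp add: graded_sub_def \<pi>_add)
  show "\<pi> (vscale p u) = p \<odot>\<^bsub>graded_sub M (P t)\<^esub> \<pi> u" for p u
    by (simp add: graded_sub_def \<pi>_scale)
  have onto: "\<exists>v\<in>ip.J t. x = \<pi> v" if "x \<in> P t" for x
    using that \<pi>_G[of t] ip.GJ[of t] by blast
  show "\<pi> ` ip.J t = carrier (graded_sub M (P t))"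
    using onto by (auto simp: graded_sub_def J_iff image_iff)
  show "\<pi> ` pieces r zdeg (ip.J t) j = grade (graded_sub M (P t)) j" for j
  proof
    show "\<pi> ` pieces r zdeg (ip.J t) j \<subseteq> grade (graded_sub M (P t)) j"
      using \<pi>_gr by (auto simp: graded_sub_def pieces_def J_iff)
    show "grade (graded_sub M (P t)) j \<subseteq> \<pi> ` pieces r zdeg (ip.J t) j"
    proof
      fix x assume "x \<in> grade (graded_sub M (P t)) j"
      then have x: "x \<in> grade M j" "x \<in> P t" by (auto simp: graded_sub_def)
      then obtain v where v: "v \<in> gr r zdeg j" "x = \<pi> v" using \<pi>_gr_onto by blast
      then have "v \<in> ip.J t" using x(2) gr_subset by (auto simp: J_iff)
      then show "x \<in> \<pi> ` pieces r zdeg (ip.J t) j" using v by (auto simp: pieces_def)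
    qed
  qed
  show "\<pi> u = \<zero>\<^bsub>graded_sub M (P t)\<^esub> \<longleftrightarrow> u \<in> U" if "u \<in> ip.J t" for u
  proof -
    have "u \<in> free_carrier r" using that ip.J_free by blast
    then show ?thesis by (simp add: graded_sub_def U_def)
  qed
qed

lemma presented_quot:
  "presented (graded_quot M (P t)) r zdeg (free_carrier r) (ip.J t) (\<lambda>v. P t +> \<pi> v)"
proof (rule presented.intro)
  let ?Q = "graded_quot M (P t)"
  have sg: "subgroup (P t) (add_monoid M)" using subP by (rule submodule.axioms(1))
  then have addsg: "additive_subgroup (P t) M" by (rule additive_subgroup.intro)
  have absg: "abelian_subgroup (P t) M"
    by (rule abelian_subgroupI3[OF addsg M.abelian_group_axioms])
  have PM: "P t \<subseteq> carrier M" by (rule submodule_facts[OF subP])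
  show "hsub r zdeg (free_carrier r)" by (rule hsub_free_carrier)
  show "hsub r zdeg (ip.J t)" by (rule ip.hsub_J)
  show "ip.J t \<subseteq> free_carrier r" by (rule ip.J_free)
  interpret C: comm_group "M A_Mod P t"
    by (rule abelian_subgroup.a_factorgroup_is_comm_group[OF absg])
  have fields: "carrier ?Q = carrier (M A_Mod P t)" "add ?Q = monoid.mult (M A_Mod P t)" "\<zero>\<^bsub>?Q\<^esub> = monoid.one (M A_Mod P t)"
    by (simp_all add: graded_quot_def A_FactGroup_def')
  show "abelian_group ?Q"
    by (rule abelian_groupI; unfold fields) (rule C.m_closed C.one_closed C.m_assoc C.m_comm C.l_one C.l_inv_ex; assumption?)+
  show "P t +> \<pi> (u + v) = (P t +> \<pi> u) \<oplus>\<^bsub>?Q\<^esub> (P t +> \<pi> v)" for u v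
    using abelian_subgroup.a_rcos_sum[OF absg \<pi>_carr \<pi>_carr] by (simp add: graded_quot_def \<pi>_add)
  show "P t +> \<pi> (vscale p u) = p \<odot>\<^bsub>?Q\<^esub> (P t +> \<pi> u)" for p u
  proof -
    \<comment> \<open>Scalar multiplication in the quotient is a union over the members of a coset.
      All cosets in this union coincide because \<open>P t\<close> is closed under
      \<open>p\<close>.\<close>
    have "P t +> (p \<odot> x) = P t +> (p \<odot> \<pi> u)" if "x \<in> P t +> \<pi> u" for x
    proof -
      obtain n where n: "n \<in> P t" "x = n \<oplus> \<pi> u" using \<open>x \<in> _\<close> by (auto simp: a_r_coset_def')
      have nM: "n \<in> carrier M" using n(1) PM by blast
      have pn: "p \<odot> n \<in> P t" by (rule submodule_facts(4)[OF subP n(1)])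
      have "p \<odot> x = p \<odot> n \<oplus> p \<odot> \<pi> u"
        unfolding n(2) by (rule poly_smult_r(1)[OF nM \<pi>_carr])
      then have "p \<odot> x \<in> P t +> (p \<odot> \<pi> u)" using pn by (auto simp: a_r_coset_def')
      from M.a_repr_independence[OF this poly_smult(1)[OF \<pi>_carr] sg] show ?thesis by simp
    qed
    moreover have "\<pi> u \<in> P t +> \<pi> u"
      using submodule_facts(2)[OF subP[of t]] \<pi>_carr[of u] by (force simp: a_r_coset_def')
    ultimately have "(\<Union>x\<in>P t +> \<pi> u. P t +> (p \<odot> x)) = P t +> (p \<odot> \<pi> u)"
      by blast
    then show ?thesis by (simp add: graded_quot_def \<pi>_scale)
  qed
  show "(\<lambda>v. P t +> \<pi> v) ` free_carrier r = carrier ?Q"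
    unfolding graded_quot_def partial_object.simps A_RCOSETS_def' \<pi>_onto[symmetric] by blast
  show "(\<lambda>v. P t +> \<pi> v) ` pieces r zdeg (free_carrier r) j = grade ?Q j" for j
    unfolding pieces_free by (simp add: graded_quot_def \<pi>_gr_onto[symmetric] image_image)
  show "P t +> \<pi> u = \<zero>\<^bsub>?Q\<^esub> \<longleftrightarrow> u \<in> ip.J t" if "u \<in> free_carrier r" for u
  proof -
    have "P t +> \<pi> u = P t \<longleftrightarrow> \<pi> u \<in> P t"
      using M.a_coset_join1[OF _ \<pi>_carr sg] M.a_coset_join2[OF \<pi>_carr sg] by blast
    then show ?thesis using that by (simp add: graded_quot_def J_iff)
  qed
qed

theorem regularity_of_powers:
  assumes fl: "finite_length polyring (graded_quot M (ideal_smult polyring I M))"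
    and nfl: "\<not> finite_length polyring M"
  shows "\<exists>f e :: nat \<Rightarrow> int.
    (\<forall>t\<ge>1. reg (graded_quot M (P t)) = ereal (real_of_int (int d * int t + f t - 1))) \<and>
    (\<forall>t\<ge>1. f t \<ge> f (Suc t) \<and> f t \<ge> 0) \<and>
    (\<forall>t\<ge>1. reg (graded_sub M (P t)) = ereal (real_of_int (int d * int t + e t))) \<and>
    (\<forall>t\<ge>1. e t \<ge> e (Suc t) \<and> e t \<ge> 0) \<and>
    (INF t\<in>{1..}. e t) = (INF t\<in>{1..}. f t) \<and>
    (\<exists>t\<^sub>0. \<forall>t\<ge>t\<^sub>0. reg (graded_sub M (P t)) =
       ereal (real_of_int (int d * int t + (INF s\<in>{1..}. e s))))"
proof -
  have nonfin: "\<not> gr r zdeg j \<subseteq> U" if "j \<ge> 0" for j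
    by (rule gr_not_subset_U[OF nfl that])
  have "\<exists>j1. \<forall>j\<ge>j1. gr r zdeg j \<subseteq> ip.J 1"
  proof -
    interpret Q: presented "graded_quot M (P 1)" r zdeg "free_carrier r" "ip.J 1" "\<lambda>v. P 1 +> \<pi> v"
      by (rule presented_quot)
    obtain L l where L: "L 0 = ip.J 1" "L l = free_carrier r" "\<forall>i\<le>l. vm.subspace (L i)"
      "\<forall>i<l. L i \<subseteq> L (Suc i) \<and>
        (\<forall>W. vm.subspace W \<longrightarrow> L i \<subseteq> W \<longrightarrow> W \<subseteq> L (Suc i) \<longrightarrow> W = L i \<or> W = L (Suc i))"
      using Q.finite_length_chain[OF fl[unfolded ideal_smult_P]] by (elim exE conjE)
    show ?thesis
      by (rule ip.eventually_full_if_chain[OF L(1,2)]) (use L(3,4) in auto)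
  qed
  then obtain j1 where fin: "\<And>j. j \<ge> j1 \<Longrightarrow> gr r zdeg j \<subseteq> ip.J 1" by blast
  note facts = ip.E_ge[OF fin nonfin] ip.E_Suc[OF fin nonfin] ip.R_ge[OF fin nonfin] ip.R_Suc[OF fin nonfin]
  define f where "f t = ip.E t + 1 - int d * int t" for t
  define e where "e t = ip.R t - int d * int t" for t
  have quot: "reg (graded_quot M (P t)) = ereal (real_of_int (int d * int t + f t - 1))" if t: "t \<ge> 1" for t
  proof -
    have "reg (graded_quot M (P t)) = ereal (real_of_int (ip.E t))"
      using ip.Q_bound[OF fin nonfin t] ip.Q_top[OF fin nonfin t]
      by (rule presented.reg_eqI[OF presented_quot])
    then show ?thesis by (simp add: f_def)
  qed
  have sub: "reg (graded_sub M (P t)) = ereal (real_of_int (int d * int t + e t))" if t: "t \<ge> 1" for t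
  proof -
    obtain i where "ip.T t i (ip.R t + int i)" using ip.R_attained[OF fin nonfin t] by blast
    then have "reg (graded_sub M (P t)) = ereal (real_of_int (ip.R t))"
      using ip.R_bound[OF fin nonfin t] by (intro presented.reg_eqI[OF presented_sub]) auto
    then show ?thesis by (simp add: e_def)
  qed
  have f: "f (Suc t) \<le> f t" "f t \<ge> 0" if "t \<ge> 1" for t
    using facts(1,2)[OF _ _ that] by (auto simp: f_def algebra_simps)
  have e: "e (Suc t) \<le> e t" "e t \<ge> 0" if "t \<ge> 1" for t
    using facts(3,4)[OF _ _ that] by (auto simp: e_def algebra_simps)
  obtain t1 where t1: "t1 \<ge> 1" "\<And>t. t \<ge> t1 \<Longrightarrow> e t = (INF s\<in>{1..}. e s)"
    using antitone_int_INF[of e] e by blast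
  obtain t2 where t2: "t2 \<ge> 1" "\<And>t. t \<ge> t2 \<Longrightarrow> f t = (INF s\<in>{1..}. f s)"
    using antitone_int_INF[of f] f by blast
  obtain t3 where t3: "\<And>t. t \<ge> t3 \<Longrightarrow> e t = f t"
    using ip.R_eq_E[OF fin nonfin] by (auto simp: e_def f_def)
  \<comment> \<open>An index past all three thresholds: there both sequences have reached their
    infima and agree with each other.\<close>
  let ?t = "max t1 (max t2 t3)"
  have "(INF s\<in>{1..}. e s) = (INF s\<in>{1..}. f s)"
    using t1(2)[of ?t] t2(2)[of ?t] t3[of ?t] by simp
  moreover have "reg (graded_sub M (P t)) = ereal (real_of_int (int d * int t + (INF s\<in>{1..}. e s)))"
    if "t \<ge> t1" for t
    using sub[of t] t1(1) t1(2)[OF that] that by simp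
  ultimately show ?thesis
    using quot f sub e by blast
qed

end

text \<open>Finite generation and generation in degree 0 are separate hypotheses, and the given
  finite generators may have any degree. The elements generated by some finite subset of degree 0
  form a submodule containing that degree, hence everything; collecting such subsets for the finite
  generators suffices.\<close>

lemma (in graded_module) finite_generators_in_degree_0:
  assumes fg: "finitely_generated polyring M"
    and gen: "generated_submodule polyring M (grade M 0) = carrier M"
  shows "\<exists>S. finite S \<and> S \<subseteq> grade M 0 \<and> generated_submodule polyring M S = carrier M"
proof -
  have sub: "submodule (generated_submodule polyring M S) polyring M" if "S \<subseteq> grade M 0" for S
    using that grade_facts(1) by (intro generated_submodule) blast
  let ?N = "{y \<in> carrier M. \<exists>S. finite S \<and> S \<subseteq> grade M 0 \<and> y \<in> generated_submodule polyring M S}"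
  have "submodule ?N polyring M"
  proof (rule poly_submoduleI)
    show "\<zero> \<in> ?N"
      using submodule_facts(2)[OF sub[of "{}"]] by auto
    show "x \<oplus> y \<in> ?N" if xy: "x \<in> ?N" "y \<in> ?N" for x y
    proof -
      obtain S S' where S: "finite S" "S \<subseteq> grade M 0" "x \<in> generated_submodule polyring M S"
        "finite S'" "S' \<subseteq> grade M 0" "y \<in> generated_submodule polyring M S'" using xy by blast
      then have "x \<in> generated_submodule polyring M (S \<union> S')" "y \<in> generated_submodule polyring M (S \<union> S')"
        using generated_submodule_mono[of S "S \<union> S'" polyring M] generated_submodule_mono[of S' "S \<union> S'" polyring M] by auto
      then have "x \<oplus> y \<in> generated_submodule polyring M (S \<union> S')"
        using submodule_facts(3)[OF sub[of "S \<union> S'"]] S by simp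
      then show ?thesis using S xy by (auto intro!: exI[of _ "S \<union> S'"])
    qed
    show "p \<odot> x \<in> ?N" if "x \<in> ?N" for p x
      using that submodule_facts(4)[OF sub] by (auto simp: poly_smult)
  qed auto
  moreover have "grade M 0 \<subseteq> ?N"
  proof
    fix y assume y: "y \<in> grade M 0"
    then have "y \<in> generated_submodule polyring M {y}"
      using subset_generated_submodule[of "{y}" polyring M] by blast
    then show "y \<in> ?N" using y grade_facts(1) by blast
  qed
  ultimately have all: "carrier M \<subseteq> ?N"
    unfolding gen[symmetric] by (rule generated_submodule_minimal)
  obtain Y where Y: "finite Y" "Y \<subseteq> carrier M" "generated_submodule polyring M Y = carrier M"
    using fg by (auto simp: finitely_generated_def)
  have "\<forall>y\<in>Y. \<exists>S. finite S \<and> S \<subseteq> grade M 0 \<and> y \<in> generated_submodule polyring M S"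
    using Y(2) all by blast
  then obtain S where S: "\<And>y. y \<in> Y \<Longrightarrow> finite (S y)" "\<And>y. y \<in> Y \<Longrightarrow> S y \<subseteq> grade M 0"
    "\<And>y. y \<in> Y \<Longrightarrow> y \<in> generated_submodule polyring M (S y)"
    by metis
  let ?S = "\<Union>y\<in>Y. S y"
  have "?S \<subseteq> grade M 0" using S(2) by blast
  moreover have "Y \<subseteq> generated_submodule polyring M ?S"
  proof
    fix y assume "y \<in> Y"
    then show "y \<in> generated_submodule polyring M ?S"
      using S(3)[of y] generated_submodule_mono[of "S y" ?S polyring M] by blast
  qed
  ultimately have "carrier M \<subseteq> generated_submodule polyring M ?S"
    unfolding Y(3)[symmetric] by (intro generated_submodule_minimal sub)
  moreover have "generated_submodule polyring M ?S \<subseteq> carrier M"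
    using submodule_facts(1)[OF sub[OF \<open>?S \<subseteq> grade M 0\<close>]] .
  ultimately show ?thesis
    using Y(1) S(1) \<open>?S \<subseteq> grade M 0\<close> by (intro exI[of _ ?S]) auto
qed

theorem proposition1p1:
  fixes M :: "(('a::field, 'v::finite) mpol, 'm) graded_module"
    and I :: "('a, 'v) mpol set"
    and d :: nat
  assumes "graded_module M"
    and "finitely_generated polyring M"
    and "generated_submodule polyring M (grade M 0) = carrier M"
    and "d > 0"
    and "\<exists>B \<subseteq> forms (int d). I = genideal polyring B"
    and "finite_length polyring (graded_quot M (ideal_smult polyring I M))"
    and "\<not> finite_length polyring M"
  shows "\<exists>f e :: nat \<Rightarrow> int.
    (\<forall>t\<ge>1. reg (graded_quot M (power_smult I t M)) = ereal (real_of_int (int d * int t + f t - 1))) \<and>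
    (\<forall>t\<ge>1. f t \<ge> f (Suc t) \<and> f t \<ge> 0) \<and>
    (\<forall>t\<ge>1. reg (graded_sub M (power_smult I t M)) = ereal (real_of_int (int d * int t + e t))) \<and>
    (\<forall>t\<ge>1. e t \<ge> e (Suc t) \<and> e t \<ge> 0) \<and>
    (INF t\<in>{1..}. e t) = (INF t\<in>{1..}. f t) \<and>
    (\<exists>t\<^sub>0. \<forall>t\<ge>t\<^sub>0. reg (graded_sub M (power_smult I t M)) =
       ereal (real_of_int (int d * int t + (INF s\<in>{1..}. e s))))"
proof -
  obtain B where B: "B \<subseteq> forms (int d)" "I = genideal polyring B" using assms(5) by blast
  obtain S where S: "finite S" "S \<subseteq> grade M 0" "generated_submodule polyring M S = carrier M"
    using graded_module.finite_generators_in_degree_0[OF assms(1-3)] by blast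
  obtain g where g: "bij_betw g {..<card S} S"
    using ex_bij_betw_nat_finite[OF S(1)] by (auto simp: atLeast0LessThan)
  have "generated_graded_module M (card S) g"
    using assms(1) S(2,3) bij_betw_imp_surj_on[OF g]
    by (intro generated_graded_module.intro generated_graded_module_axioms.intro) auto
  then have "module_powers M (card S) g B I d"
    using B assms(4) by (intro module_powers.intro module_powers_axioms.intro) auto
  then show ?thesis
    using assms(6,7) by (rule module_powers.regularity_of_powers)
qed

end
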